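(* Let $d\in\{1,2,3\}$, $t>0$, and let $\sigma(t,D_x)f=f*\mu_t$ be the wave multiplier, where $\mu_t$ is the positive Borel measure with (formal) density $m_t$ with respect to Lebesgue measure, $d\mu_t(y)=m_t(y)\,dy$. The Wigner kernel of $\sigma(t,D_x)$ is given by $$k_W(x,\xi,y,\eta)=\delta(\eta-\xi)\int_{\mathbb{R}^d}e^{-2\pi i r\cdot\xi}\,m_t\left(x-y+\tfrac r2\right)m_t\left(x-y-\tfrac r2\right)dr=\delta(\eta-\xi)\,Wm_t(x-y,\xi).$$
   Context: Fourier transform: $\widehat f(\xi)=\int f(x)e^{-2\pi i x\cdot\xi}dx$. $\sigma(t,D_x)$ is the Fourier multiplier with symbol $\sigma(t,\xi)=\frac{\sin(2\pi|\xi|t)}{2\pi|\xi|}$ (propagator of $\partial_{tt}u-\Delta u=0$, $u(0,\cdot)=0$, $\partial_tu(0,\cdot)=f$). For $d=1$: $d\mu_t(y)=\frac12\chi_{[-t,t]}(y)dy$; for $d=2$: $d\mu_t(y)=(2\pi)^{-1}(t^2-|y|^2)_+^{-1/2}dy$; for $d=3$: $d\mu_t=(4\pi t)^{-1}d\sigma_{\partial B_t(0)}$ (surface measure on the sphere of radius $t$). In $d=3$ the notation $m_t$ is formal: $m_t$ stands for the measure $\mu_t\in\mathcal{S}'(\mathbb{R}^d)$. Cross-Wigner distribution: $W(f,g)(x,\xi)=\int_{\mathbb{R}^d}f(x+\frac y2)\overline{g(x-\frac y2)}e^{-2\pi i y\cdot\xi}dy$, extended to tempered distributions, $Wf=W(f,f)$;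 the integrals are understood distributionally. The Wigner kernel of a continuous linear $T:\mathcal{S}(\mathbb{R}^d)\to\mathcal{S}'(\mathbb{R}^d)$ is the unique $k_W\in\mathcal{S}'(\mathbb{R}^{4d})$ with $W(Tf,Tg)(z)=\int_{\mathbb{R}^{2d}}k_W(z,w)W(f,g)(w)\,dw$ for all $f,g\in\mathcal{S}(\mathbb{R}^d)$, $z=(x,\xi)$, $w=(y,\eta)$. $\delta(\eta-\xi)F(x-y,\xi)$ denotes the tempered distribution $\Phi\mapsto\langle F(s,\xi),\int_{\mathbb{R}^d}\Phi(y+s,\xi,y,\xi)\,dy\rangle$ (bilinear pairing in $(s,\xi)$). *)

theory Defs
  imports "HOL-Analysis.Analysis"
begin

section \<open>Schwartz functions and tempered distributions\<close>

text \<open>Multi-indices are represented by lists of basis vectors: \<open>iter_deriv [v1, ..., vn] f\<close> is the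
  iterated partial derivative of \<open>f\<close> in the directions \<open>vn\<close>, ..., \<open>v1\<close>.\<close>

fun iter_deriv :: "'a list \<Rightarrow> ('a::euclidean_space \<Rightarrow> complex) \<Rightarrow> 'a \<Rightarrow> complex" where
  "iter_deriv [] f = f"
| "iter_deriv (v # vs) f = (\<lambda>x. frechet_derivative (iter_deriv vs f) (at x) v)"

definition schwartz :: "('a::euclidean_space \<Rightarrow> complex) set" where
  "schwartz = {f. \<forall>vs. set vs \<subseteq> Basis \<longrightarrow>
     (\<forall>x. iter_deriv vs f differentiable (at x)) \<and>
     (\<forall>k::nat. bdd_above (range (\<lambda>x. norm x ^ k * norm (iter_deriv vs f x))))}"

definition schwartz_seminorm :: "nat \<Rightarrow> 'a list \<Rightarrow> ('a::euclidean_space \<Rightarrow> complex) \<Rightarrow> real" where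
  "schwartz_seminorm k vs f = (SUP x. norm x ^ k * norm (iter_deriv vs f x))"

text \<open>A distribution is a functional on all functions of which only the values on \<open>schwartz\<close>
  matter; equality of distributions is equality on \<open>schwartz\<close>. Pairings are bilinear.\<close>

definition tempered_distribution :: "(('a::euclidean_space \<Rightarrow> complex) \<Rightarrow> complex) \<Rightarrow> bool" where
  "tempered_distribution u \<longleftrightarrow>
     (\<forall>\<phi>\<in>schwartz. \<forall>\<psi>\<in>schwartz. u (\<lambda>x. \<phi> x + \<psi> x) = u \<phi> + u \<psi>) \<and>
     (\<forall>c. \<forall>\<phi>\<in>schwartz. u (\<lambda>x. c * \<phi> x) = c * u \<phi>) \<and>
     (\<exists>C N. \<forall>\<phi>\<in>schwartz. norm (u \<phi>) \<le>
        C * (\<Sum>k\<le>N. \<Sum>vs | set vs \<subseteq> Basis \<and> length vs \<le> N. schwartz_seminorm k vs \<phi>))"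

text \<open>Continuous linear operators from \<open>S\<close> to \<open>S'\<close>, where \<open>S'\<close> carries the weak-* topology:
  the second clause says that \<open>f \<mapsto> \<langle>T f, \<phi>\<rangle>\<close> is linear and continuous on \<open>S\<close>.\<close>

definition continuous_linear_to_tempered ::
    "(('a::euclidean_space \<Rightarrow> complex) \<Rightarrow> ('a \<Rightarrow> complex) \<Rightarrow> complex) \<Rightarrow> bool" where
  "continuous_linear_to_tempered T \<longleftrightarrow>
     (\<forall>f\<in>schwartz. tempered_distribution (T f)) \<and>
     (\<forall>\<phi>\<in>schwartz. tempered_distribution (\<lambda>f. T f \<phi>))"

definition function_distr :: "('a::euclidean_space \<Rightarrow> complex) \<Rightarrow> ('a \<Rightarrow> complex) \<Rightarrow> complex" where
  "function_distr h \<phi> = (\<integral>x. h x * \<phi> x \<partial>lborel)"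

definition measure_distr :: "'a::euclidean_space measure \<Rightarrow> ('a \<Rightarrow> complex) \<Rightarrow> complex" where
  "measure_distr \<mu> \<phi> = (\<integral>x. \<phi> x \<partial>\<mu>)"

definition cnj_distr :: "(('a \<Rightarrow> complex) \<Rightarrow> complex) \<Rightarrow> ('a \<Rightarrow> complex) \<Rightarrow> complex" where
  "cnj_distr u \<phi> = cnj (u (\<lambda>x. cnj (\<phi> x)))"

definition tensor_distr ::
    "(('a \<Rightarrow> complex) \<Rightarrow> complex) \<Rightarrow> (('b \<Rightarrow> complex) \<Rightarrow> complex) \<Rightarrow> ('a \<times> 'b \<Rightarrow> complex) \<Rightarrow> complex" where
  "tensor_distr u v \<Psi> = u (\<lambda>x. v (\<lambda>y. \<Psi> (x, y)))"


section \<open>Fourier multipliers and the Wigner distribution\<close>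

definition fourier :: "('a::euclidean_space \<Rightarrow> complex) \<Rightarrow> 'a \<Rightarrow> complex" where
  "fourier f \<xi> = (\<integral>x. f x * cis (- 2 * pi * (x \<bullet> \<xi>)) \<partial>lborel)"

definition inverse_fourier :: "('a::euclidean_space \<Rightarrow> complex) \<Rightarrow> 'a \<Rightarrow> complex" where
  "inverse_fourier f x = (\<integral>\<xi>. f \<xi> * cis (2 * pi * (x \<bullet> \<xi>)) \<partial>lborel)"

definition fourier_multiplier ::
    "('a::euclidean_space \<Rightarrow> complex) \<Rightarrow> ('a \<Rightarrow> complex) \<Rightarrow> 'a \<Rightarrow> complex" where
  "fourier_multiplier m f = inverse_fourier (\<lambda>\<xi>. m \<xi> * fourier f \<xi>)"

definition cross_wigner ::
    "('a::euclidean_space \<Rightarrow> complex) \<Rightarrow> ('a \<Rightarrow> complex) \<Rightarrow> 'a \<times> 'a \<Rightarrow> complex" where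
  "cross_wigner f g = (\<lambda>(x, \<xi>).
     \<integral>y. f (x + (1/2) *\<^sub>R y) * cnj (g (x - (1/2) *\<^sub>R y)) * cis (- 2 * pi * (y \<bullet> \<xi>)) \<partial>lborel)"

text \<open>The extension of \<open>cross_wigner\<close> to tempered distributions. For functions \<open>f, g\<close>, substituting
  \<open>a = x + y/2\<close>, \<open>b = x - y/2\<close> (Jacobian 1) in \<open>\<langle>W(f,g), \<Phi>\<rangle>\<close> gives
  \<open>\<integral>\<integral> f(a) cnj(g(b)) (\<integral> \<Phi>((a+b)/2, \<xi>) e^(-2\<pi>i(a-b)\<cdot>\<xi>) d\<xi>) da db\<close>.\<close>

definition wigner_distr ::
    "(('a::euclidean_space \<Rightarrow> complex) \<Rightarrow> complex) \<Rightarrow> (('a \<Rightarrow> complex) \<Rightarrow> complex) \<Rightarrow>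
     ('a \<times> 'a \<Rightarrow> complex) \<Rightarrow> complex" where
  "wigner_distr u v \<Phi> = tensor_distr u (cnj_distr v)
     (\<lambda>(a, b). \<integral>\<xi>. \<Phi> ((1/2) *\<^sub>R (a + b), \<xi>) * cis (- 2 * pi * ((a - b) \<bullet> \<xi>)) \<partial>lborel)"

text \<open>\<open>W(Tf,Tg)(z) = \<integral> k(z,w) W(f,g)(w) dw\<close> in the sense of distributions in \<open>z\<close>.\<close>

definition wigner_kernel_identity ::
    "(('a::euclidean_space \<Rightarrow> complex) \<Rightarrow> ('a \<Rightarrow> complex) \<Rightarrow> complex) \<Rightarrow>
     ((('a \<times> 'a) \<times> ('a \<times> 'a) \<Rightarrow> complex) \<Rightarrow> complex) \<Rightarrow> bool" where
  "wigner_kernel_identity T k \<longleftrightarrow>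
     (\<forall>f\<in>schwartz. \<forall>g\<in>schwartz. \<forall>\<Phi>\<in>schwartz.
        wigner_distr (T f) (T g) \<Phi> = k (\<lambda>(z, w). \<Phi> z * cross_wigner f g w))"

definition is_wigner_kernel ::
    "(('a::euclidean_space \<Rightarrow> complex) \<Rightarrow> ('a \<Rightarrow> complex) \<Rightarrow> complex) \<Rightarrow>
     ((('a \<times> 'a) \<times> ('a \<times> 'a) \<Rightarrow> complex) \<Rightarrow> complex) \<Rightarrow> bool" where
  "is_wigner_kernel T k \<longleftrightarrow>
     continuous_linear_to_tempered T \<and>
     tempered_distribution k \<and> wigner_kernel_identity T k \<and>
     (\<forall>k'. tempered_distribution k' \<and> wigner_kernel_identity T k' \<longrightarrow>
        (\<forall>\<Psi>\<in>schwartz. k' \<Psi> = k \<Psi>))"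

text \<open>The distribution \<open>\<delta>(\<eta> - \<xi>) F(x - y, \<xi>)\<close> in the variables \<open>((x, \<xi>), (y, \<eta>))\<close>.\<close>

definition delta_kernel ::
    "(('a::euclidean_space \<times> 'a \<Rightarrow> complex) \<Rightarrow> complex) \<Rightarrow>
     (('a \<times> 'a) \<times> ('a \<times> 'a) \<Rightarrow> complex) \<Rightarrow> complex" where
  "delta_kernel F \<Phi> = F (\<lambda>(s, \<xi>). \<integral>y. \<Phi> ((y + s, \<xi>), (y, \<xi>)) \<partial>lborel)"


section \<open>The wave propagator\<close>

text \<open>At \<open>\<xi> = 0\<close> the symbol is extended by continuity.\<close>

definition wave_symbol :: "real \<Rightarrow> 'a::euclidean_space \<Rightarrow> real" where
  "wave_symbol t \<xi> =
     (if \<xi> = 0 then t else sin (2 * pi * norm \<xi> * t) / (2 * pi * norm \<xi>))"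

definition wave_multiplier :: "real \<Rightarrow> ('a::euclidean_space \<Rightarrow> complex) \<Rightarrow> 'a \<Rightarrow> complex" where
  "wave_multiplier t = fourier_multiplier (\<lambda>\<xi>. complex_of_real (wave_symbol t \<xi>))"

text \<open>Surface measure on the sphere of radius \<open>t > 0\<close> about \<open>0\<close> in dimension \<open>n\<close>, defined through
  solid cones: a Borel subset \<open>E\<close> of the sphere has measure \<open>n/t\<close> times the Lebesgue measure of
  \<open>{r x | 0 < r < 1, x \<in> E}\<close>. The origin, where radial projection is undefined, is a null set.\<close>

definition sphere_surface_measure :: "real \<Rightarrow> 'a::euclidean_space measure" where
  "sphere_surface_measure t =
     scale_measure (ennreal (real DIM('a) / t))
       (distr (restrict_space lborel (ball 0 t)) borel (\<lambda>x. (t / norm x) *\<^sub>R x))"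

text \<open>The density \<open>m\<^sub>t\<close> in dimensions 1 (first case) and 2 (second case).\<close>

definition wave_density :: "real \<Rightarrow> 'a::euclidean_space \<Rightarrow> real" where
  "wave_density t y =
     (if DIM('a) = 1 then (if norm y \<le> t then 1/2 else 0)
      else (if norm y < t then 1 / (2 * pi * sqrt (t\<^sup>2 - (norm y)\<^sup>2)) else 0))"

text \<open>Only meaningful in dimensions 1, 2 and 3.\<close>

definition wave_measure :: "real \<Rightarrow> 'a::euclidean_space measure" where
  "wave_measure t =
     (if DIM('a) = 3 then scale_measure (ennreal (1 / (4 * pi * t))) (sphere_surface_measure t)
      else density lborel (\<lambda>y. ennreal (wave_density t y)))"

definition convolution_measure ::
    "('a::euclidean_space \<Rightarrow> complex) \<Rightarrow> 'a measure \<Rightarrow> 'a \<Rightarrow> complex" where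
  "convolution_measure f \<mu> x = (\<integral>y. f (x - y) \<partial>\<mu>)"

text \<open>The distribution \<open>\<integral> e^(-2\<pi>i r\<cdot>\<xi>) m\<^sub>t(s + r/2) m\<^sub>t(s - r/2) dr\<close> in \<open>(s, \<xi>)\<close>. In dimensions 1 and 2
  it is the function given by this integral, which converges for almost every \<open>s\<close>. In dimension 3,
  where \<open>m\<^sub>t\<close> is only formal, \<open>m\<^sub>t(s + r/2) m\<^sub>t(s - r/2) ds dr\<close> stands for the image of \<open>\<mu>\<^sub>t \<otimes> \<mu>\<^sub>t\<close>
  under \<open>(a, b) \<mapsto> (s, r) = ((a + b)/2, a - b)\<close>, and the integral is its Fourier transform in \<open>r\<close>.\<close>

definition wave_wigner_integral :: "real \<Rightarrow> ('a::euclidean_space \<times> 'a \<Rightarrow> complex) \<Rightarrow> complex" where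
  "wave_wigner_integral t \<Phi> =
     (if DIM('a) = 3 then
        (\<integral>(s, r). (\<integral>\<xi>. \<Phi> (s, \<xi>) * cis (- 2 * pi * (r \<bullet> \<xi>)) \<partial>lborel)
           \<partial>(distr (wave_measure t \<Otimes>\<^sub>M wave_measure t) borel
               (\<lambda>(a, b). ((1/2) *\<^sub>R (a + b), a - b))))
      else
        function_distr
          (\<lambda>(s, \<xi>). \<integral>r. cis (- 2 * pi * (r \<bullet> \<xi>)) *
             complex_of_real (wave_density t (s + (1/2) *\<^sub>R r) * wave_density t (s - (1/2) *\<^sub>R r))
             \<partial>lborel)
          \<Phi>)"

end

theory Submission
  imports Defs "HOL-Probability.Characteristic_Functions" "HOL-Probability.Sinc_Integral"
begin

text \<open>The multiplier is a convolution because \<open>\<mu>\<^sub>t\<close> has the symbol as Fourier transform: the projection of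
  \<open>\<mu>\<^sub>t\<close> to any line through the origin is half of Lebesgue measure on \<open>[-t, t]\<close> in all three dimensions.
  The kernel identity is Fubini's theorem together with the measure-preserving substitution
  \<open>(s, r) \<mapsto> (s + r/2, s - r/2)\<close>. A Wigner kernel is unique because the functions \<open>\<Phi> \<otimes> W(f, g)\<close>
  include, up to a factor, all time-frequency shifts of a fixed Gaussian on \<open>\<real>\<^sup>4\<^sup>d\<close>, and these span a
  dense subspace of the Schwartz space.\<close>


section \<open>Schwartz functions\<close>

text \<open>All dimensions meet in one number, \<open>wigner_pairing\<close>: the integral of
  \<open>weyl_symbol_kernel F\<close> against the product of the wave measure with itself. It refers
  to no density, so dimension 3 is no exception, and it makes sense for every F dominated by an
  integrable function of the frequency alone. This weak class, \<open>slice_bounded\<close>, shapes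
  the existence half: the kernel is evaluated at \<Phi> \<otimes> W(f, g), and the diagonal slice of
  such a function lies in the class by an L1 estimate that involves no smoothness of W(f, g).
  Uniqueness meets the opposite obstacle. A competing kernel is known only through linearity and a
  bound by finitely many seminorms, so every approximation has to converge in all seminorms, and an
  integral under such a functional has to be replaced by Riemann sums. Here W(f, g) is computed
  explicitly for Gaussians: from exp (- pi |x|^2) it has exponent - 2 pi |w|^2, the origin of the
  constant 2 in the fixed Gaussian.\<close>

abbreviation pd :: "'a::euclidean_space \<Rightarrow> ('a \<Rightarrow> complex) \<Rightarrow> 'a \<Rightarrow> complex" where
  "pd v f \<equiv> \<lambda>x. frechet_derivative f (at x) v"

text \<open>The weight \<open>1 + norm x\<close> is at least 1 and submultiplicative under addition
  of vectors, so its powers are increasing in k and behave well under products and shifts; bare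
  powers of \<open>norm x\<close> do neither near 0.\<close>

definition rapid :: "('a::euclidean_space \<Rightarrow> complex) \<Rightarrow> bool" where
  "rapid f \<longleftrightarrow> (\<forall>k. \<exists>C. \<forall>x. (1 + norm x) ^ k * norm (f x) \<le> C)"

lemma one_plus_power_le:
  fixes r :: real
  assumes "r \<ge> 0"
  shows "(1 + r) ^ k \<le> 2 ^ k * (1 + r ^ k)"
proof -
  have "(1 + r) ^ k \<le> (2 * max 1 r) ^ k"
    using assms by (intro power_mono) auto
  also have "\<dots> = 2 ^ k * max 1 r ^ k" by (simp add: power_mult_distrib)
  also have "\<dots> \<le> 2 ^ k * (1 + r ^ k)"
    using assms by (intro mult_left_mono) (auto simp: max_def)
  finally show ?thesis .
qed

lemma rapid_iff_bdd:
  "rapid f \<longleftrightarrow> (\<forall>k. bdd_above (range (\<lambda>x. norm x ^ k * norm (f x))))"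
proof (intro iffI allI)
  fix k assume "rapid f"
  then obtain C where C: "(1 + norm x) ^ k * norm (f x) \<le> C" for x
    unfolding rapid_def by blast
  have "norm x ^ k * norm (f x) \<le> C" for x
  proof -
    have "norm x ^ k * norm (f x) \<le> (1 + norm x) ^ k * norm (f x)"
      by (intro mult_right_mono power_mono) auto
    with C[of x] show ?thesis by linarith
  qed
  then show "bdd_above (range (\<lambda>x. norm x ^ k * norm (f x)))"
    by (auto simp: bdd_above_def)
next
  assume a: "\<forall>k. bdd_above (range (\<lambda>x. norm x ^ k * norm (f x)))"
  show "rapid f" unfolding rapid_def
  proof
    fix k
    obtain A where A: "\<And>x. norm x ^ 0 * norm (f x) \<le> A"
      using a[rule_format, of 0] by (auto simp: bdd_above_def)
    obtain B where B: "\<And>x. norm x ^ k * norm (f x) \<le> B"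
      using a[rule_format, of k] by (auto simp: bdd_above_def)
    have "(1 + norm x) ^ k * norm (f x) \<le> 2 ^ k * (A + B)" for x
    proof -
      have "(1 + norm x) ^ k * norm (f x) \<le> (2 ^ k * (1 + norm x ^ k)) * norm (f x)"
        by (intro mult_right_mono one_plus_power_le) auto
      also have "\<dots> = 2 ^ k * (norm x ^ 0 * norm (f x) + norm x ^ k * norm (f x))"
        by (simp add: algebra_simps)
      also have "\<dots> \<le> 2 ^ k * (A + B)" using A[of x] B[of x] by (intro mult_left_mono) auto
      finally show ?thesis .
    qed
    then show "\<exists>C. \<forall>x. (1 + norm x) ^ k * norm (f x) \<le> C" by blast
  qed
qed

lemma rapidE:
  assumes "rapid f"
  obtains C where "C > 0" "\<And>x. (1 + norm x) ^ k * norm (f x) \<le> C"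
proof -
  obtain C where C: "\<And>x. (1 + norm x) ^ k * norm (f x) \<le> C"
    using assms unfolding rapid_def by blast
  show ?thesis by (rule that[of "max 1 C"]) (simp_all add: le_max_iff_disj C)
qed

lemma rapid_add: "rapid f \<Longrightarrow> rapid g \<Longrightarrow> rapid (\<lambda>x. f x + g x)"
  unfolding rapid_def
proof
  fix k assume f: "\<forall>k. \<exists>C. \<forall>x. (1 + norm x) ^ k * norm (f x) \<le> C"
    and g: "\<forall>k. \<exists>C. \<forall>x. (1 + norm x) ^ k * norm (g x) \<le> C"
  obtain A B where A: "\<And>x. (1 + norm x) ^ k * norm (f x) \<le> A" and B: "\<And>x. (1 + norm x) ^ k * norm (g x) \<le> B"
    using f[rule_format, of k] g[rule_format, of k] by blast
  have "(1 + norm x) ^ k * norm (f x + g x) \<le> A + B" for x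
  proof -
    have "(1 + norm x) ^ k * norm (f x + g x) \<le> (1 + norm x) ^ k * (norm (f x) + norm (g x))"
      by (intro mult_left_mono norm_triangle_ineq) auto
    also have "\<dots> \<le> A + B" using A[of x] B[of x] by (simp add: algebra_simps)
    finally show ?thesis .
  qed
  then show "\<exists>C. \<forall>x. (1 + norm x) ^ k * norm (f x + g x) \<le> C" by blast
qed

lemma rapid_mult_poly_growth:
  assumes "rapid f" and b: "\<And>x. norm (a x) \<le> D * (1 + norm x) ^ m"
  shows "rapid (\<lambda>x. a x * f x)"
  unfolding rapid_def
proof
  fix k
  obtain C where C: "\<And>x. (1 + norm x) ^ (k + m) * norm (f x) \<le> C"
    using assms(1) unfolding rapid_def by blast
  have D: "D \<ge> 0" using order_trans[OF norm_ge_zero b[of 0]] by simp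
  have "(1 + norm x) ^ k * norm (a x * f x) \<le> D * C" for x
  proof -
    have "(1 + norm x) ^ k * norm (a x * f x) \<le> (1 + norm x) ^ k * ((D * (1 + norm x) ^ m) * norm (f x))"
      unfolding norm_mult by (intro mult_left_mono mult_right_mono b) auto
    also have "\<dots> = D * ((1 + norm x) ^ (k + m) * norm (f x))" by (simp add: power_add algebra_simps)
    also have "\<dots> \<le> D * C" using D by (intro mult_left_mono C)
    finally show ?thesis .
  qed
  then show "\<exists>C. \<forall>x. (1 + norm x) ^ k * norm (a x * f x) \<le> C" by blast
qed

lemma rapid_cmult: "rapid f \<Longrightarrow> rapid (\<lambda>x. c * f x)"
  using rapid_mult_poly_growth[of f "\<lambda>_. c" "norm c" 0] by simp

section \<open>Closure properties of the Schwartz space\<close>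

lemma schwartz_iff:
  "f \<in> schwartz \<longleftrightarrow> (\<forall>vs. set vs \<subseteq> Basis \<longrightarrow>
     (\<forall>x. iter_deriv vs f differentiable (at x)) \<and> rapid (iter_deriv vs f))"
  unfolding schwartz_def rapid_iff_bdd by simp

lemma iter_deriv_append: "iter_deriv (vs @ ws) f = iter_deriv vs (iter_deriv ws f)"
  by (induction vs) auto

text \<open>Membership in \<open>schwartz\<close> by coinduction: it suffices to find a set of rapidly decreasing
  differentiable functions that is closed under the partial derivatives.\<close>

lemma schwartz_coinduct:
  assumes "f \<in> S"
    and step: "\<And>f. f \<in> S \<Longrightarrow> (\<forall>x. f differentiable (at x)) \<and> rapid f \<and> (\<forall>v\<in>Basis. pd v f \<in> S)"
  shows "f \<in> schwartz"
proof -
  have "iter_deriv vs f \<in> S" if "set vs \<subseteq> Basis" for vs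
    using that by (induction vs) (auto simp: assms(1) step)
  then show ?thesis unfolding schwartz_iff using step by blast
qed

lemma schwartz_differentiable: "f \<in> schwartz \<Longrightarrow> f differentiable (at x)"
  using schwartz_iff[of f, THEN iffD1, rule_format, of "[]"] by simp

lemma schwartz_rapid: "f \<in> schwartz \<Longrightarrow> rapid f"
  using schwartz_iff[of f, THEN iffD1, rule_format, of "[]"] by simp

lemma schwartz_has_derivative: "f \<in> schwartz \<Longrightarrow> (f has_derivative frechet_derivative f (at x)) (at x)"
  using schwartz_differentiable frechet_derivative_works by blast

lemma schwartz_continuous: "f \<in> schwartz \<Longrightarrow> continuous_on A f"
  by (intro continuous_at_imp_continuous_on ballI differentiable_imp_continuous_within schwartz_differentiable)

lemma schwartz_measurable: "f \<in> schwartz \<Longrightarrow> f \<in> borel_measurable borel"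
  by (simp add: borel_measurable_continuous_onI schwartz_continuous)

lemma schwartz_iter_deriv:
  assumes "f \<in> schwartz" "set ws \<subseteq> Basis"
  shows "iter_deriv ws f \<in> schwartz"
  unfolding schwartz_iff
proof (intro allI impI)
  fix vs :: "'a list" assume "set vs \<subseteq> Basis"
  then show "(\<forall>x. iter_deriv vs (iter_deriv ws f) differentiable at x) \<and> rapid (iter_deriv vs (iter_deriv ws f))"
    using schwartz_iff[of f, THEN iffD1, rule_format, of "vs @ ws"] assms by (simp add: iter_deriv_append)
qed

lemma schwartz_pd: "f \<in> schwartz \<Longrightarrow> v \<in> Basis \<Longrightarrow> pd v f \<in> schwartz"
  using schwartz_iter_deriv[of f "[v]"] by simp

lemma pd_eqI:
  assumes "\<And>x. (f has_derivative f' x) (at x)"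
  shows "pd v f = (\<lambda>x. f' x v)"
  by (rule ext) (rule fun_cong[OF frechet_derivative_at[OF assms, symmetric]])

lemma pd_add:
  "f \<in> schwartz \<Longrightarrow> g \<in> schwartz \<Longrightarrow> pd v (\<lambda>x. f x + g x) = (\<lambda>x. pd v f x + pd v g x)"
  by (rule pd_eqI) (intro has_derivative_add schwartz_has_derivative)

lemma schwartz_add:
  assumes "f \<in> schwartz" "g \<in> schwartz"
  shows "(\<lambda>x. f x + g x) \<in> schwartz"
proof (rule schwartz_coinduct[where S="{\<lambda>x. f x + g x | f g. f \<in> schwartz \<and> g \<in> schwartz}"])
  show "(\<lambda>x. f x + g x) \<in> {\<lambda>x. f x + g x | f g. f \<in> schwartz \<and> g \<in> schwartz}" using assms by blast
next
  fix h :: "'a \<Rightarrow> complex" assume "h \<in> {\<lambda>x. f x + g x | f g. f \<in> schwartz \<and> g \<in> schwartz}"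
  then obtain f g where h: "h = (\<lambda>x. f x + g x)" and fg: "f \<in> schwartz" "g \<in> schwartz" by blast
  show "(\<forall>x. h differentiable at x) \<and> rapid h \<and>
       (\<forall>v\<in>Basis. pd v h \<in> {\<lambda>x. f x + g x |f g. f \<in> schwartz \<and> g \<in> schwartz})"
  proof (intro conjI allI ballI)
    show "rapid h" unfolding h using fg by (intro rapid_add schwartz_rapid)
    show "h differentiable at x" for x unfolding h using fg by (intro differentiable_add schwartz_differentiable)
    fix v :: 'a assume "v \<in> Basis"
    then show "pd v h \<in> {\<lambda>x. f x + g x |f g. f \<in> schwartz \<and> g \<in> schwartz}"
      unfolding h pd_add[OF fg]
      by (intro CollectI exI[of _ "pd v f"] exI[of _ "pd v g"]) (auto intro: schwartz_pd fg)
  qed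
qed

lemma pd_cmult:
  "f \<in> schwartz \<Longrightarrow> pd v (\<lambda>x. c * f x) = (\<lambda>x. c * pd v f x)"
  by (rule pd_eqI) (intro has_derivative_mult_right schwartz_has_derivative)

lemma schwartz_cmult:
  assumes "f \<in> schwartz"
  shows "(\<lambda>x. c * f x) \<in> schwartz"
proof (rule schwartz_coinduct[where S="{\<lambda>x. c * f x | f. f \<in> schwartz}"])
  show "(\<lambda>x. c * f x) \<in> {\<lambda>x. c * f x | f. f \<in> schwartz}" using assms by blast
next
  fix h :: "'a \<Rightarrow> complex" assume "h \<in> {\<lambda>x. c * f x | f. f \<in> schwartz}"
  then obtain f where h: "h = (\<lambda>x. c * f x)" and f: "f \<in> schwartz" by blast
  show "(\<forall>x. h differentiable at x) \<and> rapid h \<and> (\<forall>v\<in>Basis. pd v h \<in> {\<lambda>x. c * f x |f. f \<in> schwartz})"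
  proof (intro conjI allI ballI)
    show "rapid h" unfolding h using f by (intro rapid_cmult schwartz_rapid)
    show "h differentiable at x" for x unfolding h
      using has_derivative_mult_right[OF schwartz_has_derivative[OF f]] differentiable_def by blast
    fix v :: 'a assume "v \<in> Basis"
    then show "pd v h \<in> {\<lambda>x. c * f x |f. f \<in> schwartz}"
      unfolding h pd_cmult[OF f]
      by (intro CollectI exI[of _ "pd v f"]) (auto intro: schwartz_pd f)
  qed
qed

lemma schwartz_zero: "(\<lambda>x. 0) \<in> schwartz"
  by (rule schwartz_coinduct[where S="{\<lambda>x. 0}"]) (auto simp: rapid_def)

lemma schwartz_diff: "f \<in> schwartz \<Longrightarrow> g \<in> schwartz \<Longrightarrow> (\<lambda>x. f x - g x) \<in> schwartz"
  using schwartz_add[OF _ schwartz_cmult[of g "-1"], of f] by simp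

lemma schwartz_sum:
  "(\<And>i. i \<in> I \<Longrightarrow> f i \<in> schwartz) \<Longrightarrow> (\<lambda>x. \<Sum>i\<in>I. c i * f i x) \<in> schwartz"
  by (induction I rule: infinite_finite_induct) (auto intro!: schwartz_zero schwartz_add schwartz_cmult)

lemma iter_deriv_add:
  "f \<in> schwartz \<Longrightarrow> g \<in> schwartz \<Longrightarrow> set vs \<subseteq> Basis \<Longrightarrow>
   iter_deriv vs (\<lambda>x. f x + g x) = (\<lambda>x. iter_deriv vs f x + iter_deriv vs g x)"
  by (induction vs) (auto simp: pd_add schwartz_iter_deriv)

lemma iter_deriv_cmult:
  "f \<in> schwartz \<Longrightarrow> set vs \<subseteq> Basis \<Longrightarrow> iter_deriv vs (\<lambda>x. c * f x) = (\<lambda>x. c * iter_deriv vs f x)"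
  by (induction vs) (auto simp: pd_cmult schwartz_iter_deriv)

lemma iter_deriv_diff:
  "f \<in> schwartz \<Longrightarrow> g \<in> schwartz \<Longrightarrow> set vs \<subseteq> Basis \<Longrightarrow>
   iter_deriv vs (\<lambda>x. f x - g x) = (\<lambda>x. iter_deriv vs f x - iter_deriv vs g x)"
  using iter_deriv_add[OF _ schwartz_cmult[of g "-1"], of f vs] iter_deriv_cmult[of g vs "-1"] by simp

lemma iter_deriv_zero: "set vs \<subseteq> Basis \<Longrightarrow> iter_deriv vs (\<lambda>x. 0) = (\<lambda>x. 0)"
  by (induction vs) auto

lemma iter_deriv_sum:
  assumes "\<And>i. i \<in> I \<Longrightarrow> f i \<in> schwartz" "set vs \<subseteq> Basis"
  shows "iter_deriv vs (\<lambda>x. \<Sum>i\<in>I. c i * f i x) = (\<lambda>x. \<Sum>i\<in>I. c i * iter_deriv vs (f i) x)"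
  using assms(1)
proof (induction I rule: infinite_finite_induct)
  case (insert j J)
  have "iter_deriv vs (\<lambda>x. c j * f j x + (\<Sum>i\<in>J. c i * f i x))
     = (\<lambda>x. c j * iter_deriv vs (f j) x + iter_deriv vs (\<lambda>x. \<Sum>i\<in>J. c i * f i x) x)"
    using insert assms(2) by (subst iter_deriv_add) (auto simp: iter_deriv_cmult intro!: schwartz_cmult schwartz_sum)
  with insert show ?case by simp
qed (auto simp: iter_deriv_zero assms(2))

text \<open>\<open>schwartz\<close> speaks of derivatives along \<open>Basis\<close> only; linearity
  of the derivative carries its bounds over to every direction.\<close>

lemma frechet_eq_sum_pd:
  assumes "f \<in> schwartz"
  shows "frechet_derivative f (at x) h = (\<Sum>b\<in>Basis. of_real (h \<bullet> b) * pd b f x)"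
proof -
  have lin: "linear (frechet_derivative f (at x))"
    using schwartz_has_derivative[OF assms] has_derivative_linear by blast
  have "frechet_derivative f (at x) h = frechet_derivative f (at x) (\<Sum>b\<in>Basis. (h \<bullet> b) *\<^sub>R b)"
    by (simp add: euclidean_representation)
  also have "\<dots> = (\<Sum>b\<in>Basis. (h \<bullet> b) *\<^sub>R pd b f x)"
    by (simp add: linear_sum[OF lin] linear_cmul[OF lin])
  finally show ?thesis by (simp add: scaleR_conv_of_real)
qed

lemma schwartz_pd_any: "f \<in> schwartz \<Longrightarrow> pd v f \<in> schwartz"
  by (simp add: frechet_eq_sum_pd) (intro schwartz_sum schwartz_pd)

text \<open>Uniform in x and linear in v, the form in which the bound serves as a Lipschitz constant
  and as a majorant for differentiation under an integral.\<close>

lemma schwartz_deriv_bound: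
  assumes "f \<in> schwartz"
  obtains C where "C > 0" "\<And>x v. (1 + norm x) ^ k * norm (frechet_derivative f (at x) v) \<le> C * norm v"
proof -
  have "\<exists>C. \<forall>x. (1 + norm x) ^ k * norm (pd b f x) \<le> C" if "b \<in> Basis" for b
    using schwartz_rapid[OF schwartz_pd[OF assms that]] unfolding rapid_def by blast
  then have "\<forall>b\<in>Basis. \<exists>C. \<forall>x. (1 + norm x) ^ k * norm (pd b f x) \<le> C" by blast
  from bchoice[OF this] obtain C where C: "\<And>b x. b \<in> Basis \<Longrightarrow> (1 + norm x) ^ k * norm (pd b f x) \<le> C b" by blast
  have C0: "0 \<le> C b" if "b \<in> Basis" for b
    by (rule order_trans[OF _ C[OF that, of 0]]) simp
  have "(1 + norm x) ^ k * norm (frechet_derivative f (at x) v) \<le> (1 + (\<Sum>b\<in>Basis. C b)) * norm v" for x v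
  proof -
    have "norm (frechet_derivative f (at x) v) \<le> (\<Sum>b\<in>Basis. norm (of_real (v \<bullet> b) * pd b f x))"
      unfolding frechet_eq_sum_pd[OF assms, of x v] by (rule norm_sum)
    also have "\<dots> \<le> (\<Sum>b\<in>Basis. norm v * norm (pd b f x))"
      by (intro sum_mono) (simp add: norm_mult mult_right_mono Basis_le_norm)
    finally have "(1 + norm x) ^ k * norm (frechet_derivative f (at x) v)
        \<le> (1 + norm x) ^ k * (\<Sum>b\<in>Basis. norm v * norm (pd b f x))"
      by (intro mult_left_mono) simp_all
    also have "\<dots> = (\<Sum>b\<in>Basis. norm v * ((1 + norm x) ^ k * norm (pd b f x)))"
      unfolding sum_distrib_left by (intro sum.cong) simp_all
    also have "\<dots> \<le> (\<Sum>b\<in>Basis. norm v * C b)"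
      by (intro sum_mono mult_left_mono C) simp_all
    also have "\<dots> = norm v * (\<Sum>b\<in>Basis. C b)" by (rule sum_distrib_left[symmetric])
    also have "\<dots> \<le> (1 + (\<Sum>b\<in>Basis. C b)) * norm v"
      by (simp add: algebra_simps)
    finally show ?thesis .
  qed
  moreover have "1 + (\<Sum>b\<in>Basis. C b) > 0"
    by (intro add_pos_nonneg sum_nonneg C0) simp_all
  ultimately show ?thesis by (rule that[rotated])
qed

text \<open>Injectivity is what preserves decay: L is then bounded below, so \<open>norm x\<close>
  is at most a constant times \<open>1 + norm (L x + c)\<close>. The target may have larger
  dimension, which covers slices x \<mapsto> (x, y) along with shifts and shears.\<close>

lemma schwartz_affine:
  fixes L :: "'a::euclidean_space \<Rightarrow> 'b::euclidean_space"
  assumes f: "f \<in> schwartz" and L: "linear L" "inj L"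
  shows "(\<lambda>x. f (L x + c)) \<in> schwartz"
proof (rule schwartz_coinduct[where S="{\<lambda>x. f (L x + c) | f. f \<in> schwartz}"])
  show "(\<lambda>x. f (L x + c)) \<in> {\<lambda>x. f (L x + c) | f. f \<in> schwartz}" using f by blast
next
  fix h assume "h \<in> {\<lambda>x. f (L x + c) | f. f \<in> schwartz}"
  then obtain f where h: "h = (\<lambda>x. f (L x + c))" and f: "f \<in> schwartz" by blast
  have dL: "((\<lambda>x. L x + c) has_derivative L) (at x)" for x
    using has_derivative_add[OF linear_imp_has_derivative[OF L(1)] has_derivative_const] by simp
  have d: "(h has_derivative (\<lambda>v. frechet_derivative f (at (L x + c)) (L v))) (at x)" for x
    unfolding h by (rule has_derivative_compose[OF dL schwartz_has_derivative[OF f]])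
  have 1: "h differentiable at x" for x using d[of x] differentiable_def by blast
  have "pd v h = (\<lambda>x. pd (L v) f (L x + c))" for v by (rule pd_eqI[OF d])
  then have 2: "pd v h \<in> {\<lambda>x. f (L x + c) | f. f \<in> schwartz}" for v
    using schwartz_pd_any[OF f, of "L v"] by (intro CollectI exI[of _ "pd (L v) f"]) simp
  obtain B where B: "B > 0" "\<And>x. B * norm x \<le> norm (L x)"
    using linear_inj_bounded_below_pos[OF L] by blast
  have "rapid h" unfolding rapid_def
  proof
    fix k
    obtain C where C: "C > 0" "\<And>x. (1 + norm x) ^ k * norm (f x) \<le> C"
      by (rule rapidE[OF schwartz_rapid[OF f], where k=k]) blast
    \<comment> \<open>The lower bound \<open>B * norm x \<le> norm (L x)\<close> and the triangle
      inequality give the second summand as the factor for \<open>norm x\<close>; the first summand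
      absorbs the 1 in \<open>1 + norm x\<close>.\<close>
    define M where "M = 1 + (1 + norm c) / B"
    have M: "M > 0" using B by (simp add: M_def add_pos_nonneg)
    have le: "1 + norm x \<le> M * (1 + norm (L x + c))" for x
    proof -
      have "B * norm x \<le> norm (L x + c) + norm c"
        using B(2)[of x] norm_triangle_ineq4[of "L x + c" c] by simp
      then have "norm x \<le> (norm (L x + c) + norm c) / B"
        using B(1) by (simp add: pos_le_divide_eq mult.commute)
      also have "\<dots> \<le> ((1 + norm c) * (1 + norm (L x + c))) / B"
        using B(1) by (intro divide_right_mono) (simp_all add: algebra_simps)
      also have "\<dots> = ((1 + norm c) / B) * (1 + norm (L x + c))" by simp
      finally have "norm x \<le> ((1 + norm c) / B) * (1 + norm (L x + c))" .
      then show ?thesis unfolding M_def distrib_right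
        by (intro add_mono) simp_all
    qed
    have "(1 + norm x) ^ k * norm (h x) \<le> M ^ k * C" for x
    proof -
      have "(1 + norm x) ^ k * norm (h x) \<le> (M * (1 + norm (L x + c))) ^ k * norm (h x)"
        by (intro mult_right_mono power_mono le) auto
      also have "\<dots> = M ^ k * ((1 + norm (L x + c)) ^ k * norm (f (L x + c)))"
        by (simp add: h power_mult_distrib)
      also have "\<dots> \<le> M ^ k * C" using M by (intro mult_left_mono C) auto
      finally show ?thesis .
    qed
    then show "\<exists>C. \<forall>x. (1 + norm x) ^ k * norm (h x) \<le> C" by blast
  qed
  with 1 2 show "(\<forall>x. h differentiable at x) \<and> rapid h \<and> (\<forall>v\<in>Basis. pd v h \<in> {\<lambda>x. f (L x + c) | f. f \<in> schwartz})"
    by simp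
qed

lemma norm_inner_poly_growth: "norm (complex_of_real (x \<bullet> v)) \<le> norm v * (1 + norm x) ^ 1"
  using Cauchy_Schwarz_ineq2[of x v] norm_ge_zero[of v] by (simp add: algebra_simps del: norm_ge_zero)

lemma schwartz_inner_mult:
  assumes "f \<in> schwartz"
  shows "(\<lambda>x. of_real (x \<bullet> w) * f x) \<in> schwartz"
\<comment> \<open>The product rule leaves a term (v \<bullet> w) f without the factor x \<bullet> w,
  so the invariant set has to contain an added Schwartz function g.\<close>
proof (rule schwartz_coinduct[where S="{\<lambda>x. of_real (x \<bullet> w) * f x + g x | f g. f \<in> schwartz \<and> g \<in> schwartz}"])
  show "(\<lambda>x. of_real (x \<bullet> w) * f x) \<in> {\<lambda>x. of_real (x \<bullet> w) * f x + g x | f g. f \<in> schwartz \<and> g \<in> schwartz}"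
    using assms schwartz_zero by (intro CollectI exI[of _ f] exI[of _ "\<lambda>x. 0"]) auto
next
  fix h assume "h \<in> {\<lambda>x. of_real (x \<bullet> w) * f x + g x | f g. f \<in> schwartz \<and> g \<in> schwartz}"
  then obtain f g where h: "h = (\<lambda>x. of_real (x \<bullet> w) * f x + g x)" and fg: "f \<in> schwartz" "g \<in> schwartz" by blast
  have d: "(h has_derivative (\<lambda>v. of_real (x \<bullet> w) * frechet_derivative f (at x) v
      + (of_real (v \<bullet> w) * f x + frechet_derivative g (at x) v))) (at x)" for x
    unfolding h
    by (rule derivative_eq_intros refl schwartz_has_derivative fg)+ (auto simp: algebra_simps)
  have "pd v h = (\<lambda>x. of_real (x \<bullet> w) * pd v f x + (of_real (v \<bullet> w) * f x + pd v g x))" for v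
    by (rule pd_eqI[OF d])
  moreover have "rapid h" unfolding h
    by (intro rapid_add rapid_mult_poly_growth[OF _ norm_inner_poly_growth] schwartz_rapid fg)
  moreover have "\<forall>x. h differentiable at x" using d differentiable_def by blast
  ultimately show "(\<forall>x. h differentiable at x) \<and> rapid h \<and>
      (\<forall>v\<in>Basis. pd v h \<in> {\<lambda>x. of_real (x \<bullet> w) * f x + g x | f g. f \<in> schwartz \<and> g \<in> schwartz})"
  proof (intro conjI ballI)
    fix v :: 'a assume pd: "\<And>v. pd v h = (\<lambda>x. of_real (x \<bullet> w) * pd v f x + (of_real (v \<bullet> w) * f x + pd v g x))"
    show "pd v h \<in> {\<lambda>x. of_real (x \<bullet> w) * f x + g x | f g. f \<in> schwartz \<and> g \<in> schwartz}"
      unfolding pd using fg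
      by (intro CollectI exI[of _ "pd v f"] exI[of _ "\<lambda>x. of_real (v \<bullet> w) * f x + pd v g x"])
        (auto intro!: schwartz_add schwartz_cmult schwartz_pd_any)
  qed
qed

text \<open>The hypothesis \<open>aff\<close> allows phases of degree at most two: a derivative
  brings down an affine factor, which \<open>schwartz_inner_mult\<close> absorbs. Linear phases give
  modulations, bilinear ones the kernel of a Fourier integral.\<close>

lemma schwartz_chirp_mult:
  assumes "f \<in> schwartz" and B: "\<And>x. (B has_derivative B' x) (at x)"
    and aff: "\<And>v. v \<in> Basis \<Longrightarrow> \<exists>w c. \<forall>x. B' x v = x \<bullet> w + c"
  shows "(\<lambda>x. cis (B x) * f x) \<in> schwartz"
proof (rule schwartz_coinduct[where S="{\<lambda>x. cis (B x) * f x | f. f \<in> schwartz}"])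
  show "(\<lambda>x. cis (B x) * f x) \<in> {\<lambda>x. cis (B x) * f x | f. f \<in> schwartz}" using assms by blast
next
  fix h assume "h \<in> {\<lambda>x. cis (B x) * f x | f. f \<in> schwartz}"
  then obtain f where h: "h = (\<lambda>x. cis (B x) * f x)" and f: "f \<in> schwartz" by blast
  have c: "((\<lambda>x. cis (B x)) has_derivative (\<lambda>v. cis (B x) * (\<i> * of_real (B' x v)))) (at x)" for x
  proof -
    have "((\<lambda>x. complex_of_real (cos (B x)) + \<i> * complex_of_real (sin (B x))) has_derivative
        (\<lambda>v. cis (B x) * (\<i> * of_real (B' x v)))) (at x)"
      by (rule derivative_eq_intros B refl)+ (auto simp: complex_eq_iff)
    then show ?thesis by (simp add: cis_conv_exp exp_Euler cos_of_real sin_of_real)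
  qed
  have d: "(h has_derivative (\<lambda>v. cis (B x) * (frechet_derivative f (at x) v + \<i> * (of_real (B' x v) * f x)))) (at x)" for x
    unfolding h
    by (rule derivative_eq_intros refl schwartz_has_derivative f c)+ (auto simp: algebra_simps)
  have "pd v h \<in> {\<lambda>x. cis (B x) * f x | f. f \<in> schwartz}" if v: "v \<in> Basis" for v
  proof -
    obtain w c where w: "\<And>x. B' x v = x \<bullet> w + c" using aff[OF v] by blast
    have "(\<lambda>x. pd v f x + \<i> * (of_real (x \<bullet> w) * f x + of_real c * f x)) \<in> schwartz"
      by (intro schwartz_add schwartz_cmult schwartz_pd_any schwartz_inner_mult f)
    then show ?thesis unfolding pd_eqI[OF d] w
      by (intro CollectI exI[of _ "\<lambda>x. pd v f x + \<i> * (of_real (x \<bullet> w) * f x + of_real c * f x)"])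
         (auto simp: algebra_simps)
  qed
  moreover have "rapid h"
    using schwartz_rapid[OF f] unfolding h rapid_def by (simp add: norm_mult)
  moreover have "\<forall>x. h differentiable at x" using d differentiable_def by blast
  ultimately show "(\<forall>x. h differentiable at x) \<and> rapid h \<and>
      (\<forall>v\<in>Basis. pd v h \<in> {\<lambda>x. cis (B x) * f x | f. f \<in> schwartz})"
    by simp
qed

text \<open>Polynomials times the standard Gaussian. This is the invariant set for
  \<open>schwartz_coinduct\<close>, as differentiation multiplies the Gaussian by linear
  factors.\<close>

inductive_set gauss_span :: "('a::euclidean_space \<Rightarrow> complex) set" where
  base: "(\<lambda>x. of_real (exp (- pi * (norm x)\<^sup>2))) \<in> gauss_span"
| mult: "f \<in> gauss_span \<Longrightarrow> (\<lambda>x. of_real (x \<bullet> v) * f x) \<in> gauss_span"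
| add: "f \<in> gauss_span \<Longrightarrow> g \<in> gauss_span \<Longrightarrow> (\<lambda>x. f x + g x) \<in> gauss_span"
| scale: "f \<in> gauss_span \<Longrightarrow> (\<lambda>x. c * f x) \<in> gauss_span"

lemma rapid_gaussian: "rapid (\<lambda>x::'a::euclidean_space. complex_of_real (exp (- pi * (norm x)\<^sup>2)))"
  unfolding rapid_def
proof
  fix k
  have "(1 + norm x) ^ k * norm (complex_of_real (exp (- pi * (norm x)\<^sup>2))) \<le> fact k * exp 2" for x :: 'a
  proof -
    \<comment> \<open>One term of the exponential series is at most its sum. This trades the power
      for exp (1 + r), which the Gaussian beats because 1 + r - pi r^2 \<le> 2.\<close>
    have "(1 + norm x) ^ k / fact k \<le> exp (1 + norm x)"
      using sums_le[OF _ sums_single[of k "\<lambda>n. (1 + norm x) ^ n / fact n"] exp_converges[of "1 + norm x"]]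
      by (auto simp: divide_inverse mult_ac)
    then have "(1 + norm x) ^ k \<le> fact k * exp (1 + norm x)" by (simp add: field_simps)
    then have "(1 + norm x) ^ k * exp (- pi * (norm x)\<^sup>2) \<le> fact k * exp (1 + norm x) * exp (- pi * (norm x)\<^sup>2)"
      by (intro mult_right_mono) auto
    also have "\<dots> = fact k * exp (1 + norm x - pi * (norm x)\<^sup>2)" by (simp add: exp_add exp_diff exp_minus field_simps)
    also have "\<dots> \<le> fact k * exp 2"
    proof -
      have "(norm x)\<^sup>2 \<le> pi * (norm x)\<^sup>2" using pi_gt3 by (intro mult_right_mono[of 1 pi, simplified]) auto
      moreover have "2 * norm x \<le> 1 + (norm x)\<^sup>2"
        using sum_squares_bound[of "norm x" 1] by simp
      ultimately have "1 + norm x - pi * (norm x)\<^sup>2 \<le> 2"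
        using norm_ge_zero[of x] by linarith
      then show ?thesis by (intro mult_left_mono) auto
    qed
    finally show ?thesis by simp
  qed
  then show "\<exists>C. \<forall>x::'a. (1 + norm x) ^ k * norm (complex_of_real (exp (- pi * (norm x)\<^sup>2))) \<le> C" by blast
qed

lemma gauss_span_schwartz_step:
  assumes "f \<in> gauss_span"
  shows "\<exists>f'. (\<forall>x. (f has_derivative f' x) (at x)) \<and> rapid f \<and> (\<forall>v. (\<lambda>x. f' x v) \<in> gauss_span)"
  using assms
proof induction
  case base
  have "((\<lambda>x. complex_of_real (exp (- pi * (norm x)\<^sup>2))) has_derivative
     (\<lambda>v. complex_of_real (-2 * pi) * (of_real (x \<bullet> v) * of_real (exp (- pi * (norm x)\<^sup>2))))) (at x)" for x :: 'a
    unfolding power2_norm_eq_inner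
    by (rule has_derivative_eq_rhs, (rule derivative_intros)+)
      (auto simp: algebra_simps inner_commute scaleR_conv_of_real)
  moreover have "(\<lambda>x. complex_of_real (-2 * pi) * (of_real (x \<bullet> v) * of_real (exp (- pi * (norm x)\<^sup>2)))) \<in> gauss_span"
    for v :: 'a by (intro gauss_span.intros)
  ultimately show ?case using rapid_gaussian
    by (intro exI[of _ "\<lambda>x v. complex_of_real (-2 * pi) * (of_real (x \<bullet> v) * of_real (exp (- pi * (norm x)\<^sup>2)))"] conjI allI)
next
  case (mult f w)
  then obtain f' where f': "\<And>x. (f has_derivative f' x) (at x)" "rapid f" "\<And>v. (\<lambda>x. f' x v) \<in> gauss_span" by blast
  have "((\<lambda>x. of_real (x \<bullet> w) * f x) has_derivative (\<lambda>v. of_real (x \<bullet> w) * f' x v + of_real (v \<bullet> w) * f x)) (at x)" for x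
    by (rule derivative_eq_intros refl f')+ (auto simp: algebra_simps)
  moreover have "rapid (\<lambda>x. of_real (x \<bullet> w) * f x)"
    by (intro rapid_mult_poly_growth[OF _ norm_inner_poly_growth] f')
  moreover have "(\<lambda>x. of_real (x \<bullet> w) * f' x v + of_real (v \<bullet> w) * f x) \<in> gauss_span" for v
    by (intro gauss_span.intros f' mult)
  ultimately show ?case
    by (intro exI[of _ "\<lambda>x v. of_real (x \<bullet> w) * f' x v + of_real (v \<bullet> w) * f x"] conjI allI)
next
  case (add f g)
  then obtain f' g' where f': "\<And>x. (f has_derivative f' x) (at x)" "rapid f" "\<And>v. (\<lambda>x. f' x v) \<in> gauss_span"
    and g': "\<And>x. (g has_derivative g' x) (at x)" "rapid g" "\<And>v. (\<lambda>x. g' x v) \<in> gauss_span" by blast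
  show ?case
    by (intro exI[of _ "\<lambda>x v. f' x v + g' x v"] conjI allI gauss_span.add has_derivative_add rapid_add f' g')
next
  case (scale f c)
  then obtain f' where f': "\<And>x. (f has_derivative f' x) (at x)" "rapid f" "\<And>v. (\<lambda>x. f' x v) \<in> gauss_span" by blast
  show ?case
    by (intro exI[of _ "\<lambda>x v. c * f' x v"] conjI allI gauss_span.scale has_derivative_mult_right rapid_cmult f')
qed

lemma schwartz_gaussian: "(\<lambda>x::'a::euclidean_space. complex_of_real (exp (- pi * (norm x)\<^sup>2))) \<in> schwartz"
proof (rule schwartz_coinduct[where S=gauss_span])
  fix f :: "'a \<Rightarrow> complex" assume "f \<in> gauss_span"
  then obtain f' where f': "\<And>x. (f has_derivative f' x) (at x)" "rapid f" "\<And>v. (\<lambda>x. f' x v) \<in> gauss_span"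
    using gauss_span_schwartz_step by blast
  then show "(\<forall>x. f differentiable at x) \<and> rapid f \<and> (\<forall>v\<in>Basis. pd v f \<in> gauss_span)"
    by (auto simp: pd_eqI[OF f'(1)] differentiable_def)
qed (rule gauss_span.base)

lemma schwartz_gaussian_affine:
  assumes "a > 0"
  shows "(\<lambda>x::'a::euclidean_space. complex_of_real (exp (- pi * a * (norm (x - c))\<^sup>2))) \<in> schwartz"
proof -
  have "(\<lambda>x::'a. complex_of_real (exp (- pi * (norm (sqrt a *\<^sub>R x + - (sqrt a *\<^sub>R c)))\<^sup>2))) \<in> schwartz"
    using assms by (intro schwartz_affine[OF schwartz_gaussian]) (auto simp: inj_on_def linear_iff algebra_simps)
  moreover have "(norm (sqrt a *\<^sub>R x + - (sqrt a *\<^sub>R c)))\<^sup>2 = a * (norm (x - c))\<^sup>2" for x :: 'a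
    using assms by (simp flip: scaleR_diff_right add: power_mult_distrib)
  ultimately show ?thesis by (simp add: mult_ac)
qed

section \<open>Tensor products and conjugates\<close>

lemma norm_Pair_ge: "norm x \<le> norm (x, y)" "norm y \<le> norm (x, y)"
  using norm_fst_le[of x y] norm_snd_le[of y x] by auto

lemma one_plus_norm_Pair_le: "1 + norm (x, y) \<le> (1 + norm x) * (1 + norm y)"
  using norm_Pair_le[of x y] mult_nonneg_nonneg[OF norm_ge_zero norm_ge_zero, of x y]
  by (simp add: distrib_left distrib_right del: mult_nonneg_nonneg)

lemma schwartz_tensor:
  fixes f :: "'a::euclidean_space \<Rightarrow> complex" and g :: "'b::euclidean_space \<Rightarrow> complex"
  assumes "f \<in> schwartz" "g \<in> schwartz"
  shows "(\<lambda>p. f (fst p) * g (snd p)) \<in> schwartz"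
proof (rule schwartz_coinduct[where S="{\<lambda>p. f (fst p) * g (snd p) | f g. f \<in> schwartz \<and> g \<in> schwartz}"])
  show "(\<lambda>p. f (fst p) * g (snd p)) \<in> {\<lambda>p. f (fst p) * g (snd p) | f g. f \<in> schwartz \<and> g \<in> schwartz}"
    using assms by blast
next
  fix h :: "'a \<times> 'b \<Rightarrow> complex" assume "h \<in> {\<lambda>p. f (fst p) * g (snd p) | f g. f \<in> schwartz \<and> g \<in> schwartz}"
  then obtain f g where h: "h = (\<lambda>p. f (fst p) * g (snd p))" and fg: "f \<in> schwartz" "g \<in> schwartz" by blast
  have df: "((\<lambda>p. f (fst p)) has_derivative (\<lambda>v. frechet_derivative f (at (fst p)) (fst v))) (at p)" for p :: "'a \<times> 'b"
    by (rule has_derivative_compose[OF has_derivative_fst[OF has_derivative_ident] schwartz_has_derivative[OF fg(1)]])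
  have dg: "((\<lambda>p. g (snd p)) has_derivative (\<lambda>v. frechet_derivative g (at (snd p)) (snd v))) (at p)" for p :: "'a \<times> 'b"
    by (rule has_derivative_compose[OF has_derivative_snd[OF has_derivative_ident] schwartz_has_derivative[OF fg(2)]])
  have d: "(h has_derivative (\<lambda>v. f (fst p) * frechet_derivative g (at (snd p)) (snd v)
       + frechet_derivative f (at (fst p)) (fst v) * g (snd p))) (at p)" for p
    unfolding h by (rule has_derivative_mult[OF df dg])
  have z: "frechet_derivative f (at x) 0 = 0" "frechet_derivative g (at y) 0 = 0" for x y
    using fg by (auto simp: frechet_eq_sum_pd)
  have "pd v h \<in> {\<lambda>p. f (fst p) * g (snd p) | f g. f \<in> schwartz \<and> g \<in> schwartz}" if "v \<in> Basis" for v
  proof -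
    from that consider u where "u \<in> Basis" "v = (u, 0)" | u where "u \<in> Basis" "v = (0, u)"
      unfolding Basis_prod_def by blast
    then show ?thesis
    proof cases
      case 1
      then show ?thesis unfolding pd_eqI[OF d]
        by (intro CollectI exI[of _ "pd u f"] exI[of _ g]) (auto simp: z intro: fg schwartz_pd)
    next
      case 2
      then show ?thesis unfolding pd_eqI[OF d]
        by (intro CollectI exI[of _ f] exI[of _ "pd u g"]) (auto simp: z intro: fg schwartz_pd)
    qed
  qed
  moreover have "rapid h" unfolding rapid_def
  proof
    fix k
    obtain C where C: "C > 0" "\<And>x. (1 + norm x) ^ k * norm (f x) \<le> C" by (rule rapidE[OF schwartz_rapid[OF fg(1)], where k=k]) blast
    obtain D where D: "D > 0" "\<And>x. (1 + norm x) ^ k * norm (g x) \<le> D" by (rule rapidE[OF schwartz_rapid[OF fg(2)], where k=k]) blast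
    have "(1 + norm p) ^ k * norm (h p) \<le> C * D" for p
    proof -
      have "(1 + norm p) ^ k * norm (h p) \<le> ((1 + norm (fst p)) * (1 + norm (snd p))) ^ k * norm (h p)"
        using one_plus_norm_Pair_le[of "fst p" "snd p"] by (intro mult_right_mono power_mono) auto
      also have "\<dots> = ((1 + norm (fst p)) ^ k * norm (f (fst p))) * ((1 + norm (snd p)) ^ k * norm (g (snd p)))"
        unfolding h norm_mult power_mult_distrib by (simp only: mult_ac)
      also have "\<dots> \<le> C * D" using C D by (intro mult_mono) (auto intro: less_imp_le)
      finally show ?thesis .
    qed
    then show "\<exists>C. \<forall>p. (1 + norm p) ^ k * norm (h p) \<le> C" by blast
  qed
  moreover have "\<forall>x. h differentiable at x" using d differentiable_def by blast
  ultimately show "(\<forall>x. h differentiable at x) \<and> rapid h \<and>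
     (\<forall>v\<in>Basis. pd v h \<in> {\<lambda>p. f (fst p) * g (snd p) | f g. f \<in> schwartz \<and> g \<in> schwartz})"
    by simp
qed

lemma schwartz_cnj:
  assumes "f \<in> schwartz"
  shows "(\<lambda>x. cnj (f x)) \<in> schwartz"
proof (rule schwartz_coinduct[where S="{\<lambda>x. cnj (f x) | f. f \<in> schwartz}"])
  show "(\<lambda>x. cnj (f x)) \<in> {\<lambda>x. cnj (f x) | f. f \<in> schwartz}" using assms by blast
next
  fix h :: "'a \<Rightarrow> complex" assume "h \<in> {\<lambda>x. cnj (f x) | f. f \<in> schwartz}"
  then obtain f where h: "h = (\<lambda>x. cnj (f x))" and f: "f \<in> schwartz" by blast
  have d: "(h has_derivative (\<lambda>v. cnj (frechet_derivative f (at x) v))) (at x)" for x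
    unfolding h by (intro has_derivative_cnj schwartz_has_derivative f)
  have "pd v h \<in> {\<lambda>x. cnj (f x) | f. f \<in> schwartz}" for v
    unfolding pd_eqI[OF d] using schwartz_pd_any[OF f] by (intro CollectI exI[of _ "pd v f"]) auto
  moreover have "rapid h" using schwartz_rapid[OF f] unfolding h rapid_def by simp
  moreover have "\<forall>x. h differentiable at x" using d differentiable_def by blast
  ultimately show "(\<forall>x. h differentiable at x) \<and> rapid h \<and> (\<forall>v\<in>Basis. pd v h \<in> {\<lambda>x. cnj (f x) | f. f \<in> schwartz})"
    by simp
qed


section \<open>Integration in a parameter\<close>

text \<open>An integrable weight made of one-dimensional factors, so that its integral is a product
  of integrals over the line. Its reciprocal is a polynomial: multiplication by it preserves
  Schwartz functions, and on the Fourier side it corresponds to a differential operator.\<close>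

definition wt :: "'a::euclidean_space \<Rightarrow> real" where
  "wt x = (\<Prod>b\<in>Basis. inverse (1 + (x \<bullet> b)\<^sup>2))"

lemma one_plus_square_pos [simp]: "0 < 1 + (r::real)\<^sup>2"
  by (simp add: add_pos_nonneg)

lemma wt_pos: "wt x > 0"
  unfolding wt_def by (intro prod_pos) auto

lemma wt_nonneg: "0 \<le> wt x" using wt_pos[of x] by simp

lemma wt_le_1: "wt x \<le> 1"
  unfolding wt_def by (intro prod_le_1) (auto intro!: inverse_le_1_iff[THEN iffD2])

lemma wt_measurable [measurable]: "wt \<in> borel_measurable borel"
  unfolding wt_def[abs_def] by measurable

lemma inverse_wt: "inverse (wt x) = (\<Prod>b\<in>Basis. 1 + (x \<bullet> b)\<^sup>2)"
  unfolding wt_def by (simp add: prod_inversef[symmetric, unfolded o_def])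

lemma inverse_wt_le: "inverse (wt (x::'a::euclidean_space)) \<le> (1 + norm x) ^ (2 * DIM('a))"
proof -
  have "inverse (wt x) \<le> (\<Prod>b\<in>(Basis::'a set). (1 + norm x)\<^sup>2)"
    unfolding inverse_wt
  proof (rule prod_mono)
    fix b :: 'a assume b: "b \<in> Basis"
    have "(x \<bullet> b)\<^sup>2 \<le> (norm x)\<^sup>2" using Basis_le_norm[OF b, of x] power_mono[of "\<bar>x \<bullet> b\<bar>" "norm x" 2] by simp
    then show "0 \<le> 1 + (x \<bullet> b)\<^sup>2 \<and> 1 + (x \<bullet> b)\<^sup>2 \<le> (1 + norm x)\<^sup>2"
      by (simp add: power2_sum add_increasing2)
  qed
  also have "\<dots> = (1 + norm x) ^ (2 * DIM('a))" by (simp add: power_mult)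
  finally show ?thesis .
qed

lemma le_wt: "1 \<le> wt (x::'a::euclidean_space) * (1 + norm x) ^ (2 * DIM('a))"
  using mult_left_mono[OF inverse_wt_le[of x] wt_nonneg[of x]] wt_pos[of x] by simp

lemma integrable_inverse_one_plus_square: "integrable lborel (\<lambda>x::real. inverse (1 + x\<^sup>2))"
  using integrable_inverse_1_plus_square by (simp add: set_integrable_def einterval_def)

text \<open>\<open>lborel_eq\<close> presents Lebesgue measure as the image of a product of measures
  on the line indexed by \<open>Basis\<close>; what remains is Fubini's theorem for finite
  products.\<close>

lemma
  fixes f :: "'a::euclidean_space \<Rightarrow> real \<Rightarrow> 'b::{real_normed_field,banach,second_countable_topology}"
  assumes "\<And>b. b \<in> Basis \<Longrightarrow> integrable lborel (f b)"
  shows integrable_lborel_prod: "integrable lborel (\<lambda>x. \<Prod>b\<in>Basis. f b (x \<bullet> b))"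
    and integral_lborel_prod: "(\<integral>x. (\<Prod>b\<in>Basis. f b (x \<bullet> b)) \<partial>lborel) = (\<Prod>b\<in>Basis. integral\<^sup>L lborel (f b))"
proof -
  interpret product_sigma_finite "\<lambda>b::'a. lborel :: real measure" ..
  have [measurable]: "f b \<in> borel_measurable borel" if "b \<in> Basis" for b
    using borel_measurable_integrable[OF assms[OF that]] by simp
  have m: "(\<lambda>x. \<Prod>b\<in>Basis. f b (x \<bullet> b)) \<in> borel_measurable borel" by measurable
  have eq: "(\<Prod>b\<in>Basis. f b ((\<Sum>c\<in>Basis. g c *\<^sub>R c) \<bullet> b)) = (\<Prod>b\<in>Basis. f b (g b))" for g :: "'a \<Rightarrow> real"
    by (intro prod.cong) auto
  show "integrable lborel (\<lambda>x. \<Prod>b\<in>Basis. f b (x \<bullet> b))"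
    unfolding lborel_eq[where 'a='a] using product_integrable_prod[of Basis f] assms
    by (subst integrable_distr_eq) (auto simp: m eq)
  show "(\<integral>x. (\<Prod>b\<in>Basis. f b (x \<bullet> b)) \<partial>lborel) = (\<Prod>b\<in>Basis. integral\<^sup>L lborel (f b))"
    unfolding lborel_eq[where 'a='a] using product_integral_prod[of Basis f] assms
    by (subst integral_distr) (auto simp: m eq)
qed

lemma integrable_wt: "integrable lborel (wt :: 'a::euclidean_space \<Rightarrow> real)"
  unfolding wt_def[abs_def] by (intro integrable_lborel_prod integrable_inverse_one_plus_square)

text \<open>\<open>2 * DIM('a)\<close> further powers of decay are exchanged for the integrable
  weight.\<close>

lemma rapid_le_wt:
  fixes f :: "'a::euclidean_space \<Rightarrow> complex"
  assumes "rapid f"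
  obtains C where "C > 0" "\<And>x. (1 + norm x) ^ k * norm (f x) \<le> C * wt x"
proof -
  obtain C where C: "C > 0" "\<And>x. (1 + norm x) ^ (k + 2 * DIM('a)) * norm (f x) \<le> C"
    using rapidE[OF assms, where k="k + 2 * DIM('a)"] by blast
  have "(1 + norm x) ^ k * norm (f x) \<le> C * wt x" for x
  proof -
    have "(1 + norm x) ^ k * norm (f x) * 1 \<le> (1 + norm x) ^ k * norm (f x) * (wt x * (1 + norm x) ^ (2 * DIM('a)))"
      by (intro mult_left_mono le_wt) simp
    also have "\<dots> = ((1 + norm x) ^ (k + 2 * DIM('a)) * norm (f x)) * wt x"
      by (simp add: power_add mult_ac)
    also have "\<dots> \<le> C * wt x" by (intro mult_right_mono C wt_nonneg)
    finally show ?thesis by simp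
  qed
  with C(1) show ?thesis by (rule that)
qed

text \<open>Only y receives the weight, and the constant is uniform in x, so integrating over y
  keeps the decay in x.\<close>

lemma rapid_Pair_le_wt:
  fixes f :: "'a::euclidean_space \<times> 'b::euclidean_space \<Rightarrow> complex"
  assumes "rapid f"
  obtains C where "C > 0" "\<And>x y. (1 + norm x) ^ k * norm (f (x, y)) \<le> C * wt y"
proof -
  obtain C where C: "C > 0" "\<And>p. (1 + norm p) ^ (k + 2 * DIM('b)) * norm (f p) \<le> C"
    using rapidE[OF assms, where k="k + 2 * DIM('b)"] by blast
  have "(1 + norm x) ^ k * norm (f (x, y)) \<le> C * wt y" for x y
  proof -
    have "(1 + norm x) ^ k * norm (f (x, y)) * 1 \<le> (1 + norm (x, y)) ^ k * norm (f (x, y)) * (wt y * (1 + norm (x, y)) ^ (2 * DIM('b)))"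
    proof (intro mult_mono)
      show "1 \<le> wt y * (1 + norm (x, y)) ^ (2 * DIM('b))"
        by (rule order_trans[OF le_wt[of y]]) (intro mult_left_mono power_mono, auto simp: norm_Pair_ge wt_nonneg)
    qed (auto intro!: power_mono simp: norm_Pair_ge wt_nonneg)
    also have "\<dots> = ((1 + norm (x, y)) ^ (k + 2 * DIM('b)) * norm (f (x, y))) * wt y"
      by (simp add: power_add mult_ac)
    also have "\<dots> \<le> C * wt y" by (intro mult_right_mono C wt_nonneg)
    finally show ?thesis by simp
  qed
  with C(1) show ?thesis by (rule that)
qed

lemma schwartz_integrable_weighted:
  fixes f :: "'a::euclidean_space \<Rightarrow> complex"
  assumes "f \<in> schwartz"
  shows "integrable lborel (\<lambda>x. (1 + norm x) ^ k * norm (f x))"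
proof -
  obtain C where C: "C > 0" "\<And>x. (1 + norm x) ^ k * norm (f x) \<le> C * wt x"
    using rapid_le_wt[OF schwartz_rapid[OF assms], where k=k] by blast
  note [measurable] = schwartz_measurable[OF assms]
  show ?thesis
    by (rule Bochner_Integration.integrable_bound[OF integrable_mult_right[OF integrable_wt, of C]])
      (use C wt_nonneg in \<open>auto intro!: AE_I2 order_trans[OF C(2)]\<close>)
qed

lemma schwartz_integrable: "f \<in> schwartz \<Longrightarrow> integrable lborel f"
  using schwartz_integrable_weighted[of f 0] schwartz_measurable[of f]
  by (simp add: integrable_norm_iff)

text \<open>Dominated convergence for the difference quotients, tested along sequences tending to 0.
  The mean value inequality turns the bound on the derivative into a bound on the quotients.\<close>

lemma has_derivative_integral:
  fixes F :: "'a::euclidean_space \<Rightarrow> 'y \<Rightarrow> complex"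
  assumes int: "\<And>x. integrable M (F x)"
    and der: "\<And>x y. ((\<lambda>x. F x y) has_derivative F' x y) (at x)"
    and bound: "\<And>x y v. norm (F' x y v) \<le> w y * norm v"
    and w: "integrable M w"
    and meas: "\<And>x v. (\<lambda>y. F' x y v) \<in> borel_measurable M"
  shows "((\<lambda>x. \<integral>y. F x y \<partial>M) has_derivative (\<lambda>v. \<integral>y. F' x y v \<partial>M)) (at x)"
proof -
  have lin: "linear (F' x y)" for y using der has_derivative_linear by blast
  have int': "integrable M (\<lambda>y. F' x y v)" for v
    by (rule Bochner_Integration.integrable_bound[OF integrable_mult_left[OF w, of "norm v"]])
      (use bound meas in \<open>auto intro!: AE_I2 order_trans[OF bound]\<close>)
  have "bounded_linear (\<lambda>v. \<integral>y. F' x y v \<partial>M)"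
  proof (rule bounded_linear_intro[of _ "\<integral>y. w y \<partial>M"])
    show "(\<integral>y. F' x y (a + b) \<partial>M) = (\<integral>y. F' x y a \<partial>M) + (\<integral>y. F' x y b \<partial>M)" for a b
      by (simp add: linear_add[OF lin] int')
    show "(\<integral>y. F' x y (r *\<^sub>R a) \<partial>M) = r *\<^sub>R (\<integral>y. F' x y a \<partial>M)" for r a
      by (simp add: linear_cmul[OF lin])
    show "norm (\<integral>y. F' x y a \<partial>M) \<le> norm a * (\<integral>y. w y \<partial>M)" for a
    proof -
      have "norm (\<integral>y. F' x y a \<partial>M) \<le> (\<integral>y. w y * norm a \<partial>M)"
        by (rule order_trans[OF integral_norm_bound]) (intro integral_mono int' w integrable_norm integrable_mult_left bound)
      then show ?thesis by (simp add: mult.commute)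
    qed
  qed
  moreover have "((\<lambda>h. norm ((\<integral>y. F (x + h) y \<partial>M) - (\<integral>y. F x y \<partial>M) - (\<integral>y. F' x y h \<partial>M)) / norm h) \<longlongrightarrow> 0) (at 0)"
    unfolding tendsto_at_iff_sequentially
  proof (intro allI impI, unfold o_def)
    fix X :: "nat \<Rightarrow> 'a" assume "\<forall>i. X i \<in> UNIV - {0}" and X: "X \<longlonglongrightarrow> 0"
    then have X0: "X i \<noteq> 0" for i by simp
    define R where "R i y = (F (x + X i) y - F x y - F' x y (X i)) /\<^sub>R norm (X i)" for i y
    have Rint: "integrable M (R i)" for i
      unfolding R_def by (intro integrable_scaleR_right Bochner_Integration.integrable_diff int int')
    \<comment> \<open>In the majorant \<open>2 * w\<close> one \<open>w\<close> is for the
      difference quotient and one for the derivative subtracted from it.\<close>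
    have "(\<lambda>i. \<integral>y. R i y \<partial>M) \<longlonglongrightarrow> (\<integral>y. 0 \<partial>M)"
    proof (rule integral_dominated_convergence[where w="\<lambda>y. 2 * w y"])
      show "AE y in M. (\<lambda>i. R i y) \<longlonglongrightarrow> 0"
      proof (rule AE_I2)
        fix y
        have "((\<lambda>h. norm (F (x + h) y - F x y - F' x y h) / norm h) \<longlongrightarrow> 0) (at 0)"
          using der[of y x] unfolding has_derivative_at by blast
        from this[unfolded tendsto_at_iff_sequentially, rule_format, of X]
        have "(\<lambda>i. norm (R i y)) \<longlonglongrightarrow> 0"
          using X X0 by (simp add: o_def R_def divide_inverse mult.commute)
        then show "(\<lambda>i. R i y) \<longlonglongrightarrow> 0" by (rule tendsto_norm_zero_cancel)
      qed
      show "AE y in M. norm (R i y) \<le> 2 * w y" for i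
      proof (rule AE_I2)
        fix y
        have "norm (F (x + X i) y - F x y) \<le> w y * norm ((x + X i) - x)"
        proof (rule differentiable_bound[of UNIV "\<lambda>x. F x y" "\<lambda>x. F' x y"])
          show "onorm (F' z y) \<le> w y" for z
            by (rule onorm_le) (simp add: bound)
        qed (use der in auto)
        then have "norm (F (x + X i) y - F x y - F' x y (X i)) \<le> w y * norm (X i) + w y * norm (X i)"
          by (intro order_trans[OF norm_triangle_ineq4[of "F (x + X i) y - F x y"]] add_mono bound) simp_all
        then show "norm (R i y) \<le> 2 * w y"
          using X0[of i] unfolding R_def norm_scaleR by (simp add: divide_simps mult_ac)
      qed
    qed (use Rint w in auto)
    then have "(\<lambda>i. norm (\<integral>y. R i y \<partial>M)) \<longlonglongrightarrow> 0" by (simp add: tendsto_norm_zero)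
    moreover have "norm (\<integral>y. R i y \<partial>M)
       = norm ((\<integral>y. F (x + X i) y \<partial>M) - (\<integral>y. F x y \<partial>M) - (\<integral>y. F' x y (X i) \<partial>M)) / norm (X i)" for i
      unfolding R_def by (simp add: int int' divide_inverse mult.commute)
    ultimately show "(\<lambda>i. norm ((\<integral>y. F (x + X i) y \<partial>M) - (\<integral>y. F x y \<partial>M) - (\<integral>y. F' x y (X i) \<partial>M)) / norm (X i)) \<longlonglongrightarrow> 0"
      by simp
  qed
  ultimately show ?thesis unfolding has_derivative_at by blast
qed

text \<open>The measure is a parameter because Lebesgue measure and finite measures both occur;
  integrability of \<open>wt\<close> is the condition common to them.\<close>

definition integrate_snd :: "'b measure \<Rightarrow> ('a \<times> 'b \<Rightarrow> complex) \<Rightarrow> 'a \<Rightarrow> complex" where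
  "integrate_snd \<nu> \<Theta> x = (\<integral>y. \<Theta> (x, y) \<partial>\<nu>)"

lemma schwartz_slice_fst:
  fixes \<Theta> :: "'a::euclidean_space \<times> 'b::euclidean_space \<Rightarrow> complex"
  assumes "\<Theta> \<in> schwartz"
  shows "(\<lambda>x. \<Theta> (x, y)) \<in> schwartz"
  using schwartz_affine[OF assms, of "\<lambda>x. (x, 0)" "(0, y)"] by (simp add: linear_iff inj_on_def)

lemma schwartz_slice_snd:
  fixes \<Theta> :: "'a::euclidean_space \<times> 'b::euclidean_space \<Rightarrow> complex"
  assumes "\<Theta> \<in> schwartz"
  shows "(\<lambda>y. \<Theta> (x, y)) \<in> schwartz"
  using schwartz_affine[OF assms, of "\<lambda>y. (0, y)" "(x, 0)"] by (simp add: linear_iff inj_on_def)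

lemma has_derivative_slice_fst:
  fixes \<Theta> :: "'a::euclidean_space \<times> 'b::euclidean_space \<Rightarrow> complex"
  assumes "\<Theta> \<in> schwartz"
  shows "((\<lambda>x. \<Theta> (x, y)) has_derivative (\<lambda>v. frechet_derivative \<Theta> (at (x, y)) (v, 0))) (at x)"
  by (rule has_derivative_compose[OF has_derivative_Pair[OF has_derivative_ident has_derivative_const]
        schwartz_has_derivative[OF assms]])

lemma iter_deriv_slice_fst:
  fixes \<Theta> :: "'a::euclidean_space \<times> 'b::euclidean_space \<Rightarrow> complex"
  assumes "\<Theta> \<in> schwartz" "set vs \<subseteq> Basis"
  shows "iter_deriv vs (\<lambda>x. \<Theta> (x, y)) = (\<lambda>x. iter_deriv (map (\<lambda>v. (v, 0)) vs) \<Theta> (x, y))"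
  using assms(2)
proof (induction vs)
  case (Cons v vs)
  have "iter_deriv (map (\<lambda>v. (v, 0)) vs) \<Theta> \<in> schwartz"
    using Cons.prems by (intro schwartz_iter_deriv assms) (auto simp: Basis_prod_def)
  from pd_eqI[OF has_derivative_slice_fst[OF this]] Cons show ?case by simp
qed simp

lemma
  fixes \<Theta> :: "'a::euclidean_space \<times> 'b::euclidean_space \<Rightarrow> complex"
  assumes \<nu>: "sets \<nu> = sets borel" "integrable \<nu> wt" and \<Theta>: "\<Theta> \<in> schwartz"
  shows integrable_slice_snd: "integrable \<nu> (\<lambda>y. \<Theta> (x, y))"
    and rapid_integrate_snd: "rapid (integrate_snd \<nu> \<Theta>)"
    and has_derivative_integrate_snd:
      "(integrate_snd \<nu> \<Theta> has_derivative (\<lambda>v. integrate_snd \<nu> (pd (v, 0) \<Theta>) x)) (at x)"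
proof -
  have meas: "(\<lambda>y. \<Theta> (x, y)) \<in> borel_measurable \<nu>" if "\<Theta> \<in> schwartz"
    for x and \<Theta> :: "'a::euclidean_space \<times> 'b::euclidean_space \<Rightarrow> complex"
    using schwartz_measurable[OF schwartz_slice_snd[OF that]] measurable_cong_sets[OF \<nu>(1) refl] by blast
  show int: "integrable \<nu> (\<lambda>y. \<Theta> (x, y))" for x
  proof -
    obtain C where C: "C > 0" "\<And>x y. (1 + norm x) ^ 0 * norm (\<Theta> (x, y)) \<le> C * wt y"
      using rapid_Pair_le_wt[OF schwartz_rapid[OF \<Theta>], where k=0] by blast
    show ?thesis
      by (rule Bochner_Integration.integrable_bound[OF integrable_mult_right[OF \<nu>(2), of C]])
        (use C(1) meas[OF \<Theta>] wt_nonneg in \<open>auto intro!: AE_I2 order_trans[OF C(2)[simplified]]\<close>)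
  qed
  show "rapid (integrate_snd \<nu> \<Theta>)" unfolding rapid_def
  proof
    fix k
    obtain C where C: "C > 0" "\<And>x y. (1 + norm x) ^ k * norm (\<Theta> (x, y)) \<le> C * wt y"
      using rapid_Pair_le_wt[OF schwartz_rapid[OF \<Theta>], where k=k] by blast
    have "(1 + norm x) ^ k * norm (integrate_snd \<nu> \<Theta> x) \<le> C * (\<integral>y. wt y \<partial>\<nu>)" for x
    proof -
      have "(1 + norm x) ^ k * norm (integrate_snd \<nu> \<Theta> x) \<le> (1 + norm x) ^ k * (\<integral>y. norm (\<Theta> (x, y)) \<partial>\<nu>)"
        unfolding integrate_snd_def by (intro mult_left_mono integral_norm_bound) auto
      also have "\<dots> = (\<integral>y. (1 + norm x) ^ k * norm (\<Theta> (x, y)) \<partial>\<nu>)" by simp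
      also have "\<dots> \<le> (\<integral>y. C * wt y \<partial>\<nu>)"
        by (intro integral_mono C integrable_mult_right integrable_norm int \<nu>)
      finally show ?thesis by simp
    qed
    then show "\<exists>C. \<forall>x. (1 + norm x) ^ k * norm (integrate_snd \<nu> \<Theta> x) \<le> C" by blast
  qed
  obtain C where C: "C > 0" "\<And>p v. (1 + norm p) ^ (2 * DIM('b)) * norm (frechet_derivative \<Theta> (at p) v) \<le> C * norm v"
    by (rule schwartz_deriv_bound[OF \<Theta>, where k="2 * DIM('b)"]) blast
  have "((\<lambda>x. \<integral>y. \<Theta> (x, y) \<partial>\<nu>) has_derivative (\<lambda>v. \<integral>y. frechet_derivative \<Theta> (at (x, y)) (v, 0) \<partial>\<nu>)) (at x)"
  proof (rule has_derivative_integral[where w="\<lambda>y. C * wt y"])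
    show "((\<lambda>x. \<Theta> (x, y)) has_derivative (\<lambda>v. frechet_derivative \<Theta> (at (x, y)) (v, 0))) (at x)" for x y
      by (rule has_derivative_slice_fst[OF \<Theta>])
    show "norm (frechet_derivative \<Theta> (at (x, y)) (v, 0)) \<le> C * wt y * norm v" for x y v
    proof -
      have "1 * norm (frechet_derivative \<Theta> (at (x, y)) (v, 0))
          \<le> (wt y * (1 + norm (x, y)) ^ (2 * DIM('b))) * norm (frechet_derivative \<Theta> (at (x, y)) (v, 0))"
      proof (intro mult_right_mono)
        show "1 \<le> wt y * (1 + norm (x, y)) ^ (2 * DIM('b))"
          by (rule order_trans[OF le_wt[of y]]) (intro mult_left_mono power_mono, auto simp: norm_Pair_ge wt_nonneg)
      qed simp
      also have "\<dots> = wt y * ((1 + norm (x, y)) ^ (2 * DIM('b)) * norm (frechet_derivative \<Theta> (at (x, y)) (v, 0)))"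
        by simp
      also have "\<dots> \<le> wt y * (C * norm (v, 0::'b))"
        by (intro mult_left_mono C wt_nonneg)
      finally show ?thesis by (simp add: norm_Pair mult_ac)
    qed
    show "(\<lambda>y. frechet_derivative \<Theta> (at (x, y)) (v, 0)) \<in> borel_measurable \<nu>" for x v
      using meas[OF schwartz_pd_any[OF \<Theta>, of "(v, 0)"]] .
  qed (use int \<nu>(2) in auto)
  then show "(integrate_snd \<nu> \<Theta> has_derivative (\<lambda>v. integrate_snd \<nu> (pd (v, 0) \<Theta>) x)) (at x)"
    by (simp add: integrate_snd_def[abs_def])
qed

lemma schwartz_integrate_snd:
  fixes \<Theta> :: "'a::euclidean_space \<times> 'b::euclidean_space \<Rightarrow> complex"
  assumes \<nu>: "sets \<nu> = sets borel" "integrable \<nu> wt" and \<Theta>: "\<Theta> \<in> schwartz"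
  shows "integrate_snd \<nu> \<Theta> \<in> schwartz"
proof (rule schwartz_coinduct[where S="integrate_snd \<nu> ` schwartz"])
  fix f assume "f \<in> integrate_snd \<nu> ` (schwartz :: ('a \<times> 'b \<Rightarrow> complex) set)"
  then obtain \<Theta> :: "'a \<times> 'b \<Rightarrow> complex" where f: "f = integrate_snd \<nu> \<Theta>" and \<Theta>: "\<Theta> \<in> schwartz" by blast
  note d = has_derivative_integrate_snd[OF \<nu> \<Theta>]
  have "\<forall>x. f differentiable at x" using d differentiable_def f by blast
  moreover have "rapid f" unfolding f by (rule rapid_integrate_snd[OF \<nu> \<Theta>])
  moreover have "pd v f \<in> integrate_snd \<nu> ` schwartz" for v
    unfolding f pd_eqI[OF d] using schwartz_pd_any[OF \<Theta>, of "(v, 0)"] by (intro image_eqI) auto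
  ultimately show "(\<forall>x. f differentiable at x) \<and> rapid f \<and> (\<forall>v\<in>Basis. pd v f \<in> integrate_snd \<nu> ` (schwartz :: ('a \<times> 'b \<Rightarrow> complex) set))"
    by simp
qed (use \<Theta> in simp)

lemma iter_deriv_integrate_snd:
  fixes \<Theta> :: "'a::euclidean_space \<times> 'b::euclidean_space \<Rightarrow> complex"
  assumes \<nu>: "sets \<nu> = sets borel" "integrable \<nu> wt" and \<Theta>: "\<Theta> \<in> schwartz" and vs: "set vs \<subseteq> Basis"
  shows "iter_deriv vs (integrate_snd \<nu> \<Theta>) = integrate_snd \<nu> (iter_deriv (map (\<lambda>v. (v, 0)) vs) \<Theta>)"
  using vs
proof (induction vs)
  case (Cons v vs)
  have "iter_deriv (map (\<lambda>v. (v, 0)) vs) \<Theta> \<in> schwartz"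
    using Cons.prems by (intro schwartz_iter_deriv \<Theta>) (auto simp: Basis_prod_def)
  from pd_eqI[OF has_derivative_integrate_snd[OF \<nu> this]] Cons show ?case by simp
qed simp

section \<open>Limits and integrals under a tempered distribution\<close>

lemma tempered_sum:
  assumes "tempered_distribution u" "\<And>i. i \<in> I \<Longrightarrow> f i \<in> schwartz" "finite I"
  shows "u (\<lambda>x. \<Sum>i\<in>I. c i * f i x) = (\<Sum>i\<in>I. c i * u (f i))"
proof -
  have add: "u (\<lambda>x. \<phi> x + \<psi> x) = u \<phi> + u \<psi>" if "\<phi> \<in> schwartz" "\<psi> \<in> schwartz" for \<phi> \<psi>
    using assms(1) that unfolding tempered_distribution_def by blast
  have scale: "u (\<lambda>x. c * \<phi> x) = c * u \<phi>" if "\<phi> \<in> schwartz" for c \<phi>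
    using assms(1) that unfolding tempered_distribution_def by blast
  show ?thesis using assms(3,2)
  proof (induction I rule: finite_induct)
    case empty
    then show ?case using scale[OF schwartz_zero, of 0] by simp
  next
    case (insert j J)
    then show ?case using add[of "\<lambda>x. c j * f j x" "\<lambda>x. \<Sum>i\<in>J. c i * f i x"]
      by (simp add: scale schwartz_cmult schwartz_sum)
  qed
qed

lemma tempered_diff:
  assumes "tempered_distribution u" "\<phi> \<in> schwartz" "\<psi> \<in> schwartz"
  shows "u (\<lambda>x. \<phi> x - \<psi> x) = u \<phi> - u \<psi>"
proof -
  have "u (\<lambda>x. \<phi> x + (- 1) * \<psi> x) = u \<phi> + (- 1) * u \<psi>"
    using assms schwartz_cmult[of \<psi> "-1"] unfolding tempered_distribution_def by metis
  then show ?thesis by simp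
qed

lemma schwartz_seminorm_le:
  "(\<And>x. norm x ^ k * norm (iter_deriv vs f x) \<le> B) \<Longrightarrow> schwartz_seminorm k vs f \<le> B"
  unfolding schwartz_seminorm_def by (rule cSUP_least) auto

lemma schwartz_seminorm_nonneg:
  assumes "f \<in> schwartz" "set vs \<subseteq> Basis"
  shows "0 \<le> schwartz_seminorm k vs f"
proof -
  have "bdd_above (range (\<lambda>x. norm x ^ k * norm (iter_deriv vs f x)))"
    using assms unfolding schwartz_def by simp
  from cSUP_upper[OF UNIV_I this, of 0] show ?thesis
    unfolding schwartz_seminorm_def by (rule order_trans[rotated]) simp
qed

lemma le_schwartz_seminorm:
  assumes "f \<in> schwartz" "set vs \<subseteq> Basis"
  shows "norm x ^ k * norm (iter_deriv vs f x) \<le> schwartz_seminorm k vs f"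
proof -
  have "bdd_above (range (\<lambda>x. norm x ^ k * norm (iter_deriv vs f x)))"
    using assms unfolding schwartz_def by simp
  from cSUP_upper[OF UNIV_I this] show ?thesis unfolding schwartz_seminorm_def .
qed

lemma finite_multi_indices: "finite {vs :: 'a::euclidean_space list. set vs \<subseteq> Basis \<and> length vs \<le> N}"
  by (rule finite_lists_length_le) simp

text \<open>Continuity involves finitely many seminorms, so constants that depend on the seminorm
  but not on i can be added up; a null sequence e shared by all seminorms then forces the value to
  be 0.\<close>

lemma tempered_null_limit:
  fixes u :: "('a::euclidean_space \<Rightarrow> complex) \<Rightarrow> complex"
  assumes u: "tempered_distribution u" and \<phi>: "\<phi> \<in> schwartz"
    and \<psi>: "\<And>i::nat. \<psi> i \<in> schwartz" "\<And>i. u (\<psi> i) = 0"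
    and e: "e \<longlonglongrightarrow> (0::real)"
    and approx: "\<And>k vs. set vs \<subseteq> Basis \<Longrightarrow> \<exists>C. \<forall>i x. norm x ^ k * norm (iter_deriv vs \<phi> x - iter_deriv vs (\<psi> i) x) \<le> C * e i"
  shows "u \<phi> = 0"
proof -
  obtain C N where CN: "\<And>\<phi>. \<phi> \<in> schwartz \<Longrightarrow> norm (u \<phi>) \<le>
        C * (\<Sum>k\<le>N. \<Sum>vs | set vs \<subseteq> Basis \<and> length vs \<le> N. schwartz_seminorm k vs \<phi>)"
    using u unfolding tempered_distribution_def by blast
  define B where "B k vs = (SOME C. \<forall>i x. norm x ^ k * norm (iter_deriv vs \<phi> x - iter_deriv vs (\<psi> i) x) \<le> C * e i)" for k vs
  have B: "norm x ^ k * norm (iter_deriv vs \<phi> x - iter_deriv vs (\<psi> i) x) \<le> B k vs * e i" if "set vs \<subseteq> Basis" for k vs i x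
    using someI_ex[OF approx[OF that, of k]] unfolding B_def by blast
  define D where "D = \<bar>C\<bar> * (\<Sum>k\<le>N. \<Sum>vs\<in>{vs :: 'a list. set vs \<subseteq> Basis \<and> length vs \<le> N}. B k vs)"
  have "norm (u \<phi>) \<le> D * e i" for i
  proof -
    let ?d = "\<lambda>x. \<phi> x - \<psi> i x"
    have d: "?d \<in> schwartz" by (intro schwartz_diff \<phi> \<psi>)
    have "norm (u \<phi>) = norm (u ?d)" using tempered_diff[OF u \<phi> \<psi>(1)[of i]] \<psi>(2) by simp
    also have "\<dots> \<le> C * (\<Sum>k\<le>N. \<Sum>vs | set vs \<subseteq> Basis \<and> length vs \<le> N. schwartz_seminorm k vs ?d)" by (rule CN[OF d])
    also have "\<dots> \<le> \<bar>C\<bar> * (\<Sum>k\<le>N. \<Sum>vs | set vs \<subseteq> Basis \<and> length vs \<le> N. schwartz_seminorm k vs ?d)"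
      by (intro mult_right_mono sum_nonneg schwartz_seminorm_nonneg d) auto
    also have "\<dots> \<le> \<bar>C\<bar> * (\<Sum>k\<le>N. \<Sum>vs | set vs \<subseteq> Basis \<and> length vs \<le> N. B k vs * e i)"
      by (intro mult_left_mono sum_mono schwartz_seminorm_le) (auto simp: iter_deriv_diff \<phi> \<psi> intro!: B)
    also have "\<dots> = D * e i" by (simp add: D_def sum_distrib_right sum_distrib_left mult_ac)
    finally show ?thesis .
  qed
  moreover have "(\<lambda>i. D * e i) \<longlonglongrightarrow> D * 0" by (intro tendsto_intros e)
  ultimately have "norm (u \<phi>) \<le> D * 0" by (intro LIMSEQ_le_const) auto
  then show ?thesis by simp
qed

text \<open>Makes the integral along a simple function a finite sum, and on finite sums a tempered
  distribution is linear.\<close>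

lemma integral_simple_comp:
  fixes g :: "'b \<Rightarrow> complex"
  assumes "finite_measure \<nu>" "simple_function \<nu> F"
  shows "(\<integral>y. g (F y) \<partial>\<nu>) = (\<Sum>z\<in>F ` space \<nu>. of_real (measure \<nu> (F -` {z} \<inter> space \<nu>)) * g z)"
proof -
  interpret finite_measure \<nu> by fact
  have fin: "finite (F ` space \<nu>)" and m: "F -` {z} \<inter> space \<nu> \<in> sets \<nu>" if "z \<in> F ` space \<nu>" for z
    using assms(2) that unfolding simple_function_def by auto
  have fin: "finite (F ` space \<nu>)" using assms(2) unfolding simple_function_def by auto
  have "(\<integral>y. g (F y) \<partial>\<nu>) = (\<integral>y. (\<Sum>z\<in>F ` space \<nu>. indicator (F -` {z} \<inter> space \<nu>) y *\<^sub>R g z) \<partial>\<nu>)"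
  proof (rule Bochner_Integration.integral_cong[OF refl])
    fix y assume y: "y \<in> space \<nu>"
    have "(\<Sum>z\<in>F ` space \<nu>. indicator (F -` {z} \<inter> space \<nu>) y *\<^sub>R g z)
        = (\<Sum>z\<in>F ` space \<nu>. if z = F y then g z else 0)"
      using y by (intro sum.cong) (auto simp: indicator_def)
    then show "g (F y) = (\<Sum>z\<in>F ` space \<nu>. indicator (F -` {z} \<inter> space \<nu>) y *\<^sub>R g z)"
      using y fin by simp
  qed
  also have "\<dots> = (\<Sum>z\<in>F ` space \<nu>. (\<integral>y. indicator (F -` {z} \<inter> space \<nu>) y *\<^sub>R g z \<partial>\<nu>))"
    by (intro Bochner_Integration.integral_sum integrable_scaleR_left) (auto intro!: integrable_real_indicator m simp: emeasure_eq_measure)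
  also have "\<dots> = (\<Sum>z\<in>F ` space \<nu>. of_real (measure \<nu> (F -` {z} \<inter> space \<nu>)) * g z)"
    using m by (intro sum.cong refl, subst integral_scaleR_left)
      (auto intro!: integrable_real_indicator simp: emeasure_eq_measure scaleR_conv_of_real)
  finally show ?thesis .
qed

text \<open>For close y and z the derivative gives a Lipschitz bound, otherwise boundedness gives
  \<open>2 * B\<close>. Truncation at 1 keeps the modulus integrable for every finite measure,
  whatever its moments.\<close>

lemma schwartz_slice_lipschitz:
  fixes \<Theta> :: "'a::euclidean_space \<times> 'b::euclidean_space \<Rightarrow> complex"
  assumes \<Theta>: "\<Theta> \<in> schwartz"
  obtains C where "C > 0" "\<And>x y z. norm x ^ k * norm (\<Theta> (x, y) - \<Theta> (x, z)) \<le> C * min 1 (norm (y - z))"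
proof -
  obtain A where A: "A > 0" "\<And>p v. (1 + norm p) ^ k * norm (frechet_derivative \<Theta> (at p) v) \<le> A * norm v"
    by (rule schwartz_deriv_bound[OF \<Theta>, where k=k]) blast
  obtain B where B: "B > 0" "\<And>p. (1 + norm p) ^ k * norm (\<Theta> p) \<le> B"
    by (rule rapidE[OF schwartz_rapid[OF \<Theta>], where k=k]) blast
  have le: "norm x ^ k * r \<le> (1 + norm (x, y)) ^ k * r" if "r \<ge> 0" for x :: 'a and y :: 'b and r
    using norm_Pair_ge(1)[of x y] that by (intro mult_right_mono power_mono) auto
  have "norm x ^ k * norm (\<Theta> (x, y) - \<Theta> (x, z)) \<le> (A + 2 * B) * min 1 (norm (y - z))" for x y z
  proof -
    have 1: "norm x ^ k * norm (\<Theta> (x, y) - \<Theta> (x, z)) \<le> A * norm (y - z)"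
    proof -
      have "norm ((norm x ^ k) *\<^sub>R \<Theta> (x, y) - (norm x ^ k) *\<^sub>R \<Theta> (x, z)) \<le> A * norm (y - z)"
      proof (rule differentiable_bound[of UNIV "\<lambda>y. (norm x ^ k) *\<^sub>R \<Theta> (x, y)" "\<lambda>y v. (norm x ^ k) *\<^sub>R frechet_derivative \<Theta> (at (x, y)) (0, v)"])
        show "((\<lambda>y. (norm x ^ k) *\<^sub>R \<Theta> (x, y)) has_derivative (\<lambda>v. (norm x ^ k) *\<^sub>R frechet_derivative \<Theta> (at (x, y)) (0, v))) (at y within UNIV)" for y
          by (intro has_derivative_scaleR_right has_derivative_compose[OF has_derivative_Pair[OF has_derivative_const has_derivative_ident]
                schwartz_has_derivative[OF \<Theta>]])
        show "onorm (\<lambda>v. (norm x ^ k) *\<^sub>R frechet_derivative \<Theta> (at (x, y)) (0, v)) \<le> A" for y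
        proof (rule onorm_le)
          fix v :: 'b
          have "norm x ^ k * norm (frechet_derivative \<Theta> (at (x, y)) (0, v)) \<le> A * norm (0::'a, v)"
            by (rule order_trans[OF le A(2)]) simp
          then show "norm ((norm x ^ k) *\<^sub>R frechet_derivative \<Theta> (at (x, y)) (0, v)) \<le> A * norm v" by simp
        qed
      qed auto
      then show ?thesis by (simp flip: scaleR_diff_right)
    qed
    have 2: "norm x ^ k * norm (\<Theta> (x, y) - \<Theta> (x, z)) \<le> 2 * B"
    proof -
      have b: "norm x ^ k * norm (\<Theta> (x, y)) \<le> B" for y
        by (rule order_trans[OF le B(2)]) simp
      have "norm x ^ k * norm (\<Theta> (x, y) - \<Theta> (x, z)) \<le> norm x ^ k * (norm (\<Theta> (x, y)) + norm (\<Theta> (x, z)))"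
        by (intro mult_left_mono norm_triangle_ineq4) simp
      with b[of y] b[of z] show ?thesis by (simp add: distrib_left)
    qed
    show ?thesis
    proof (cases "norm (y - z) \<le> 1")
      case True
      have "A * norm (y - z) \<le> (A + 2 * B) * norm (y - z)" using B(1) by (intro mult_right_mono) auto
      with 1 True show ?thesis by simp
    next
      case False
      with 2 A(1) show ?thesis by simp
    qed
  qed
  moreover have "A + 2 * B > 0" using A B by simp
  ultimately show ?thesis by (rule that[rotated])
qed

text \<open>Riemann sums: \<open>\<Theta>\<close> is integrated against simple functions approximating the identity.\<close>

lemma tempered_integrate_snd_zero:
  fixes \<Theta> :: "'a::euclidean_space \<times> 'b::euclidean_space \<Rightarrow> complex"
  assumes u: "tempered_distribution u" and \<nu>: "finite_measure \<nu>" "sets \<nu> = sets borel" and \<Theta>: "\<Theta> \<in> schwartz"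
    and zero: "\<And>y. u (\<lambda>x. \<Theta> (x, y)) = 0"
  shows "u (integrate_snd \<nu> \<Theta>) = 0"
proof -
  interpret finite_measure \<nu> by fact
  have sp: "space \<nu> = UNIV" using sets_eq_imp_space_eq[OF \<nu>(2)] by simp
  have wt_m: "wt \<in> borel_measurable \<nu>" using wt_measurable measurable_cong_sets[OF \<nu>(2) refl] by blast
  have wt: "integrable \<nu> wt"
    by (rule integrable_const_bound[of _ 1]) (auto simp: wt_m wt_le_1 wt_nonneg)
  have id: "(\<lambda>y::'b. y) \<in> borel_measurable \<nu>"
    using \<nu>(2) by (simp add: measurable_ident_sets)
  obtain F where F: "\<And>i. simple_function \<nu> (F i)" "\<And>y. (\<lambda>i. F i y) \<longlonglongrightarrow> y"
    using borel_measurable_implies_sequence_metric[OF id, of 0] unfolding sp by auto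
  have Fm: "F i \<in> borel_measurable \<nu>" for i by (rule borel_measurable_simple_function[OF F(1)])
  define c where "c i z = complex_of_real (measure \<nu> (F i -` {z} \<inter> space \<nu>))" for i z
  define \<psi> where "\<psi> i x = (\<Sum>z\<in>F i ` space \<nu>. c i z * \<Theta> (x, z))" for i x
  \<comment> \<open>The error of the i-th Riemann sum, in which F i y stands for y. It tends to 0 by
    dominated convergence with majorant 1 and serves as the common rate for all seminorms.\<close>
  define e where "e i = (\<integral>y. min 1 (norm (y - F i y)) \<partial>\<nu>)" for i
  have fin: "finite (F i ` space \<nu>)" for i using F(1) unfolding simple_function_def by auto
  have em: "(\<lambda>y. min 1 (norm (y - F i y))) \<in> borel_measurable \<nu>" for i
    using id Fm by measurable
  have eint: "integrable \<nu> (\<lambda>y. min 1 (norm (y - F i y)))" for i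
    by (rule integrable_const_bound[of _ 1]) (auto simp: em)
  show ?thesis
  proof (rule tempered_null_limit[OF u, where \<psi>=\<psi> and e=e])
    show "integrate_snd \<nu> \<Theta> \<in> schwartz" by (rule schwartz_integrate_snd[OF \<nu>(2) wt \<Theta>])
    show "\<psi> i \<in> schwartz" for i unfolding \<psi>_def[abs_def] by (intro schwartz_sum schwartz_slice_fst \<Theta>)
    show "u (\<psi> i) = 0" for i unfolding \<psi>_def[abs_def]
      by (subst tempered_sum[OF u schwartz_slice_fst[OF \<Theta>] fin]) (simp add: zero)
    have "e \<longlonglongrightarrow> (\<integral>y. 0 \<partial>\<nu>)" unfolding e_def
    proof (rule integral_dominated_convergence[where w="\<lambda>_. 1"])
      show "AE y in \<nu>. (\<lambda>i. min 1 (norm (y - F i y))) \<longlonglongrightarrow> 0"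
      proof (rule AE_I2)
        fix y
        have "(\<lambda>i. min 1 (norm (y - F i y))) \<longlonglongrightarrow> min 1 (norm (y - y))"
          by (intro tendsto_intros F(2))
        then show "(\<lambda>i. min 1 (norm (y - F i y))) \<longlonglongrightarrow> 0" by simp
      qed
    qed (use em in auto)
    then show "e \<longlonglongrightarrow> 0" by simp
    fix k and vs :: "'a list" assume vs: "set vs \<subseteq> Basis"
    define \<Xi> where "\<Xi> = iter_deriv (map (\<lambda>v. (v, 0::'b)) vs) \<Theta>"
    have \<Xi>: "\<Xi> \<in> schwartz"
      unfolding \<Xi>_def using vs by (intro schwartz_iter_deriv \<Theta>) (auto simp: Basis_prod_def)
    obtain C where C: "C > 0" "\<And>x y z. norm x ^ k * norm (\<Xi> (x, y) - \<Xi> (x, z)) \<le> C * min 1 (norm (y - z))"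
      by (rule schwartz_slice_lipschitz[OF \<Xi>, where k=k]) blast
    have "norm x ^ k * norm (iter_deriv vs (integrate_snd \<nu> \<Theta>) x - iter_deriv vs (\<psi> i) x) \<le> C * e i" for i x
    proof -
      have s: "(\<lambda>y. \<Xi> (x, y)) \<in> schwartz" by (rule schwartz_slice_snd[OF \<Xi>])
      have int1: "integrable \<nu> (\<lambda>y. \<Xi> (x, y))" by (rule integrable_slice_snd[OF \<nu>(2) wt \<Xi>])
      obtain B where B: "\<And>p. (1 + norm p) ^ 0 * norm (\<Xi> p) \<le> B"
        by (rule rapidE[OF schwartz_rapid[OF \<Xi>], where k=0]) blast
      have m2: "(\<lambda>y. \<Xi> (x, F i y)) \<in> borel_measurable \<nu>"
        using measurable_compose[OF Fm schwartz_measurable[OF s]] .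
      have int2: "integrable \<nu> (\<lambda>y. \<Xi> (x, F i y))"
        by (rule integrable_const_bound[of _ B]) (use B m2 in auto)
      have "iter_deriv vs (\<psi> i) x = (\<Sum>z\<in>F i ` space \<nu>. c i z * \<Xi> (x, z))"
        unfolding \<psi>_def[abs_def] \<Xi>_def
        by (subst iter_deriv_sum[OF schwartz_slice_fst[OF \<Theta>] vs]) (simp add: iter_deriv_slice_fst[OF \<Theta> vs])
      also have "\<dots> = (\<integral>y. \<Xi> (x, F i y) \<partial>\<nu>)"
        unfolding c_def by (rule integral_simple_comp[OF \<nu>(1) F(1), symmetric])
      finally have "iter_deriv vs (integrate_snd \<nu> \<Theta>) x - iter_deriv vs (\<psi> i) x = (\<integral>y. \<Xi> (x, y) - \<Xi> (x, F i y) \<partial>\<nu>)"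
        using int1 int2 by (simp add: iter_deriv_integrate_snd[OF \<nu>(2) wt \<Theta> vs] integrate_snd_def \<Xi>_def)
      then have "norm x ^ k * norm (iter_deriv vs (integrate_snd \<nu> \<Theta>) x - iter_deriv vs (\<psi> i) x)
          \<le> norm x ^ k * (\<integral>y. norm (\<Xi> (x, y) - \<Xi> (x, F i y)) \<partial>\<nu>)"
        by (simp add: mult_left_mono)
      also have "\<dots> = (\<integral>y. norm x ^ k * norm (\<Xi> (x, y) - \<Xi> (x, F i y)) \<partial>\<nu>)" by simp
      also have "\<dots> \<le> (\<integral>y. C * min 1 (norm (y - F i y)) \<partial>\<nu>)"
        by (intro integral_mono C integrable_mult_right integrable_norm Bochner_Integration.integrable_diff int1 int2 eint)
      finally show ?thesis by (simp add: e_def)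
    qed
    then show "\<exists>C. \<forall>i x. norm x ^ k * norm (iter_deriv vs (integrate_snd \<nu> \<Theta>) x - iter_deriv vs (\<psi> i) x) \<le> C * e i"
      by blast
  qed
qed

text \<open>The reciprocal of \<open>wt\<close> is a product of polynomials 1 + (y \<bullet> b)^2,
  and each is applied by multiplying twice with a coordinate.\<close>

lemma schwartz_divide_wt:
  fixes \<Theta> :: "'a::euclidean_space \<times> 'b::euclidean_space \<Rightarrow> complex"
  assumes "\<Theta> \<in> schwartz"
  shows "(\<lambda>p. of_real (inverse (wt (snd p))) * \<Theta> p) \<in> schwartz"
proof -
  have "(\<lambda>p. of_real (\<Prod>b\<in>A. 1 + (snd p \<bullet> b)\<^sup>2) * \<Theta> p) \<in> schwartz" if "finite A" for A :: "'b set"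
    using that
  proof (induction A rule: finite_induct)
    case (insert b A)
    let ?f = "\<lambda>p. of_real (\<Prod>b\<in>A. 1 + (snd p \<bullet> b)\<^sup>2) * \<Theta> p"
    have "(\<lambda>p. ?f p + of_real (p \<bullet> (0, b)) * (of_real (p \<bullet> (0, b)) * ?f p)) \<in> schwartz"
      by (intro schwartz_add schwartz_inner_mult insert.IH)
    then show ?case using insert(1,2)
      by (simp add: inner_prod_def power2_eq_square algebra_simps)
  qed (simp add: assms)
  from this[of Basis] show ?thesis by (simp add: inverse_wt)
qed

text \<open>The Riemann sums work for finite measures. Lebesgue measure is reduced to them by
  writing it as wt dy with 1 / wt moved into the integrand, which remains Schwartz.\<close>

lemma tempered_integrate_snd_lborel_zero:
  fixes \<Theta> :: "'a::euclidean_space \<times> 'b::euclidean_space \<Rightarrow> complex"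
  assumes u: "tempered_distribution u" and \<Theta>: "\<Theta> \<in> schwartz"
    and zero: "\<And>y. u (\<lambda>x. \<Theta> (x, y)) = 0"
  shows "u (integrate_snd lborel \<Theta>) = 0"
proof -
  let ?\<nu> = "density lborel (\<lambda>y::'b. ennreal (wt y))"
  let ?\<Theta> = "\<lambda>p. of_real (inverse (wt (snd p))) * \<Theta> p"
  have "u (integrate_snd ?\<nu> ?\<Theta>) = 0"
  proof (rule tempered_integrate_snd_zero[OF u])
    show "finite_measure ?\<nu>"
      by (rule finite_measureI) (use integrable_wt in \<open>simp add: emeasure_density integrable_iff_bounded wt_nonneg less_top\<close>)
    show "u (\<lambda>x. ?\<Theta> (x, y)) = 0" for y
      using u schwartz_slice_fst[OF \<Theta>] zero[of y] unfolding tempered_distribution_def by simp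
  qed (use schwartz_divide_wt[OF \<Theta>] in simp_all)
  moreover have "integrate_snd ?\<nu> ?\<Theta> = integrate_snd lborel \<Theta>"
  proof
    fix x
    note [measurable] = schwartz_measurable[OF schwartz_slice_snd[OF \<Theta>, of x]]
    have "integrate_snd ?\<nu> ?\<Theta> x = (\<integral>y. wt y *\<^sub>R (of_real (inverse (wt y)) * \<Theta> (x, y)) \<partial>lborel)"
      unfolding integrate_snd_def by (subst integral_density) (auto simp: wt_nonneg)
    also have "\<dots> = integrate_snd lborel \<Theta> x"
      unfolding integrate_snd_def
      by (intro Bochner_Integration.integral_cong refl)
         (simp add: scaleR_conv_of_real less_imp_neq[OF wt_pos, symmetric])
    finally show "integrate_snd ?\<nu> ?\<Theta> x = integrate_snd lborel \<Theta> x" .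
  qed
  ultimately show ?thesis by simp
qed


section \<open>Gaussians and density of their time-frequency shifts\<close>

lemma integral_lborel_affine:
  fixes f :: "'a::euclidean_space \<Rightarrow> complex"
  assumes [measurable]: "f \<in> borel_measurable borel" and c: "c \<noteq> 0"
  shows "(\<integral>x. f x \<partial>lborel) = \<bar>c\<bar> ^ DIM('a) *\<^sub>R (\<integral>x. f (t + c *\<^sub>R x) \<partial>lborel)"
proof -
  have "(\<integral>x. f x \<partial>lborel) = integral\<^sup>L (density (distr lborel borel (\<lambda>x. t + c *\<^sub>R x)) (\<lambda>_. ennreal (\<bar>c\<bar> ^ DIM('a)))) f"
    using arg_cong[OF lborel_affine[OF c, of t], of "\<lambda>M. integral\<^sup>L M f"] by simp
  also have "\<dots> = (\<integral>x. \<bar>c\<bar> ^ DIM('a) *\<^sub>R f (t + c *\<^sub>R x) \<partial>lborel)"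
    by (subst integral_density, simp_all, subst integral_distr, simp_all)
  finally show ?thesis by simp
qed

lemma integrable_mult_cis:
  assumes "integrable M f" "B \<in> borel_measurable M"
  shows "integrable M (\<lambda>x. f x * cis (B x))"
proof (rule Bochner_Integration.integrable_bound[OF assms(1)])
  have "(\<lambda>x. cis (B x)) \<in> borel_measurable M"
    using assms(2) unfolding cis_conv_exp by measurable
  then show "(\<lambda>x. f x * cis (B x)) \<in> borel_measurable M" using assms(1) by measurable
qed (simp add: norm_mult)

lemma
  fixes \<eta> :: real
  assumes a: "a > 0"
  shows integrable_gaussian_cis_real: "integrable lborel (\<lambda>x. complex_of_real (exp (- pi * a * x\<^sup>2)) * cis (2 * pi * (x * \<eta>)))" (is ?I)
    and integral_gaussian_cis_real: "(\<integral>x. complex_of_real (exp (- pi * a * x\<^sup>2)) * cis (2 * pi * (x * \<eta>)) \<partial>lborel)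
      = of_real (exp (- pi * \<eta>\<^sup>2 / a) / sqrt a)"
proof -
  have "integrable lborel (\<lambda>x::real. complex_of_real (exp (- pi * a * x\<^sup>2)))"
    using schwartz_integrable[OF schwartz_gaussian_affine[OF a, of "0::real"]] by simp
  then show ?I by (rule integrable_mult_cis) simp
  \<comment> \<open>The scaling under which the Gaussian becomes the standard normal density, so
    that its characteristic function gives the value.\<close>
  define c where "c = sqrt (2 * pi * a)"
  have c: "c > 0" "c\<^sup>2 = 2 * pi * a" using a by (auto simp: c_def)
  define t where "t = 2 * pi * \<eta> / c"
  have tc: "t * c = 2 * pi * \<eta>" using c by (simp add: t_def)
  have "t\<^sup>2 / 2 = pi * \<eta>\<^sup>2 / a"
    using a unfolding t_def power_divide power_mult_distrib c(2) by (simp add: power2_eq_square[of pi])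
  then have "of_real (exp (- pi * \<eta>\<^sup>2 / a)) = char std_normal_distribution t"
    by (simp add: char_std_normal_distribution)
  also have "\<dots> = (\<integral>x. std_normal_density x *\<^sub>R iexp (t * x) \<partial>lborel)"
    unfolding char_def by (subst integral_density) auto
  also have "\<dots> = c *\<^sub>R (\<integral>x. std_normal_density (c * x) *\<^sub>R iexp (t * (c * x)) \<partial>lborel)"
    using lborel_integral_real_affine[of c "\<lambda>x. std_normal_density x *\<^sub>R iexp (t * x)" 0] c by simp
  also have "\<dots> = c *\<^sub>R (\<integral>x. (1 / sqrt (2 * pi)) *\<^sub>R (complex_of_real (exp (- pi * a * x\<^sup>2)) * cis (2 * pi * (x * \<eta>))) \<partial>lborel)"
  proof (intro arg_cong[where f="scaleR c"] Bochner_Integration.integral_cong refl)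
    fix x
    have "(c * x)\<^sup>2 / 2 = pi * a * x\<^sup>2" using c by (simp add: power_mult_distrib)
    moreover have "t * (c * x) = 2 * pi * (x * \<eta>)" using tc by (simp add: mult_ac)
    then have "iexp (t * (c * x)) = cis (2 * pi * (x * \<eta>))" by (simp only: cis_conv_exp)
    ultimately show "std_normal_density (c * x) *\<^sub>R iexp (t * (c * x))
       = (1 / sqrt (2 * pi)) *\<^sub>R (complex_of_real (exp (- pi * a * x\<^sup>2)) * cis (2 * pi * (x * \<eta>)))"
      by (simp only: std_normal_density_def scaleR_conv_of_real) simp
  qed
  also have "\<dots> = (c / sqrt (2 * pi)) *\<^sub>R (\<integral>x. complex_of_real (exp (- pi * a * x\<^sup>2)) * cis (2 * pi * (x * \<eta>)) \<partial>lborel)"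
    by simp
  also have "c / sqrt (2 * pi) = sqrt a" by (simp add: c_def real_sqrt_mult)
  finally show "(\<integral>x. complex_of_real (exp (- pi * a * x\<^sup>2)) * cis (2 * pi * (x * \<eta>)) \<partial>lborel)
      = of_real (exp (- pi * \<eta>\<^sup>2 / a) / sqrt a)"
    using a by (simp add: scaleR_conv_of_real field_simps)
qed

lemma norm_square_eq_sum: "(norm (x::'a::euclidean_space))\<^sup>2 = (\<Sum>b\<in>Basis. (x \<bullet> b)\<^sup>2)"
  unfolding power2_norm_eq_inner by (subst euclidean_inner) (simp add: power2_eq_square)

lemma cis_sum: "finite A \<Longrightarrow> cis (\<Sum>b\<in>A. f b) = (\<Prod>b\<in>A. cis (f b))"
  by (induction A rule: finite_induct) (auto simp: cis_mult[symmetric])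

lemma integral_gaussian_cis:
  fixes \<xi> :: "'a::euclidean_space"
  assumes a: "a > 0"
  shows "(\<integral>x. complex_of_real (exp (- pi * a * (norm x)\<^sup>2)) * cis (2 * pi * (x \<bullet> \<xi>)) \<partial>lborel)
      = of_real (exp (- pi * (norm \<xi>)\<^sup>2 / a) / sqrt a ^ DIM('a))"
proof -
  let ?f = "\<lambda>b x. complex_of_real (exp (- pi * a * x\<^sup>2)) * cis (2 * pi * (x * (\<xi> \<bullet> b)))"
  have e: "exp (- pi * r * (norm x)\<^sup>2) = (\<Prod>b\<in>Basis. exp (- pi * r * (x \<bullet> b)\<^sup>2))" for r and x :: 'a
    unfolding norm_square_eq_sum sum_distrib_left by (rule exp_sum) simp
  have "complex_of_real (exp (- pi * a * (norm x)\<^sup>2)) * cis (2 * pi * (x \<bullet> \<xi>)) = (\<Prod>b\<in>Basis. ?f b (x \<bullet> b))" for x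
  proof -
    have "cis (2 * pi * (x \<bullet> \<xi>)) = (\<Prod>b\<in>Basis. cis (2 * pi * ((x \<bullet> b) * (\<xi> \<bullet> b))))"
      by (subst euclidean_inner) (simp add: sum_distrib_left cis_sum)
    then show ?thesis by (simp only: e of_real_prod prod.distrib)
  qed
  then have "(\<integral>x. complex_of_real (exp (- pi * a * (norm x)\<^sup>2)) * cis (2 * pi * (x \<bullet> \<xi>)) \<partial>lborel)
     = (\<Prod>b\<in>(Basis::'a set). of_real (exp (- pi * (\<xi> \<bullet> b)\<^sup>2 / a) / sqrt a))"
    by (simp only: integral_lborel_prod[of ?f, OF integrable_gaussian_cis_real[OF a]] integral_gaussian_cis_real[OF a])
  also have "\<dots> = of_real ((\<Prod>b\<in>(Basis::'a set). exp (- pi * (1 / a) * (\<xi> \<bullet> b)\<^sup>2)) / sqrt a ^ DIM('a))"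
    by (simp add: prod_dividef)
  also have "\<dots> = of_real (exp (- pi * (norm \<xi>)\<^sup>2 / a) / sqrt a ^ DIM('a))"
    by (simp only: e[symmetric]) simp
  finally show ?thesis .
qed

section \<open>Gaussian mollification\<close>

definition gaussian :: "'a::euclidean_space \<Rightarrow> complex" where
  "gaussian x = of_real (exp (- pi * (norm x)\<^sup>2))"

lemma gaussian_schwartz: "gaussian \<in> schwartz"
  using schwartz_gaussian by (simp add: gaussian_def[abs_def])

lemma integral_gaussian: "(\<integral>x. gaussian (x::'a::euclidean_space) \<partial>lborel) = 1"
  using integral_gaussian_cis[of 1 "0::'a"] by (simp add: gaussian_def)

text \<open>Convolution of f with the Gaussian of width h, after the substitution that puts h into
  the argument of f: derivatives fall on f, and the comparison with f takes place under the
  integral.\<close>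

definition mollify :: "real \<Rightarrow> ('a::euclidean_space \<Rightarrow> complex) \<Rightarrow> 'a \<Rightarrow> complex" where
  "mollify h f = integrate_snd lborel (\<lambda>p. f (fst p - h *\<^sub>R snd p) * gaussian (snd p))"

lemma schwartz_mollify_integrand:
  fixes f :: "'a::euclidean_space \<Rightarrow> complex"
  assumes "f \<in> schwartz"
  shows "(\<lambda>p. f (fst p - h *\<^sub>R snd p) * gaussian (snd p)) \<in> schwartz"
proof -
  have "(\<lambda>p. (\<lambda>q. f (fst q) * gaussian (snd q)) ((\<lambda>p. (fst p - h *\<^sub>R snd p, snd p)) p + 0)) \<in> schwartz"
    by (intro schwartz_affine[OF schwartz_tensor[OF assms gaussian_schwartz]])
       (auto simp: linear_iff inj_on_def algebra_simps)
  then show ?thesis by simp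
qed

lemma integrable_lborel_wt: "sets lborel = sets borel" "integrable lborel (wt :: 'a::euclidean_space \<Rightarrow> real)"
  by (simp_all add: integrable_wt)

lemma schwartz_mollify: "f \<in> schwartz \<Longrightarrow> mollify h f \<in> schwartz"
  unfolding mollify_def by (intro schwartz_integrate_snd integrable_lborel_wt schwartz_mollify_integrand)

lemma pd_mollify:
  assumes f: "f \<in> schwartz"
  shows "pd v (mollify h f) = mollify h (pd v f)"
proof -
  let ?T = "\<lambda>p. f (fst p - h *\<^sub>R snd p) * gaussian (snd p)"
  note T = schwartz_mollify_integrand[OF f, of h]
  have "pd (v, 0) ?T (x, z) = pd v f (x - h *\<^sub>R z) * gaussian z" for x z
  proof -
    have "((\<lambda>x. f (x - h *\<^sub>R z) * gaussian z) has_derivative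
        (\<lambda>v. frechet_derivative f (at (x - h *\<^sub>R z)) v * gaussian z)) (at x)"
    proof (rule has_derivative_mult_left, rule has_derivative_compose[OF _ schwartz_has_derivative[OF f]])
      show "((\<lambda>x. x - h *\<^sub>R z) has_derivative (\<lambda>v. v)) (at x)"
        by (auto intro!: derivative_eq_intros)
    qed
    from fun_cong[OF has_derivative_unique[OF this has_derivative_slice_fst[OF T, of z x, simplified]], of v]
    show ?thesis by simp
  qed
  then show ?thesis
    using pd_eqI[OF has_derivative_integrate_snd[OF integrable_lborel_wt T]]
    by (simp add: mollify_def integrate_snd_def[abs_def])
qed

lemma iter_deriv_mollify:
  assumes "f \<in> schwartz" "set vs \<subseteq> Basis"
  shows "iter_deriv vs (mollify h f) = mollify h (iter_deriv vs f)"
  using assms(2) by (induction vs) (auto simp: pd_mollify schwartz_iter_deriv assms(1))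

text \<open>The mean value inequality on the segment from x to x - w compares weights at different
  points. For y on it, 1 + |x| \<le> (1 + |y|) (1 + |w|), which is the source of the factor (1 +
  |w|)^k.\<close>

lemma schwartz_shift_lipschitz:
  fixes f :: "'a::euclidean_space \<Rightarrow> complex"
  assumes f: "f \<in> schwartz"
  obtains C where "C > 0" "\<And>x w. (1 + norm x) ^ k * norm (f (x - w) - f x) \<le> C * norm w * (1 + norm w) ^ k"
proof -
  obtain A where A: "A > 0" "\<And>p v. (1 + norm p) ^ k * norm (frechet_derivative f (at p) v) \<le> A * norm v"
    by (rule schwartz_deriv_bound[OF f, where k=k]) blast
  have "(1 + norm x) ^ k * norm (f (x - w) - f x) \<le> A * norm w * (1 + norm w) ^ k" for x w
  proof -
    let ?r = "(1 + norm x) ^ k"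
    have "norm (?r *\<^sub>R f (x - w) - ?r *\<^sub>R f x) \<le> (A * (1 + norm w) ^ k) * norm ((x - w) - x)"
    proof (rule differentiable_bound[of "closed_segment x (x - w)" "\<lambda>y. ?r *\<^sub>R f y" "\<lambda>y v. ?r *\<^sub>R frechet_derivative f (at y) v"])
      show "((\<lambda>y. ?r *\<^sub>R f y) has_derivative (\<lambda>v. ?r *\<^sub>R frechet_derivative f (at y) v)) (at y within closed_segment x (x - w))" for y
        by (rule has_derivative_scaleR_right[OF has_derivative_at_withinI[OF schwartz_has_derivative[OF f]]])
      fix y assume "y \<in> closed_segment x (x - w)"
      then have "norm (y - x) \<le> norm w" using segment_bound(1)[of y x "x - w"] by simp
      then have "1 + norm x \<le> 1 + norm y + norm w" using norm_triangle_ineq3[of x y] by (simp add: norm_minus_commute)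
      also have "\<dots> \<le> (1 + norm y) * (1 + norm w)" by (simp add: algebra_simps)
      finally have le: "?r \<le> ((1 + norm y) * (1 + norm w)) ^ k" by (intro power_mono) auto
      show "onorm (\<lambda>v. ?r *\<^sub>R frechet_derivative f (at y) v) \<le> A * (1 + norm w) ^ k"
      proof (rule onorm_le)
        fix v
        have "?r * norm (frechet_derivative f (at y) v) \<le> ((1 + norm y) * (1 + norm w)) ^ k * norm (frechet_derivative f (at y) v)"
          by (intro mult_right_mono le) simp
        also have "\<dots> = (1 + norm w) ^ k * ((1 + norm y) ^ k * norm (frechet_derivative f (at y) v))"
          by (simp add: power_mult_distrib mult_ac)
        also have "\<dots> \<le> (1 + norm w) ^ k * (A * norm v)" by (intro mult_left_mono A) simp
        finally show "norm (?r *\<^sub>R frechet_derivative f (at y) v) \<le> A * (1 + norm w) ^ k * norm v"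
          by (simp add: mult_ac)
      qed
    qed auto
    then show ?thesis by (simp flip: scaleR_diff_right add: mult_ac)
  qed
  with A(1) show ?thesis by (rule that)
qed

text \<open>The Gaussian has integral 1, so the difference is an average of f (x - h z) - f x. The
  shift estimate bounds it by h times a Gaussian moment of order k + 1; the rate h is the same for
  all weights, as \<open>tempered_null_limit\<close> requires.\<close>

lemma mollify_approx:
  fixes f :: "'a::euclidean_space \<Rightarrow> complex"
  assumes f: "f \<in> schwartz"
  obtains C where "\<And>h x. 0 \<le> h \<Longrightarrow> h \<le> 1 \<Longrightarrow> (1 + norm x) ^ k * norm (mollify h f x - f x) \<le> C * h"
proof -
  obtain A where A: "A > 0" "\<And>x w. (1 + norm x) ^ k * norm (f (x - w) - f x) \<le> A * norm w * (1 + norm w) ^ k"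
    by (rule schwartz_shift_lipschitz[OF f, where k=k]) blast
  let ?G = "\<lambda>z::'a. (1 + norm z) ^ (k + 1) * norm (gaussian z)"
  have G: "integrable lborel ?G" by (rule schwartz_integrable_weighted[OF gaussian_schwartz])
  have "(1 + norm x) ^ k * norm (mollify h f x - f x) \<le> (A * (\<integral>z. ?G z \<partial>lborel)) * h" if h: "0 \<le> h" "h \<le> 1" for h x
  proof -
    note T = schwartz_mollify_integrand[OF f, of h]
    have i1: "integrable lborel (\<lambda>z. f (x - h *\<^sub>R z) * gaussian z)"
      using integrable_slice_snd[OF integrable_lborel_wt T, of x] by simp
    have i2: "integrable lborel (\<lambda>z::'a. f x * gaussian z)"
      by (intro integrable_mult_right schwartz_integrable gaussian_schwartz)
    have "mollify h f x - f x = (\<integral>z. f (x - h *\<^sub>R z) * gaussian z \<partial>lborel) - (\<integral>z. f x * gaussian (z::'a) \<partial>lborel)"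
      using integral_gaussian[where 'a='a] by (simp add: mollify_def integrate_snd_def)
    also have "\<dots> = (\<integral>z. (f (x - h *\<^sub>R z) - f x) * gaussian z \<partial>lborel)"
      by (simp only: left_diff_distrib Bochner_Integration.integral_diff[OF i1 i2])
    finally have eq: "mollify h f x - f x = (\<integral>z. (f (x - h *\<^sub>R z) - f x) * gaussian z \<partial>lborel)" .
    have i3: "integrable lborel (\<lambda>z. (f (x - h *\<^sub>R z) - f x) * gaussian z)"
      using Bochner_Integration.integrable_diff[OF i1 i2] by (simp add: left_diff_distrib)
    have "(1 + norm x) ^ k * norm (mollify h f x - f x)
        \<le> (1 + norm x) ^ k * (\<integral>z. norm ((f (x - h *\<^sub>R z) - f x) * gaussian z) \<partial>lborel)"
      unfolding eq by (intro mult_left_mono integral_norm_bound) simp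
    also have "\<dots> = (\<integral>z. (1 + norm x) ^ k * norm ((f (x - h *\<^sub>R z) - f x) * gaussian z) \<partial>lborel)" by simp
    also have "\<dots> \<le> (\<integral>z. (A * h) * ?G z \<partial>lborel)"
    proof (intro integral_mono integrable_mult_right integrable_norm i3 G)
      fix z :: 'a
      have hz: "h * norm z \<le> norm z" using h by (intro mult_left_le_one_le) auto
      have "(1 + norm x) ^ k * norm ((f (x - h *\<^sub>R z) - f x) * gaussian z)
          = ((1 + norm x) ^ k * norm (f (x - h *\<^sub>R z) - f x)) * norm (gaussian z)" by (simp only: norm_mult mult_ac)
      also have "\<dots> \<le> (A * norm (h *\<^sub>R z) * (1 + norm (h *\<^sub>R z)) ^ k) * norm (gaussian z)"
        by (intro mult_right_mono A) simp
      also have "\<dots> = (A * h) * (norm z * (1 + h * norm z) ^ k) * norm (gaussian z)"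
        using h by (simp only: norm_scaleR abs_of_nonneg mult_ac)
      also have "\<dots> \<le> (A * h) * ((1 + norm z) * (1 + norm z) ^ k) * norm (gaussian z)"
        using A h hz by (intro mult_right_mono mult_left_mono mult_mono power_mono) auto
      finally show "(1 + norm x) ^ k * norm ((f (x - h *\<^sub>R z) - f x) * gaussian z) \<le> (A * h) * ?G z"
        by (simp only: power_add power_one_right mult_ac)
    qed
    finally show ?thesis by (simp add: mult_ac)
  qed
  then show ?thesis by (rule that)
qed

text \<open>The substitution y = x - h z. In this form the mollification is a superposition of
  Gaussians centred at y, which both the density argument and Fourier inversion exploit.\<close>

lemma mollify_eq_convolution:
  fixes f :: "'a::euclidean_space \<Rightarrow> complex"
  assumes f: "f \<in> schwartz" and h: "h > 0"
  shows "mollify h f x = (\<integral>y. f y * of_real (exp (- pi * (1 / h\<^sup>2) * (norm (x - y))\<^sup>2) / h ^ DIM('a)) \<partial>lborel)"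
proof -
  note [measurable] = schwartz_measurable[OF f]
  have m: "(\<lambda>y. f y * of_real (exp (- pi * (1 / h\<^sup>2) * (norm (x - y))\<^sup>2) / h ^ DIM('a))) \<in> borel_measurable borel"
    by measurable
  have "(\<integral>y. f y * of_real (exp (- pi * (1 / h\<^sup>2) * (norm (x - y))\<^sup>2) / h ^ DIM('a)) \<partial>lborel)
      = \<bar>- h\<bar> ^ DIM('a) *\<^sub>R (\<integral>z. f (x + (- h) *\<^sub>R z) *
          of_real (exp (- pi * (1 / h\<^sup>2) * (norm (x - (x + (- h) *\<^sub>R z)))\<^sup>2) / h ^ DIM('a)) \<partial>lborel)"
    using h by (intro integral_lborel_affine[OF m]) simp
  also have "\<dots> = (\<integral>z. h ^ DIM('a) *\<^sub>R (f (x + (- h) *\<^sub>R z) *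
          of_real (exp (- pi * (1 / h\<^sup>2) * (norm (x - (x + (- h) *\<^sub>R z)))\<^sup>2) / h ^ DIM('a))) \<partial>lborel)"
    using h by simp
  also have "\<dots> = (\<integral>z. f (x - h *\<^sub>R z) * gaussian z \<partial>lborel)"
  proof (intro Bochner_Integration.integral_cong refl)
    fix z
    have "(1 / h\<^sup>2) * (norm (x - (x + (- h) *\<^sub>R z)))\<^sup>2 = (norm z)\<^sup>2"
      using h by (simp add: power_mult_distrib)
    then have "- pi * (1 / h\<^sup>2) * (norm (x - (x + (- h) *\<^sub>R z)))\<^sup>2 = - pi * (norm z)\<^sup>2"
      by (simp only: mult.assoc)
    then show "h ^ DIM('a) *\<^sub>R (f (x + (- h) *\<^sub>R z) *
          of_real (exp (- pi * (1 / h\<^sup>2) * (norm (x - (x + (- h) *\<^sub>R z)))\<^sup>2) / h ^ DIM('a)))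
        = f (x - h *\<^sub>R z) * gaussian z"
      using h by (simp only: gaussian_def scaleR_conv_of_real) simp
  qed
  finally show ?thesis by (simp add: mollify_def integrate_snd_def)
qed

section \<open>Density of the Gaussian shifts\<close>

lemma schwartz_gaussian_shift:
  "(\<lambda>p::'a::euclidean_space. of_real (exp (- 2 * pi * (norm (p - c))\<^sup>2)) * cis (2 * pi * (p \<bullet> l))) \<in> schwartz"
proof -
  have "(\<lambda>p. cis (2 * pi * (p \<bullet> l)) * of_real (exp (- pi * 2 * (norm (p - c))\<^sup>2))) \<in> schwartz"
    by (rule schwartz_chirp_mult[OF schwartz_gaussian_affine, where B'="\<lambda>p v. 2 * pi * (v \<bullet> l)"])
       (auto intro!: derivative_eq_intros exI[of _ "0::'a"])
  then show ?thesis by (simp add: mult_ac)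
qed

text \<open>The time-frequency shifts of a fixed Gaussian span a dense subspace: integrating over the
  frequency against a Gaussian weight produces arbitrarily narrow Gaussians, and these form an
  approximate identity.\<close>

lemma tempered_zero_if_gaussian_shifts:
  fixes u :: "('a::euclidean_space \<Rightarrow> complex) \<Rightarrow> complex"
  assumes u: "tempered_distribution u"
    and zero: "\<And>c l. u (\<lambda>p. of_real (exp (- 2 * pi * (norm (p - c))\<^sup>2)) * cis (2 * pi * (p \<bullet> l))) = 0"
    and \<Psi>: "\<Psi> \<in> schwartz"
  shows "u \<Psi> = 0"
proof -
  have scale: "u (\<lambda>x. c * \<phi> x) = c * u \<phi>" if "\<phi> \<in> schwartz" for c \<phi>
    using u that unfolding tempered_distribution_def by blast
  \<comment> \<open>Averaging over the frequency l with weight exp (- pi s |l|^2) multiplies the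
    fixed Gaussian by the Fourier transform of the weight, which is proportional to exp (- pi |p -
    c|^2 / s). The exponents add up to 2 + 1 / s.\<close>
  have narrow: "u (\<lambda>p. of_real (exp (- pi * (2 + 1 / s) * (norm (p - c))\<^sup>2))) = 0" if s: "s > 0" for s c
  proof -
    let ?T = "\<lambda>q. cis (2 * pi * (snd q \<bullet> (fst q - c))) *
      (of_real (exp (- pi * 2 * (norm (fst q - c))\<^sup>2)) * of_real (exp (- pi * s * (norm (snd q - 0))\<^sup>2)))"
    have T: "?T \<in> (schwartz :: ('a \<times> 'a \<Rightarrow> complex) set)"
    proof (rule schwartz_chirp_mult[where B'="\<lambda>q v. 2 * pi * (snd v \<bullet> (fst q - c) + snd q \<bullet> fst v)"])
      show "(\<lambda>q::'a \<times> 'a. complex_of_real (exp (- pi * 2 * (norm (fst q - c))\<^sup>2)) * complex_of_real (exp (- pi * s * (norm (snd q - 0))\<^sup>2))) \<in> schwartz"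
        by (intro schwartz_tensor schwartz_gaussian_affine s) simp
      show "((\<lambda>q. 2 * pi * (snd q \<bullet> (fst q - c))) has_derivative (\<lambda>v. 2 * pi * (snd v \<bullet> (fst q - c) + snd q \<bullet> fst v))) (at q)" for q :: "'a \<times> 'a"
        by (auto intro!: derivative_eq_intros simp: algebra_simps)
      show "\<exists>w r. \<forall>q. 2 * pi * (snd v \<bullet> (fst q - c) + snd q \<bullet> fst v) = q \<bullet> w + r" for v :: "'a \<times> 'a"
        by (intro exI[of _ "(2 * pi) *\<^sub>R (snd v, fst v)"] exI[of _ "- 2 * pi * (snd v \<bullet> c)"])
           (auto simp: inner_prod_def algebra_simps inner_commute)
    qed
    have "u (integrate_snd lborel ?T) = 0"
    proof (rule tempered_integrate_snd_lborel_zero[OF u T])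
      fix l
      have "(\<lambda>p. ?T (p, l)) = (\<lambda>p. (cis (- (2 * pi * (l \<bullet> c))) * of_real (exp (- pi * s * (norm l)\<^sup>2))) *
          (of_real (exp (- 2 * pi * (norm (p - c))\<^sup>2)) * cis (2 * pi * (p \<bullet> l))))"
      proof
        fix p
        have "cis (2 * pi * (l \<bullet> (p - c))) = cis (- (2 * pi * (l \<bullet> c))) * cis (2 * pi * (p \<bullet> l))"
          unfolding cis_mult by (rule arg_cong[where f=cis]) (simp add: inner_diff_right inner_commute algebra_simps)
        then show "?T (p, l) = (cis (- (2 * pi * (l \<bullet> c))) * of_real (exp (- pi * s * (norm l)\<^sup>2))) *
          (of_real (exp (- 2 * pi * (norm (p - c))\<^sup>2)) * cis (2 * pi * (p \<bullet> l)))"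
          by (simp add: mult_ac)
      qed
      then show "u (\<lambda>p. ?T (p, l)) = 0" by (simp only: scale[OF schwartz_gaussian_shift] zero mult_zero_right)
    qed
    moreover have "integrate_snd lborel ?T = (\<lambda>p. of_real (1 / sqrt s ^ DIM('a)) * of_real (exp (- pi * (2 + 1 / s) * (norm (p - c))\<^sup>2)))"
    proof
      fix p
      have "integrate_snd lborel ?T p = of_real (exp (- pi * 2 * (norm (p - c))\<^sup>2)) *
          (\<integral>l. of_real (exp (- pi * s * (norm l)\<^sup>2)) * cis (2 * pi * (l \<bullet> (p - c))) \<partial>lborel)"
        unfolding integrate_snd_def by (subst integral_mult_right_zero[symmetric]) (simp add: mult_ac)
      also have "\<dots> = of_real (exp (- pi * 2 * (norm (p - c))\<^sup>2) * (exp (- pi * (norm (p - c))\<^sup>2 / s) / sqrt s ^ DIM('a)))"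
        using integral_gaussian_cis[OF s, of "p - c"] by simp
      also have "\<dots> = of_real (1 / sqrt s ^ DIM('a)) * of_real (exp (- pi * (2 + 1 / s) * (norm (p - c))\<^sup>2))"
        by (simp add: algebra_simps flip: exp_add)
      finally show "integrate_snd lborel ?T p = of_real (1 / sqrt s ^ DIM('a)) * of_real (exp (- pi * (2 + 1 / s) * (norm (p - c))\<^sup>2))" .
    qed
    ultimately have "of_real (1 / sqrt s ^ DIM('a)) * u (\<lambda>p. of_real (exp (- pi * (2 + 1 / s) * (norm (p - c))\<^sup>2))) = 0"
      using s by (simp only: scale[OF schwartz_gaussian_affine[of "2 + 1 / s" c]] add_pos_pos zero_less_numeral zero_less_divide_1_iff)
    then show ?thesis using s by simp
  qed
  \<comment> \<open>Averaging the narrow Gaussians over their centres y with weight \<Psi> y gives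
    the mollification of \<Psi>.\<close>
  have moll: "u (mollify h \<Psi>) = 0" if h: "h > 0" "1 / h\<^sup>2 > 2" for h
  proof -
    \<comment> \<open>Solves 2 + 1 / s = 1 / h^2 with s > 0, hence the requirement 1 / h^2 > 2: only
      Gaussians narrower than the fixed one can be reached.\<close>
    define s where "s = 1 / (1 / h\<^sup>2 - 2)"
    have s: "s > 0" "2 + 1 / s = 1 / h\<^sup>2" using h by (auto simp: s_def)
    let ?T = "\<lambda>q. of_real (1 / h ^ DIM('a)) * (\<Psi> (snd q) * of_real (exp (- pi * (1 / h\<^sup>2) * (norm (fst q - snd q - 0))\<^sup>2)))"
    have g: "(\<lambda>q. \<Psi> (fst q) * of_real (exp (- pi * (1 / h\<^sup>2) * (norm (snd q - 0))\<^sup>2))) \<in> schwartz"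
      using h by (intro schwartz_tensor \<Psi> schwartz_gaussian_affine) auto
    have "(\<lambda>q. (\<lambda>q. \<Psi> (fst q) * of_real (exp (- pi * (1 / h\<^sup>2) * (norm (snd q - 0))\<^sup>2))) ((\<lambda>q. (snd q, fst q - snd q)) q + 0)) \<in> schwartz"
      by (intro schwartz_affine[OF g]) (auto simp: linear_iff inj_on_def algebra_simps)
    then have T: "?T \<in> schwartz" by (intro schwartz_cmult) simp
    have "u (integrate_snd lborel ?T) = 0"
    proof (rule tempered_integrate_snd_lborel_zero[OF u T])
      fix y
      have "(\<lambda>x. ?T (x, y)) = (\<lambda>x. (of_real (1 / h ^ DIM('a)) * \<Psi> y) * of_real (exp (- pi * (1 / h\<^sup>2) * (norm (x - y))\<^sup>2)))"
        by (simp add: mult_ac)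
      then show "u (\<lambda>x. ?T (x, y)) = 0"
        using narrow[OF s(1), of y] s(2) h scale[OF schwartz_gaussian_affine[of "1 / h\<^sup>2" y], of "of_real (1 / h ^ DIM('a)) * \<Psi> y"]
        by simp
    qed
    moreover have "integrate_snd lborel ?T = mollify h \<Psi>"
      unfolding mollify_eq_convolution[OF \<Psi> h(1), abs_def] integrate_snd_def[abs_def] fun_eq_iff
      by (auto intro!: Bochner_Integration.integral_cong simp: mult_ac)
    ultimately show ?thesis by simp
  qed
  \<comment> \<open>The offset 2 gives 1 / (h i)^2 \<ge> 4, so every width is admissible for
    \<open>moll\<close>.\<close>
  define h where "h i = 1 / (real i + 2)" for i :: nat
  have h: "0 < h i" "h i \<le> 1" "1 / (h i)\<^sup>2 > 2" for i
  proof -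
    have "(2::real)\<^sup>2 \<le> (real i + 2)\<^sup>2" by (intro power_mono) auto
    then show "1 / (h i)\<^sup>2 > 2" by (simp add: h_def power_divide)
  qed (auto simp: h_def)
  have "h \<longlonglongrightarrow> 0"
    using LIMSEQ_ignore_initial_segment[OF lim_1_over_n, of 2] by (simp add: h_def[abs_def] add.commute)
  then show ?thesis
  proof (rule tempered_null_limit[OF u \<Psi>, where \<psi>="\<lambda>i. mollify (h i) \<Psi>", rotated 2])
    fix k and vs :: "'a list" assume vs: "set vs \<subseteq> Basis"
    obtain C where C: "\<And>h x. 0 \<le> h \<Longrightarrow> h \<le> 1 \<Longrightarrow> (1 + norm x) ^ k * norm (mollify h (iter_deriv vs \<Psi>) x - iter_deriv vs \<Psi> x) \<le> C * h"
      by (rule mollify_approx[OF schwartz_iter_deriv[OF \<Psi> vs], where k=k]) blast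
    have "norm x ^ k * norm (iter_deriv vs \<Psi> x - iter_deriv vs (mollify (h i) \<Psi>) x) \<le> C * h i" for i x
    proof -
      have "norm x ^ k * norm (iter_deriv vs \<Psi> x - iter_deriv vs (mollify (h i) \<Psi>) x)
          \<le> (1 + norm x) ^ k * norm (mollify (h i) (iter_deriv vs \<Psi>) x - iter_deriv vs \<Psi> x)"
        unfolding iter_deriv_mollify[OF \<Psi> vs]
        by (subst norm_minus_commute) (intro mult_right_mono power_mono, auto)
      also have "\<dots> \<le> C * h i" using h[of i] by (intro C) auto
      finally show ?thesis .
    qed
    then show "\<exists>C. \<forall>i x. norm x ^ k * norm (iter_deriv vs \<Psi> x - iter_deriv vs (mollify (h i) \<Psi>) x) \<le> C * h i" by blast
  qed (use h moll schwartz_mollify[OF \<Psi>] in auto)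
qed


section \<open>Fourier inversion\<close>

lemma integrable_pair_dominated:
  fixes f :: "'a \<times> 'b \<Rightarrow> 'c::{banach,second_countable_topology}" and a :: "'a \<Rightarrow> real" and b :: "'b \<Rightarrow> real"
  assumes "sigma_finite_measure M1" "sigma_finite_measure M2"
    and f: "f \<in> borel_measurable (M1 \<Otimes>\<^sub>M M2)"
    and a: "integrable M1 a" and b: "integrable M2 b"
    and le: "\<And>x y. norm (f (x, y)) \<le> a x * b y"
  shows "integrable (M1 \<Otimes>\<^sub>M M2) f"
proof -
  interpret M1: sigma_finite_measure M1 by fact
  interpret M2: sigma_finite_measure M2 by fact
  interpret pair_sigma_finite M1 M2 ..
  note [measurable] = borel_measurable_integrable[OF a] borel_measurable_integrable[OF b]
  have "integrable (M1 \<Otimes>\<^sub>M M2) (\<lambda>p. a (fst p) * b (snd p))"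
    by (rule Fubini_integrable) (use a b in \<open>simp_all add: abs_mult\<close>)
  then show ?thesis
    by (rule Bochner_Integration.integrable_bound[OF _ f])
      (use le in \<open>auto intro!: AE_I2 order_trans[OF le]\<close>)
qed

lemma cis_measurable [measurable (raw)]:
  "B \<in> borel_measurable M \<Longrightarrow> (\<lambda>x. cis (B x)) \<in> borel_measurable M"
  unfolding cis_conv_exp by measurable

text \<open>The integral of f (x + s v) over x does not depend on s, so its derivative at s = 0
  vanishes. The factor \<open>gaussian s\<close> makes the integrand Schwartz in (s, x), so that
  \<open>has_derivative_integrate_snd\<close> applies; at 0 it has value 1 and derivative 0 and
  leaves no trace.\<close>

lemma integral_pd_zero:
  assumes f: "f \<in> schwartz"
  shows "(\<integral>x. pd v f x \<partial>lborel) = 0"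
proof -
  let ?T = "\<lambda>q. f (snd q + fst q *\<^sub>R v) * gaussian (fst q :: real)"
  have "(\<lambda>q. (\<lambda>q. f (fst q) * gaussian (snd q)) ((\<lambda>q. (snd q + fst q *\<^sub>R v, fst q)) q + 0)) \<in> schwartz"
    by (intro schwartz_affine[OF schwartz_tensor[OF f gaussian_schwartz]])
       (auto simp: linear_iff inj_on_def algebra_simps)
  then have T: "?T \<in> schwartz" by simp
  note m[measurable] = schwartz_measurable[OF f]
  have g0: "(gaussian has_derivative (\<lambda>r. 0)) (at (0::real))"
    unfolding gaussian_def[abs_def] real_norm_def power2_abs
    by (auto intro!: derivative_eq_intros)
  have d: "((\<lambda>s. f (x + s *\<^sub>R v) * gaussian s) has_derivative (\<lambda>r. r *\<^sub>R pd v f x)) (at 0)" for x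
  proof -
    have lin: "linear (frechet_derivative f (at x))"
      using schwartz_has_derivative[OF f] has_derivative_linear by blast
    have 1: "((\<lambda>s. x + s *\<^sub>R v) has_derivative (\<lambda>r. r *\<^sub>R v)) (at 0)"
      by (auto intro!: derivative_eq_intros)
    have "((\<lambda>s. f (x + s *\<^sub>R v)) has_derivative (\<lambda>r. frechet_derivative f (at x) (r *\<^sub>R v))) (at 0)"
      by (rule has_derivative_compose[OF 1]) (simp add: schwartz_has_derivative[OF f])
    from has_derivative_mult[OF this g0] show ?thesis
      by (simp add: linear_cmul[OF lin] gaussian_def)
  qed
  have "integrate_snd lborel ?T s = gaussian s * (\<integral>x. f x \<partial>lborel)" for s
    unfolding integrate_snd_def using integral_lborel_affine[of f 1 "s *\<^sub>R v"] by (simp add: add.commute mult.commute)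
  then have eq: "integrate_snd lborel ?T = (\<lambda>s. gaussian s * (\<integral>x. f x \<partial>lborel))" by (rule ext)
  have "(integrate_snd lborel ?T has_derivative (\<lambda>r. 0)) (at 0)"
    unfolding eq using has_derivative_mult_left[OF g0, of "\<integral>x. f x \<partial>lborel"] by simp
  then have "(\<lambda>r. 0) = (\<lambda>r. integrate_snd lborel (pd (r, 0) ?T) 0)"
    by (rule has_derivative_unique[OF _ has_derivative_integrate_snd[OF integrable_lborel_wt T]])
  then have "0 = integrate_snd lborel (pd (1, 0) ?T) 0" by (rule fun_cong)
  also have "pd (1, 0) ?T (0, x) = pd v f x" for x
    using fun_cong[OF has_derivative_unique[OF d has_derivative_slice_fst[OF T, of x 0, simplified]], of 1] by simp
  then have "integrate_snd lborel (pd (1, 0) ?T) 0 = (\<integral>x. pd v f x \<partial>lborel)"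
    by (simp add: integrate_snd_def)
  finally show ?thesis by simp
qed

lemma schwartz_cis_mult:
  assumes "f \<in> schwartz"
  shows "(\<lambda>x. cis (r * (x \<bullet> l)) * f x) \<in> schwartz"
  by (rule schwartz_chirp_mult[OF assms, where B'="\<lambda>p v. r * (v \<bullet> l)"])
     (auto intro!: derivative_eq_intros exI[of _ "0::'a"])

text \<open>Integration by parts: the derivative of f times the exponential has integral 0, and the
  product rule splits it into the two sides.\<close>

lemma fourier_pd:
  assumes f: "f \<in> schwartz"
  shows "fourier (pd b f) \<xi> = 2 * pi * \<i> * of_real (b \<bullet> \<xi>) * fourier f \<xi>"
proof -
  let ?h = "\<lambda>x. cis (- 2 * pi * (x \<bullet> \<xi>)) * f x"
  have h: "?h \<in> schwartz" by (rule schwartz_cis_mult[OF f])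
  have h': "(\<lambda>x. cis (- 2 * pi * (x \<bullet> \<xi>)) * pd b f x) \<in> schwartz"
    by (rule schwartz_cis_mult[OF schwartz_pd_any[OF f]])
  have c: "((\<lambda>x. cis (- 2 * pi * (x \<bullet> \<xi>))) has_derivative
      (\<lambda>v. cis (- 2 * pi * (x \<bullet> \<xi>)) * (\<i> * of_real (- 2 * pi * (v \<bullet> \<xi>))))) (at x)" for x
  proof -
    have "((\<lambda>x. complex_of_real (cos (- 2 * pi * (x \<bullet> \<xi>))) + \<i> * complex_of_real (sin (- 2 * pi * (x \<bullet> \<xi>)))) has_derivative
        (\<lambda>v. cis (- 2 * pi * (x \<bullet> \<xi>)) * (\<i> * of_real (- 2 * pi * (v \<bullet> \<xi>))))) (at x)"
      by (rule derivative_eq_intros refl)+ (auto simp: complex_eq_iff)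
    then show ?thesis by (simp only: cis_conv_exp exp_Euler cos_of_real sin_of_real)
  qed
  have "pd b ?h = (\<lambda>x. cis (- 2 * pi * (x \<bullet> \<xi>)) * pd b f x + (- 2 * pi * \<i> * of_real (b \<bullet> \<xi>)) * ?h x)"
    by (subst pd_eqI[OF has_derivative_mult[OF c schwartz_has_derivative[OF f]]]) (simp add: mult_ac)
  then have "0 = (\<integral>x. cis (- 2 * pi * (x \<bullet> \<xi>)) * pd b f x + (- 2 * pi * \<i> * of_real (b \<bullet> \<xi>)) * ?h x \<partial>lborel)"
    using integral_pd_zero[OF h, of b] by simp
  also have "\<dots> = (\<integral>x. cis (- 2 * pi * (x \<bullet> \<xi>)) * pd b f x \<partial>lborel) + (- 2 * pi * \<i> * of_real (b \<bullet> \<xi>)) * (\<integral>x. ?h x \<partial>lborel)"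
    by (subst Bochner_Integration.integral_add[OF schwartz_integrable[OF h'] integrable_mult_right[OF schwartz_integrable[OF h]]])
       (simp only: integral_mult_right_zero)
  also have "\<dots> = fourier (pd b f) \<xi> - 2 * pi * \<i> * of_real (b \<bullet> \<xi>) * fourier f \<xi>"
    by (simp add: fourier_def mult.commute)
  finally show ?thesis by simp
qed

lemma fourier_add:
  assumes "f \<in> schwartz" "g \<in> schwartz"
  shows "fourier (\<lambda>x. f x + c * g x) \<xi> = fourier f \<xi> + c * fourier g \<xi>"
proof -
  have "integrable lborel (\<lambda>x. f x * cis (- 2 * pi * (x \<bullet> \<xi>)))" "integrable lborel (\<lambda>x. g x * cis (- 2 * pi * (x \<bullet> \<xi>)))"
    by (rule integrable_mult_cis[OF schwartz_integrable[OF assms(1)]], simp)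
       (rule integrable_mult_cis[OF schwartz_integrable[OF assms(2)]], simp)
  then show ?thesis by (simp add: fourier_def distrib_right mult.assoc)
qed

text \<open>Decay is gained coordinate by coordinate: the factor 1 + (\<xi> \<bullet> b)^2 on the
  transform comes from the operator 1 - \<partial>_b^2 / (4 pi^2) on f. Thus the transform divided
  by \<open>wt\<close> is again the transform of a Schwartz function, and such a transform is
  bounded by an L1 norm.\<close>

lemma fourier_bound:
  fixes f :: "'a::euclidean_space \<Rightarrow> complex"
  assumes f: "f \<in> schwartz"
  obtains C where "\<And>\<xi>. norm (fourier f \<xi>) \<le> C * wt \<xi>"
proof -
  have "\<exists>g\<in>schwartz. \<forall>\<xi>. fourier g \<xi> = of_real (\<Prod>b\<in>A. 1 + (\<xi> \<bullet> b)\<^sup>2) * fourier f \<xi>" if "finite A" for A :: "'a set"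
    using that
  proof (induction A rule: finite_induct)
    case empty
    then show ?case using f by (intro bexI[of _ f]) auto
  next
    case (insert b A)
    then obtain g where g: "g \<in> schwartz" "\<And>\<xi>. fourier g \<xi> = of_real (\<Prod>b\<in>A. 1 + (\<xi> \<bullet> b)\<^sup>2) * fourier f \<xi>" by blast
    \<comment> \<open>Two derivatives along b multiply the transform by (2 pi i)^2 (\<xi> \<bullet>
      b)^2, and c normalises this to (\<xi> \<bullet> b)^2.\<close>
    define c :: complex where "c = - 1 / (4 * pi\<^sup>2)"
    have "(\<lambda>x. g x + c * pd b (pd b g) x) \<in> schwartz"
      by (intro schwartz_add schwartz_cmult schwartz_pd_any g)
    moreover have "fourier (\<lambda>x. g x + c * pd b (pd b g) x) \<xi> = of_real (\<Prod>b\<in>insert b A. 1 + (\<xi> \<bullet> b)\<^sup>2) * fourier f \<xi>" for \<xi>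
    proof -
      have "fourier (\<lambda>x. g x + c * pd b (pd b g) x) \<xi> = fourier g \<xi> + c * fourier (pd b (pd b g)) \<xi>"
        by (rule fourier_add[OF g(1) schwartz_pd_any[OF schwartz_pd_any[OF g(1)]]])
      also have "\<dots> = of_real (1 + (\<xi> \<bullet> b)\<^sup>2) * fourier g \<xi>"
        by (simp add: fourier_pd[OF schwartz_pd_any[OF g(1)]] fourier_pd[OF g(1)] c_def field_simps inner_commute power2_eq_square)
      finally show ?thesis using insert(1,2) by (simp add: g(2) mult_ac)
    qed
    ultimately show ?case by blast
  qed
  from this[of Basis] obtain g where g: "g \<in> schwartz" "\<And>\<xi>. fourier g \<xi> = of_real (inverse (wt \<xi>)) * fourier f \<xi>"
    by (auto simp: inverse_wt)
  have "norm (fourier f \<xi>) \<le> (\<integral>x. norm (g x) \<partial>lborel) * wt \<xi>" for \<xi>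
  proof -
    have "fourier f \<xi> = of_real (wt \<xi>) * fourier g \<xi>" using wt_pos[of \<xi>] by (simp add: g(2))
    moreover have "norm (fourier g \<xi>) \<le> (\<integral>x. norm (g x) \<partial>lborel)"
      unfolding fourier_def by (rule order_trans[OF integral_norm_bound]) (simp add: norm_mult)
    ultimately show ?thesis using wt_nonneg[of \<xi>] by (simp add: norm_mult mult.commute mult_left_mono)
  qed
  then show ?thesis by (rule that)
qed

lemma fourier_measurable [measurable]:
  fixes f :: "'a::euclidean_space \<Rightarrow> complex"
  assumes [measurable]: "f \<in> borel_measurable borel"
  shows "fourier f \<in> borel_measurable borel"
  unfolding fourier_def[abs_def] by measurable

lemma fourier_integrable:
  assumes f: "f \<in> schwartz"
  shows "integrable lborel (fourier f)"
proof -
  note [measurable] = schwartz_measurable[OF f]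
  obtain C where C: "\<And>\<xi>. norm (fourier f \<xi>) \<le> C * wt \<xi>" using fourier_bound[OF f] by blast
  show ?thesis
    by (rule Bochner_Integration.integrable_bound[OF integrable_mult_right[OF integrable_wt, of C]])
       (auto intro!: AE_I2 order_trans[OF C])
qed

text \<open>The Gaussian factor makes the double integral absolutely convergent. After Fubini's
  theorem the integral over \<xi> is the transform of that factor, which is the mollifying kernel of
  width h.\<close>

lemma gaussian_summation:
  fixes f :: "'a::euclidean_space \<Rightarrow> complex"
  assumes f: "f \<in> schwartz" and h: "h > 0"
  shows "(\<integral>\<xi>. fourier f \<xi> * cis (2 * pi * (x \<bullet> \<xi>)) * of_real (exp (- pi * h\<^sup>2 * (norm \<xi>)\<^sup>2)) \<partial>lborel) = mollify h f x"
proof -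
  note [measurable] = schwartz_measurable[OF f]
  let ?G = "\<lambda>\<xi>::'a. complex_of_real (exp (- pi * h\<^sup>2 * (norm \<xi>)\<^sup>2))"
  let ?F = "\<lambda>\<xi> y. f y * cis (2 * pi * ((x - y) \<bullet> \<xi>)) * ?G \<xi>"
  have G: "integrable lborel ?G" using schwartz_integrable[OF schwartz_gaussian_affine[of "h\<^sup>2" "0::'a"]] h by simp
  have "integrable (lborel \<Otimes>\<^sub>M lborel) (case_prod ?F)"
    by (rule integrable_pair_dominated[where a="\<lambda>\<xi>. norm (?G \<xi>)" and b="\<lambda>y. norm (f y)"])
       (use integrable_norm[OF G] schwartz_integrable[OF f] in \<open>auto simp: norm_mult lborel.sigma_finite_measure_axioms\<close>)
  from lborel_pair.Fubini_integral[OF this]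
  have fub: "(\<integral>\<xi>. (\<integral>y. ?F \<xi> y \<partial>lborel) \<partial>lborel) = (\<integral>y. (\<integral>\<xi>. ?F \<xi> y \<partial>lborel) \<partial>lborel)" by simp
  have inner: "(\<integral>\<xi>. ?F \<xi> y \<partial>lborel) = f y * of_real (exp (- pi * (1 / h\<^sup>2) * (norm (x - y))\<^sup>2) / h ^ DIM('a))" for y
  proof -
    have "(\<integral>\<xi>. ?F \<xi> y \<partial>lborel) = f y * (\<integral>\<xi>. ?G \<xi> * cis (2 * pi * (\<xi> \<bullet> (x - y))) \<partial>lborel)"
      by (subst integral_mult_right_zero[symmetric]) (simp add: mult_ac inner_commute)
    then show ?thesis using h by (subst (asm) integral_gaussian_cis) simp_all
  qed
  have "(\<integral>\<xi>. (\<integral>y. ?F \<xi> y \<partial>lborel) \<partial>lborel) = mollify h f x"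
    unfolding fub by (simp only: inner mollify_eq_convolution[OF f h])
  moreover have "(\<integral>y. ?F \<xi> y \<partial>lborel) = fourier f \<xi> * cis (2 * pi * (x \<bullet> \<xi>)) * ?G \<xi>" for \<xi>
  proof -
    have "?F \<xi> y = (f y * cis (- 2 * pi * (y \<bullet> \<xi>))) * (cis (2 * pi * (x \<bullet> \<xi>)) * ?G \<xi>)" for y
    proof -
      have "cis (2 * pi * ((x - y) \<bullet> \<xi>)) = cis (- 2 * pi * (y \<bullet> \<xi>)) * cis (2 * pi * (x \<bullet> \<xi>))"
        unfolding cis_mult by (rule arg_cong[where f=cis]) (simp add: inner_diff_left algebra_simps)
      then show ?thesis by (simp only: mult_ac)
    qed
    then have "(\<integral>y. ?F \<xi> y \<partial>lborel) = (\<integral>y. (f y * cis (- 2 * pi * (y \<bullet> \<xi>))) * (cis (2 * pi * (x \<bullet> \<xi>)) * ?G \<xi>) \<partial>lborel)"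
      by (intro Bochner_Integration.integral_cong refl)
    also have "\<dots> = fourier f \<xi> * (cis (2 * pi * (x \<bullet> \<xi>)) * ?G \<xi>)"
      unfolding fourier_def by (rule integral_mult_left_zero)
    finally show ?thesis by (simp only: mult.assoc)
  qed
  ultimately show ?thesis by (simp only:)
qed

text \<open>As h tends to 0, the regularised integral tends to the full one by dominated
  convergence, since the transform is integrable, and to f x because it is a mollification of
  f.\<close>

lemma fourier_inversion:
  fixes f :: "'a::euclidean_space \<Rightarrow> complex"
  assumes f: "f \<in> schwartz"
  shows "inverse_fourier (fourier f) x = f x"
proof -
  note [measurable] = schwartz_measurable[OF f]
  define h where "h i = 1 / (real i + 1)" for i :: nat
  have h: "0 < h i" "h i \<le> 1" for i by (auto simp: h_def)
  have h0: "h \<longlonglongrightarrow> 0"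
    using LIMSEQ_ignore_initial_segment[OF lim_1_over_n, of 1] by (simp add: h_def[abs_def] add.commute)
  let ?J = "\<lambda>i \<xi>. fourier f \<xi> * cis (2 * pi * (x \<bullet> \<xi>)) * of_real (exp (- pi * (h i)\<^sup>2 * (norm \<xi>)\<^sup>2))"
  have "(\<lambda>i. \<integral>\<xi>. ?J i \<xi> \<partial>lborel) \<longlonglongrightarrow> (\<integral>\<xi>. fourier f \<xi> * cis (2 * pi * (x \<bullet> \<xi>)) \<partial>lborel)"
  proof (rule integral_dominated_convergence[where w="\<lambda>\<xi>. norm (fourier f \<xi>)"])
    show "AE \<xi> in lborel. (\<lambda>i. ?J i \<xi>) \<longlonglongrightarrow> fourier f \<xi> * cis (2 * pi * (x \<bullet> \<xi>))"
    proof (rule AE_I2)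
      fix \<xi>
      have "(\<lambda>i. ?J i \<xi>) \<longlonglongrightarrow> fourier f \<xi> * cis (2 * pi * (x \<bullet> \<xi>)) * of_real (exp (- pi * 0\<^sup>2 * (norm \<xi>)\<^sup>2))"
        by (intro tendsto_intros h0)
      then show "(\<lambda>i. ?J i \<xi>) \<longlonglongrightarrow> fourier f \<xi> * cis (2 * pi * (x \<bullet> \<xi>))" by simp
    qed
    show "AE \<xi> in lborel. norm (?J i \<xi>) \<le> norm (fourier f \<xi>)" for i
      by (rule AE_I2) (auto simp: norm_mult intro!: mult_left_le)
  qed (use fourier_integrable[OF f] in auto)
  moreover have "(\<lambda>i. \<integral>\<xi>. ?J i \<xi> \<partial>lborel) = (\<lambda>i. mollify (h i) f x)"
    using gaussian_summation[OF f h(1)] by blast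
  ultimately have lim: "(\<lambda>i. mollify (h i) f x) \<longlonglongrightarrow> (\<integral>\<xi>. fourier f \<xi> * cis (2 * pi * (x \<bullet> \<xi>)) \<partial>lborel)"
    by (simp only:)
  have "(\<lambda>i. mollify (h i) f x) \<longlonglongrightarrow> f x"
  proof -
    obtain C where C: "\<And>h x. 0 \<le> h \<Longrightarrow> h \<le> 1 \<Longrightarrow> (1 + norm x) ^ 0 * norm (mollify h f x - f x) \<le> C * h"
      by (rule mollify_approx[OF f, where k=0]) blast
    have "(\<lambda>i. C * h i) \<longlonglongrightarrow> C * 0" by (intro tendsto_intros h0)
    then have "(\<lambda>i. C * h i) \<longlonglongrightarrow> 0" by simp
    then have "(\<lambda>i. mollify (h i) f x - f x) \<longlonglongrightarrow> 0"
      by (rule Lim_null_comparison[rotated]) (intro always_eventually allI C[simplified] less_imp_le[OF h(1)] h(2))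
    then show ?thesis using Lim_null by blast
  qed
  from LIMSEQ_unique[OF lim this]
  have "(\<integral>\<xi>. fourier f \<xi> * cis (2 * pi * (x \<bullet> \<xi>)) \<partial>lborel) = f x" .
  then show ?thesis by (simp add: inverse_fourier_def)
qed

text \<open>Fubini's theorem moves the integral over \<mu> outside; the inner frequency integral is
  then Fourier inversion at x - y.\<close>

lemma fourier_multiplier_eq_convolution:
  fixes f :: "'a::euclidean_space \<Rightarrow> complex"
  assumes f: "f \<in> schwartz" and "finite_measure \<mu>" and \<mu>: "sets \<mu> = sets borel"
    and m: "\<And>\<xi>. m \<xi> = (\<integral>y. cis (- 2 * pi * (y \<bullet> \<xi>)) \<partial>\<mu>)"
  shows "fourier_multiplier m f = convolution_measure f \<mu>"
proof
  fix x
  interpret finite_measure \<mu> by fact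
  have sf: "sigma_finite_measure \<mu>" ..
  interpret pair_sigma_finite lborel \<mu> ..
  note [measurable_cong] = \<mu>
  note [measurable] = schwartz_measurable[OF f]
  let ?F = "\<lambda>\<xi> y. fourier f \<xi> * cis (2 * pi * ((x - y) \<bullet> \<xi>))"
  have "integrable (lborel \<Otimes>\<^sub>M \<mu>) (case_prod ?F)"
    by (rule integrable_pair_dominated[where a="\<lambda>\<xi>. norm (fourier f \<xi>)" and b="\<lambda>y. 1"])
       (use fourier_integrable[OF f] in \<open>auto simp: norm_mult lborel.sigma_finite_measure_axioms sf\<close>)
  from Fubini_integral[OF this]
  have "(\<integral>\<xi>. (\<integral>y. ?F \<xi> y \<partial>\<mu>) \<partial>lborel) = (\<integral>y. (\<integral>\<xi>. ?F \<xi> y \<partial>lborel) \<partial>\<mu>)" by simp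
  moreover have "(\<integral>y. ?F \<xi> y \<partial>\<mu>) = m \<xi> * fourier f \<xi> * cis (2 * pi * (x \<bullet> \<xi>))" for \<xi>
  proof -
    have "?F \<xi> y = cis (- 2 * pi * (y \<bullet> \<xi>)) * (fourier f \<xi> * cis (2 * pi * (x \<bullet> \<xi>)))" for y
    proof -
      have "cis (2 * pi * ((x - y) \<bullet> \<xi>)) = cis (- 2 * pi * (y \<bullet> \<xi>)) * cis (2 * pi * (x \<bullet> \<xi>))"
        unfolding cis_mult by (rule arg_cong[where f=cis]) (simp add: inner_diff_left algebra_simps)
      then show ?thesis by (simp only: mult_ac)
    qed
    then show ?thesis by (simp only: integral_mult_left_zero m mult.assoc)
  qed
  moreover have "(\<integral>\<xi>. ?F \<xi> y \<partial>lborel) = f (x - y)" for y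
    using fourier_inversion[OF f, of "x - y"] by (simp add: inverse_fourier_def)
  ultimately show "fourier_multiplier m f x = convolution_measure f \<mu> x"
    by (simp only: fourier_multiplier_def inverse_fourier_def convolution_measure_def)
qed


section \<open>The projections of the wave measures\<close>

lemma nn_integral_lborel_translate:
  fixes F :: "'a::euclidean_space \<Rightarrow> ennreal"
  assumes [measurable]: "F \<in> borel_measurable borel"
  shows "(\<integral>\<^sup>+x. F (x + a) \<partial>lborel) = (\<integral>\<^sup>+x. F x \<partial>lborel)"
proof -
  have "(\<integral>\<^sup>+x. F x \<partial>lborel) = (\<integral>\<^sup>+x. F x \<partial>distr lborel borel ((+) a))" by (simp add: lborel_distr_plus)
  also have "\<dots> = (\<integral>\<^sup>+x. F (x + a) \<partial>lborel)" by (subst nn_integral_distr) (simp_all add: add.commute)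
  finally show ?thesis by simp
qed

text \<open>Lebesgue measure is, up to a factor, the only translation-invariant \<open>\<sigma>\<close>-finite measure;
  the factor is read off the unit balls.\<close>

lemma distr_lborel_isometry:
  fixes U :: "'b::euclidean_space \<Rightarrow> 'a::euclidean_space"
  assumes U: "linear U" "\<And>x. norm (U x) = norm x" and dim: "DIM('b) = DIM('a)"
  shows "distr lborel borel U = lborel"
proof -
  define \<Lambda> where "\<Lambda> = distr lborel borel U"
  have sets [measurable_cong]: "sets \<Lambda> = sets borel" by (simp add: \<Lambda>_def)
  have Um [measurable]: "U \<in> borel_measurable borel"
    by (intro borel_measurable_continuous_onI linear_continuous_on linear_conv_bounded_linear[THEN iffD1] U)
  \<comment> \<open>An isometry is injective and equal dimensions make it onto, so every translation
    of the target comes from a translation of the source.\<close>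
  have surj: "surj U"
  proof -
    have inj: "inj U" using U by (metis linear_injective_0 norm_eq_zero)
    have "dim (range U) = DIM('a)" using dim_image_eq[OF U(1), of UNIV] inj dim by simp
    moreover have "subspace (range U)" using U(1) by (simp add: linear_subspace_image subspace_UNIV)
    ultimately show ?thesis by (metis dim_eq_full span_eq_iff)
  qed
  have trans: "(\<integral>\<^sup>+x. F (x + a) \<partial>\<Lambda>) = (\<integral>\<^sup>+x. F x \<partial>\<Lambda>)" if [measurable]: "F \<in> borel_measurable borel" for F a
  proof -
    obtain b where b: "a = U b" using surj by (metis surjD)
    have "(\<integral>\<^sup>+x. F (x + a) \<partial>\<Lambda>) = (\<integral>\<^sup>+z. F (U (z + b)) \<partial>lborel)"
      unfolding \<Lambda>_def by (subst nn_integral_distr) (simp_all add: b linear_add[OF U(1)])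
    also have "\<dots> = (\<integral>\<^sup>+z. F (U z) \<partial>lborel)" by (rule nn_integral_lborel_translate) measurable
    also have "\<dots> = (\<integral>\<^sup>+x. F x \<partial>\<Lambda>)" unfolding \<Lambda>_def by (subst nn_integral_distr) simp_all
    finally show ?thesis .
  qed
  have ball: "emeasure \<Lambda> (ball 0 r) = emeasure lborel (ball 0 r :: 'a set)" if "r \<ge> 0" for r
  proof -
    have "U -` ball 0 r = ball 0 r" using U(2) by auto
    then have "emeasure \<Lambda> (ball 0 r) = emeasure lborel (ball 0 r :: 'b set)"
      unfolding \<Lambda>_def by (subst emeasure_distr) auto
    then show ?thesis using that by (simp add: emeasure_ball dim)
  qed
  have "sigma_finite_measure \<Lambda>"
  proof
    have "(\<Union>n::nat. ball 0 (real n)) = (UNIV :: 'a set)"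
      using reals_Archimedean2 by (auto simp: set_eq_iff)
    then show "\<exists>A. countable A \<and> A \<subseteq> sets \<Lambda> \<and> \<Union> A = space \<Lambda> \<and> (\<forall>a\<in>A. emeasure \<Lambda> a \<noteq> \<infinity>)"
      by (intro exI[of _ "range (\<lambda>n::nat. ball 0 (real n))"])
         (auto simp: sets ball \<Lambda>_def[THEN sets_eq_imp_space_eq[OF arg_cong[where f=sets]]] emeasure_ball)
  qed
  then interpret \<Lambda>: sigma_finite_measure \<Lambda> .
  interpret P: pair_sigma_finite \<Lambda> lborel ..
  let ?B = "ball 0 1 :: 'a set"
  have "emeasure \<Lambda> A = emeasure lborel A" if [measurable]: "A \<in> sets borel" for A
  proof -
    let ?f = "indicator A :: 'a \<Rightarrow> ennreal" and ?g = "indicator ?B :: 'a \<Rightarrow> ennreal"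
    have [measurable]: "?g \<in> borel_measurable borel" by (intro borel_measurable_indicator) simp
    \<comment> \<open>One double integral of the indicators of A and the unit ball is read in two
      ways. Shifting x under \<Lambda> by y and then y under Lebesgue measure by - x moves the shift
      from A to the ball; a last shift under \<Lambda> frees the ball of y. Since both measures give
      the ball the same finite positive value, it cancels.\<close>
    have "emeasure \<Lambda> A * emeasure lborel ?B = (\<integral>\<^sup>+y. (\<integral>\<^sup>+x. ?f x \<partial>\<Lambda>) * ?g y \<partial>lborel)"
      by (subst nn_integral_cmult) (simp_all add: sets)
    also have "\<dots> = (\<integral>\<^sup>+y. (\<integral>\<^sup>+x. ?f (x + y) * ?g y \<partial>\<Lambda>) \<partial>lborel)"
      using trans[of ?f] by (simp add: nn_integral_multc)
    also have "\<dots> = (\<integral>\<^sup>+x. (\<integral>\<^sup>+y. ?f (x + y) * ?g y \<partial>lborel) \<partial>\<Lambda>)"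
      by (rule P.Fubini') measurable
    also have "\<dots> = (\<integral>\<^sup>+x. (\<integral>\<^sup>+y. ?f y * ?g (y - x) \<partial>lborel) \<partial>\<Lambda>)"
    proof (rule nn_integral_cong)
      fix x
      have "(\<integral>\<^sup>+y. ?f y * ?g (y - x) \<partial>lborel) = (\<integral>\<^sup>+y. ?f (y + x) * ?g (y + x - x) \<partial>lborel)"
        by (rule nn_integral_lborel_translate[symmetric]) measurable
      then show "(\<integral>\<^sup>+y. ?f (x + y) * ?g y \<partial>lborel) = (\<integral>\<^sup>+y. ?f y * ?g (y - x) \<partial>lborel)"
        by (simp add: add.commute)
    qed
    also have "\<dots> = (\<integral>\<^sup>+y. (\<integral>\<^sup>+x. ?f y * ?g (y - x) \<partial>\<Lambda>) \<partial>lborel)"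
      by (rule P.Fubini'[symmetric]) measurable
    also have "\<dots> = (\<integral>\<^sup>+y. ?f y * (\<integral>\<^sup>+x. ?g (x + (- y)) \<partial>\<Lambda>) \<partial>lborel)"
    proof (rule nn_integral_cong)
      fix y
      have "?g (y - x) = ?g (x + (- y))" for x by (simp add: indicator_def dist_norm norm_minus_commute)
      then show "(\<integral>\<^sup>+x. ?f y * ?g (y - x) \<partial>\<Lambda>) = ?f y * (\<integral>\<^sup>+x. ?g (x + (- y)) \<partial>\<Lambda>)"
        by (simp only:) (rule nn_integral_cmult, measurable)
    qed
    also have "\<dots> = (\<integral>\<^sup>+y. ?f y * emeasure \<Lambda> ?B \<partial>lborel)"
      by (subst trans) (simp_all add: sets)
    also have "\<dots> = emeasure lborel A * emeasure lborel ?B"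
      by (simp add: nn_integral_multc ball)
    finally have "emeasure lborel ?B * emeasure \<Lambda> A = emeasure lborel ?B * emeasure lborel A"
      by (simp add: mult.commute)
    moreover have "emeasure lborel ?B \<noteq> 0" "emeasure lborel ?B \<noteq> top"
      by (simp_all add: emeasure_ball unit_ball_vol_pos less_imp_neq[symmetric])
    ultimately show ?thesis by (simp add: ennreal_mult_cancel_left)
  qed
  then show ?thesis unfolding \<Lambda>_def[symmetric] by (intro measure_eqI) (auto simp: sets)
qed

text \<open>Allows real ^ 'd to be replaced by a concrete product of lines in which the direction e
  is the first coordinate. Any isometry between the spaces will do once an orthogonal map carries
  the image of e0 to e.\<close>

lemma isometry_to_unit_vector:
  fixes e :: "real ^ 'd" and e0 :: "'b::euclidean_space"
  assumes dim: "DIM('b) = CARD('d)" and e: "norm e = 1" "norm e0 = 1"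
  obtains U :: "'b \<Rightarrow> real ^ 'd" where "linear U" "\<And>x. norm (U x) = norm x" "\<And>x. U x \<bullet> e = x \<bullet> e0"
proof -
  have "dim (UNIV :: 'b set) = dim (UNIV :: (real ^ 'd) set)" using dim by simp
  then obtain f :: "'b \<Rightarrow> real ^ 'd" where f: "linear f" "\<And>x. norm (f x) = norm x"
    by (rule isometries_subspaces[OF subspace_UNIV subspace_UNIV]) blast
  obtain R where R: "orthogonal_transformation R" "R (f e0) = e"
    using orthogonal_transformation_exists[of "f e0" e] f e by auto
  have lin: "linear (\<lambda>x. R (f x))"
    using linear_compose[OF f(1) orthogonal_transformation_linear[OF R(1)]] by (simp add: o_def)
  have nrm: "norm (R (f x)) = norm x" for x
    using R(1) f(2) by (simp add: orthogonal_transformation)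
  have "R (f x) \<bullet> e = x \<bullet> e0" for x
  proof -
    \<comment> \<open>Polarization: a norm-preserving linear map preserves inner products.\<close>
    have "R (f x) \<bullet> R (f e0) = ((norm (R (f x) + R (f e0)))\<^sup>2 - (norm (R (f x)))\<^sup>2 - (norm (R (f e0)))\<^sup>2) / 2"
      by (rule dot_norm)
    also have "R (f x) + R (f e0) = R (f (x + e0))" using linear_add[OF lin] by simp
    finally show ?thesis unfolding nrm R(2) dot_norm[of x e0] e .
  qed
  with lin nrm show ?thesis by (rule that)
qed

text \<open>The disc |v|^2 \<le> x has area pi x, so the squared norm pushes planar Lebesgue measure
  forward to pi times Lebesgue measure on the half-line. This takes the place of polar
  coordinates.\<close>

lemma nn_integral_radial_plane:
  fixes H :: "real \<Rightarrow> ennreal"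
  assumes [measurable]: "H \<in> borel_measurable borel"
  shows "(\<integral>\<^sup>+v. H ((norm (v :: real \<times> real))\<^sup>2) \<partial>lborel) = ennreal pi * (\<integral>\<^sup>+w. H w * indicator {0..} w \<partial>lborel)"
proof -
  let ?M = "distr lborel borel (\<lambda>v :: real \<times> real. (norm v)\<^sup>2)"
  let ?N = "density lborel (\<lambda>w. ennreal pi * indicator {0..} w)"
  have M: "emeasure ?M {..x} = ennreal (if x \<ge> 0 then pi * x else 0)" for x
  proof -
    have *: "(norm v)\<^sup>2 \<le> x \<longleftrightarrow> norm v \<le> sqrt x" for v :: "real \<times> real"
      using real_sqrt_le_iff[of "(norm v)\<^sup>2" x] by simp
    have "\<not> norm v \<le> sqrt x" if "\<not> 0 \<le> x" for v :: "real \<times> real"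
      using that real_sqrt_lt_0_iff[of x] norm_ge_zero[of v] by linarith
    then have "(\<lambda>v :: real \<times> real. (norm v)\<^sup>2) -` {..x} = (if x \<ge> 0 then cball 0 (sqrt x) else {})"
      by (auto simp: *)
    then show ?thesis
      by (subst emeasure_distr) (auto simp: emeasure_cball unit_ball_vol_2)
  qed
  have N: "emeasure ?N {..x} = ennreal (if x \<ge> 0 then pi * x else 0)" for x
  proof -
    have "emeasure ?N {..x} = (\<integral>\<^sup>+w. ennreal pi * indicator {0..x} w \<partial>lborel)"
      by (subst emeasure_density) (auto intro!: nn_integral_cong split: split_indicator)
    also have "\<dots> = ennreal (if x \<ge> 0 then pi * x else 0)"
      by (subst nn_integral_cmult) (auto simp: ennreal_mult[symmetric])
    finally show ?thesis .
  qed
  have "?M = ?N"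
  \<comment> \<open>Closed half-lines generate the Borel sets and are stable under intersection, and
    both measures are finite on them.\<close>
  proof (rule measure_eqI_generator_eq[where E="range (\<lambda>a::real. {..a})" and A="\<lambda>n. {..real n}"])
    show "Int_stable (range (\<lambda>a::real. {..a}))"
      by (auto simp: Int_stable_def)
    show "(\<Union>i. {..real i}) = (UNIV :: real set)" using real_arch_simple by auto
    show "emeasure ?M {..real n} \<noteq> \<infinity>" for n unfolding M by simp
    show "emeasure ?M X = emeasure ?N X" if "X \<in> range (\<lambda>a::real. {..a})" for X
      using that by (elim rangeE) (simp only: M N)
    have "sets borel = sigma_sets UNIV (range (\<lambda>a::real. {..a}))" by (simp add: borel_eq_atMost)
    then show "sets ?M = sigma_sets UNIV (range (\<lambda>a::real. {..a}))" "sets ?N = sigma_sets UNIV (range (\<lambda>a::real. {..a}))"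
      by (simp_all only: sets_distr sets_density sets_lborel)
  qed auto
  then have "(\<integral>\<^sup>+w. H w \<partial>?M) = (\<integral>\<^sup>+w. H w \<partial>?N)" by simp
  then show ?thesis
    by (simp add: nn_integral_distr nn_integral_density nn_integral_cmult[symmetric] mult_ac)
qed

text \<open>Under y = a sin \<theta> the integrand times the Jacobian is 1. At the endpoints cos
  \<theta> vanishes, which leaves an open interval of length pi.\<close>

lemma nn_integral_semicircle_inverse:
  assumes a: "a > 0"
  shows "(\<integral>\<^sup>+y. ennreal (if \<bar>y\<bar> < a then 1 / sqrt (a\<^sup>2 - y\<^sup>2) else 0) \<partial>lborel) = ennreal pi"
proof -
  let ?f = "\<lambda>y. if \<bar>y\<bar> < a then 1 / sqrt (a\<^sup>2 - y\<^sup>2) else 0"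
  let ?g = "\<lambda>\<theta>. a * sin \<theta>"
  have "(\<integral>\<^sup>+y. ennreal (?f y) \<partial>lborel) = (\<integral>\<^sup>+y. ennreal (?f y * indicator {?g (- pi / 2)..?g (pi / 2)} y) \<partial>lborel)"
    by (intro nn_integral_cong) (auto split: split_indicator)
  also have "\<dots> = (\<integral>\<^sup>+\<theta>. ennreal (?f (?g \<theta>) * (a * cos \<theta>) * indicator {- pi / 2..pi / 2} \<theta>) \<partial>lborel)"
  proof (rule nn_integral_substitution)
    show "set_borel_measurable borel {?g (- pi / 2)..?g (pi / 2)} ?f"
      unfolding set_borel_measurable_def by measurable
    show "(?g has_real_derivative a * cos \<theta>) (at \<theta>)" for \<theta> by (auto intro!: derivative_eq_intros)
    show "0 \<le> a * cos \<theta>" if "\<theta> \<in> {- pi / 2..pi / 2}" for \<theta>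
      using that a by (auto intro!: mult_nonneg_nonneg cos_ge_zero)
  qed (auto intro!: continuous_intros)
  also have "\<dots> = (\<integral>\<^sup>+\<theta>. indicator {- pi / 2<..<pi / 2} \<theta> \<partial>lborel)"
  proof (intro nn_integral_cong)
    fix \<theta> :: real
    show "ennreal (?f (?g \<theta>) * (a * cos \<theta>) * indicator {- pi / 2..pi / 2} \<theta>) = indicator {- pi / 2<..<pi / 2} \<theta>"
    proof (cases "\<theta> \<in> {- pi / 2<..<pi / 2}")
      case True
      then have c: "cos \<theta> > 0" by (auto intro!: cos_gt_zero_pi)
      have "(sin \<theta>)\<^sup>2 < 1" using c sin_cos_squared_add[of \<theta>] zero_less_power[OF c, of 2] by linarith
      then have "\<bar>sin \<theta>\<bar> < 1" by (simp add: abs_square_less_1)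
      then have "\<bar>?g \<theta>\<bar> < a" using a by (simp add: abs_mult)
      moreover have "a\<^sup>2 - (?g \<theta>)\<^sup>2 = (a * cos \<theta>)\<^sup>2"
        by (simp add: power_mult_distrib cos_squared_eq algebra_simps)
      then have "sqrt (a\<^sup>2 - (?g \<theta>)\<^sup>2) = a * cos \<theta>" using a c by simp
      ultimately show ?thesis using True a c by (simp add: less_imp_neq[symmetric])
    next
      case False
      then have "cos \<theta> = 0 \<or> \<theta> \<notin> {- pi / 2..pi / 2}"
      proof -
        consider "\<theta> = pi / 2" | "\<theta> = - (pi / 2)" | "\<theta> \<notin> {- pi / 2..pi / 2}" using False by fastforce
        then show ?thesis by cases (simp_all only: cos_pi_half cos_minus simp_thms)
      qed
      then show ?thesis using False by auto
    qed
  qed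
  also have "\<dots> = ennreal pi" by simp
  finally show ?thesis .
qed

lemma abs_less_iff_square_less: "0 \<le> (a::real) \<Longrightarrow> \<bar>x\<bar> < a \<longleftrightarrow> x\<^sup>2 < a\<^sup>2"
  using abs_le_square_iff[of a x] by (auto simp: not_le[symmetric])

lemma nn_integral_sqrt:
  assumes t: "t > 0"
  shows "(\<integral>\<^sup>+w. ennreal (sqrt w) * indicator {0..t\<^sup>2} w \<partial>lborel) = ennreal (2 / 3 * t ^ 3)"
proof -
  have "(\<integral>\<^sup>+w. ennreal (sqrt w) * indicator {0..t\<^sup>2} w \<partial>lborel) = (\<integral>\<^sup>+w. ennreal (sqrt w * indicator {0\<^sup>2..t\<^sup>2} w) \<partial>lborel)"
    by (intro nn_integral_cong) (auto split: split_indicator)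
  also have "\<dots> = (\<integral>\<^sup>+r. ennreal (sqrt (r\<^sup>2) * (2 * r) * indicator {0..t} r) \<partial>lborel)"
  proof (rule nn_integral_substitution)
    show "set_borel_measurable borel {0\<^sup>2..t\<^sup>2} sqrt"
      unfolding set_borel_measurable_def by measurable
  qed (use t in \<open>auto intro!: derivative_eq_intros continuous_intros\<close>)
  also have "\<dots> = (\<integral>\<^sup>+r. ennreal (2 * r\<^sup>2) * indicator {0..t} r \<partial>lborel)"
    by (intro nn_integral_cong) (auto split: split_indicator simp: power2_eq_square)
  also have "\<dots> = ennreal (2 / 3 * t ^ 3 - 2 / 3 * 0 ^ 3)"
    using t by (intro nn_integral_FTC_Icc) (auto intro!: derivative_eq_intros simp: power2_eq_square)
  finally show ?thesis by simp
qed

section \<open>One-dimensional marginals of the wave measures\<close>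

lemma nn_integral_wave_measure_1:
  fixes e :: "real ^ 'd" and h :: "real \<Rightarrow> ennreal"
  assumes d: "CARD('d) = 1" and e: "norm e = 1" and [measurable]: "h \<in> borel_measurable borel"
  shows "(\<integral>\<^sup>+y. h (y \<bullet> e) \<partial>wave_measure t) = ennreal (1 / 2) * (\<integral>\<^sup>+u. h u * indicator {-t..t} u \<partial>lborel)"
proof -
  obtain U :: "real \<Rightarrow> real ^ 'd" where U: "linear U" "\<And>x. norm (U x) = norm x" "\<And>x. U x \<bullet> e = x \<bullet> 1"
    using isometry_to_unit_vector[of e "1::real"] d e by auto
  have [measurable]: "U \<in> borel_measurable borel"
    by (intro borel_measurable_continuous_onI linear_continuous_on linear_conv_bounded_linear[THEN iffD1] U)
  have L: "(lborel :: (real ^ 'd) measure) = distr lborel borel U"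
    using distr_lborel_isometry[OF U(1,2)] d by simp
  have "(\<integral>\<^sup>+y. h (y \<bullet> e) \<partial>wave_measure t) = (\<integral>\<^sup>+y. ennreal (if norm y \<le> t then 1/2 else 0) * h (y \<bullet> e) \<partial>(lborel :: (real ^ 'd) measure))"
    using d by (simp add: wave_measure_def nn_integral_density wave_density_def cong: if_cong)
  also have "\<dots> = (\<integral>\<^sup>+x. ennreal (if \<bar>x\<bar> \<le> t then 1/2 else 0) * h x \<partial>lborel)"
    by (subst L, subst nn_integral_distr) (simp_all add: U cong: if_cong)
  also have "\<dots> = (\<integral>\<^sup>+x. ennreal (1 / 2) * (h x * indicator {-t..t} x) \<partial>lborel)"
    by (intro nn_integral_cong) (auto split: split_indicator simp: mult.commute)
  finally show ?thesis by (simp add: nn_integral_cmult)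
qed

text \<open>Over x with |x| < t the density is integrated along the chord |y| < a with a^2 = t^2 -
  x^2. The value pi / (2 pi) = 1 / 2 does not depend on the length of the chord.\<close>

lemma nn_integral_wave_measure_2:
  fixes e :: "real ^ 'd" and h :: "real \<Rightarrow> ennreal"
  assumes d: "CARD('d) = 2" and e: "norm e = 1" and [measurable]: "h \<in> borel_measurable borel" and t: "t > 0"
  shows "(\<integral>\<^sup>+y. h (y \<bullet> e) \<partial>wave_measure t) = ennreal (1 / 2) * (\<integral>\<^sup>+u. h u * indicator {-t..t} u \<partial>lborel)"
proof -
  obtain U :: "real \<times> real \<Rightarrow> real ^ 'd" where U: "linear U" "\<And>x. norm (U x) = norm x" "\<And>x. U x \<bullet> e = x \<bullet> (1, 0)"
    using isometry_to_unit_vector[of e "(1::real, 0::real)"] d e by auto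
  have [measurable]: "U \<in> borel_measurable borel"
    by (intro borel_measurable_continuous_onI linear_continuous_on linear_conv_bounded_linear[THEN iffD1] U)
  have L: "(lborel :: (real ^ 'd) measure) = distr lborel borel U"
    using distr_lborel_isometry[OF U(1,2)] d by simp
  let ?q = "\<lambda>r. if r < t then 1 / (2 * pi * sqrt (t\<^sup>2 - r\<^sup>2)) else 0"
  have "(\<integral>\<^sup>+y. h (y \<bullet> e) \<partial>wave_measure t) = (\<integral>\<^sup>+y. ennreal (?q (norm y)) * h (y \<bullet> e) \<partial>(lborel :: (real ^ 'd) measure))"
    using d by (simp add: wave_measure_def nn_integral_density wave_density_def cong: if_cong)
  also have "\<dots> = (\<integral>\<^sup>+p. ennreal (?q (norm p)) * h (p \<bullet> (1, 0)) \<partial>(lborel :: (real \<times> real) measure))"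
    by (subst L, subst nn_integral_distr) (simp_all add: U cong: if_cong)
  also have "\<dots> = (\<integral>\<^sup>+x. (\<integral>\<^sup>+y. ennreal (?q (norm (x, y :: real))) * h x \<partial>lborel) \<partial>lborel)"
  proof -
    have "(\<lambda>p. ennreal (?q (norm p)) * h (p \<bullet> (1, 0))) \<in> borel_measurable (borel :: (real \<times> real) measure)"
      by measurable
    then have m: "(\<lambda>p. ennreal (?q (norm p)) * h (p \<bullet> (1, 0))) \<in> borel_measurable (lborel \<Otimes>\<^sub>M (lborel :: real measure))"
      by (simp add: lborel_prod)
    show ?thesis
      by (subst lborel_prod[symmetric], subst lborel.nn_integral_fst[OF m, symmetric]) simp
  qed
  also have "\<dots> = (\<integral>\<^sup>+x. ennreal (1 / 2) * (h x * indicator {-t..t} x) \<partial>lborel)"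
  proof (rule nn_integral_cong_AE)
    \<comment> \<open>At x = t and x = - t the density vanishes along the whole line while the
      closed interval still contains x; the two points are set aside as a null set.\<close>
    have "AE x in lborel. x \<noteq> t \<and> x \<noteq> - t" using AE_lborel_singleton[of t] AE_lborel_singleton[of "-t"] by auto
    then show "AE x in lborel. (\<integral>\<^sup>+y. ennreal (?q (norm (x, y :: real))) * h x \<partial>lborel) = ennreal (1 / 2) * (h x * indicator {-t..t} x)"
    proof eventually_elim
      case (elim x)
      have q: "(\<integral>\<^sup>+y. ennreal (?q (norm (x, y :: real))) \<partial>lborel) = ennreal (1 / 2) * indicator {-t..t} x"
      proof (cases "\<bar>x\<bar> < t")
        case True
        define a where "a = sqrt (t\<^sup>2 - x\<^sup>2)"
        have x2: "x\<^sup>2 < t\<^sup>2" using True t by (simp add: abs_less_iff_square_less)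
        then have a: "a > 0" "a\<^sup>2 = t\<^sup>2 - x\<^sup>2" by (auto simp: a_def)
        have q': "?q (norm (x, y)) = (1 / (2 * pi)) * (if \<bar>y\<bar> < a then 1 / sqrt (a\<^sup>2 - y\<^sup>2) else 0)" for y :: real
        proof -
          have "norm (x, y) < t \<longleftrightarrow> x\<^sup>2 + y\<^sup>2 < t\<^sup>2"
            using t real_sqrt_less_iff[of "x\<^sup>2 + y\<^sup>2" "t\<^sup>2"] by (simp add: norm_Pair)
          also have "\<dots> \<longleftrightarrow> y\<^sup>2 < a\<^sup>2" using a by auto
          also have "\<dots> \<longleftrightarrow> \<bar>y\<bar> < a" using a(1) by (simp add: abs_less_iff_square_less)
          finally have "norm (x, y) < t \<longleftrightarrow> \<bar>y\<bar> < a" .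
          moreover have "t\<^sup>2 - (norm (x, y))\<^sup>2 = a\<^sup>2 - y\<^sup>2" by (simp add: norm_Pair a)
          ultimately show ?thesis by simp
        qed
        have "0 \<le> 1 / (2 * pi)" by simp
        then have "ennreal (?q (norm (x, y))) = ennreal (1 / (2 * pi)) * ennreal (if \<bar>y\<bar> < a then 1 / sqrt (a\<^sup>2 - y\<^sup>2) else 0)"
          for y unfolding q' by (rule ennreal_mult')
        then have "(\<integral>\<^sup>+y. ennreal (?q (norm (x, y :: real))) \<partial>lborel)
            = (\<integral>\<^sup>+y. ennreal (1 / (2 * pi)) * ennreal (if \<bar>y\<bar> < a then 1 / sqrt (a\<^sup>2 - y\<^sup>2) else 0) \<partial>lborel)"
          by (simp only:)
        also have "\<dots> = ennreal (1 / (2 * pi)) * ennreal pi"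
          by (subst nn_integral_cmult) (simp_all add: nn_integral_semicircle_inverse[OF a(1)])
        also have "\<dots> = ennreal (1 / 2)" by (simp add: ennreal_mult[symmetric])
        finally show ?thesis using True by (auto simp: abs_less_iff)
      next
        case False
        then have "?q (norm (x, y)) = 0" for y :: real
          using norm_Pair_ge(1)[of x y] by auto
        moreover have "x \<notin> {-t..t}" using False elim by auto
        ultimately show ?thesis by simp
      qed
      have "(\<integral>\<^sup>+y. ennreal (?q (norm (x, y :: real))) * h x \<partial>lborel) = (\<integral>\<^sup>+y. ennreal (?q (norm (x, y :: real))) \<partial>lborel) * h x"
        by (rule nn_integral_multc) measurable
      then show ?case unfolding q by (simp only: mult_ac)
    qed
  qed
  finally show ?thesis by (simp add: nn_integral_cmult)
qed

text \<open>Archimedes' hat-box theorem. Writing points as \<open>(x, v)\<close> with \<open>v\<close> in the plane, the area of discs turns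
  the integral over the solid cone into one over \<open>(x, w)\<close> with \<open>w = x\<^sup>2 + \<bar>v\<bar>\<^sup>2\<close>.\<close>

lemma nn_integral_wave_measure_3:
  fixes e :: "real ^ 'd" and h :: "real \<Rightarrow> ennreal"
  assumes d: "CARD('d) = 3" and e: "norm e = 1" and [measurable]: "h \<in> borel_measurable borel" and t: "t > 0"
  shows "(\<integral>\<^sup>+y. h (y \<bullet> e) \<partial>wave_measure t) = ennreal (1 / 2) * (\<integral>\<^sup>+u. h u * indicator {-t..t} u \<partial>lborel)"
proof -
  obtain U :: "real \<times> (real \<times> real) \<Rightarrow> real ^ 'd" where U: "linear U" "\<And>x. norm (U x) = norm x" "\<And>x. U x \<bullet> e = x \<bullet> (1, 0)"
    using isometry_to_unit_vector[of e "(1::real, 0::real \<times> real)"] d e by auto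
  have [measurable]: "U \<in> borel_measurable borel"
    by (intro borel_measurable_continuous_onI linear_continuous_on linear_conv_bounded_linear[THEN iffD1] U)
  have L: "(lborel :: (real ^ 'd) measure) = distr lborel borel U"
    using distr_lborel_isometry[OF U(1,2)] d by simp
  define K where "K = (\<integral>\<^sup>+u. h u * indicator {-t..t} u \<partial>lborel)"
  \<comment> \<open>The normalisation in \<open>wave_measure\<close> times the cone factor DIM / t
    in \<open>sphere_surface_measure\<close>.\<close>
  define c where "c = ennreal (1 / (4 * pi * t)) * ennreal (3 / t)"
  let ?ind = "\<lambda>P. (if P then 1 else 0) :: ennreal"
  have m: "(\<lambda>x::real ^ 'd. (t / norm x) *\<^sub>R x) \<in> borel_measurable borel" by measurable
  have m': "(\<lambda>x::real ^ 'd. (t / norm x) *\<^sub>R x) \<in> restrict_space lborel (ball 0 t) \<rightarrow>\<^sub>M borel"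
    by (intro measurable_restrict_space1) (simp add: m)
  have "(\<integral>\<^sup>+y. h (y \<bullet> e) \<partial>wave_measure t) = c * (\<integral>\<^sup>+x. h (((t / norm x) *\<^sub>R x) \<bullet> e) \<partial>restrict_space (lborel :: (real ^ 'd) measure) (ball 0 t))"
    using d unfolding wave_measure_def sphere_surface_measure_def c_def
    by (simp add: nn_integral_scale_measure nn_integral_distr[OF m'] mult.assoc)
  also have "\<dots> = c * (\<integral>\<^sup>+x. h ((t / norm x) * (x \<bullet> e)) * ?ind (norm x < t) \<partial>(lborel :: (real ^ 'd) measure))"
    by (subst nn_integral_restrict_space) (auto intro!: arg_cong2[where f="(*)"] nn_integral_cong split: split_indicator)
  also have "(\<integral>\<^sup>+x. h ((t / norm x) * (x \<bullet> e)) * ?ind (norm x < t) \<partial>(lborel :: (real ^ 'd) measure))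
      = (\<integral>\<^sup>+p. h ((t / norm p) * (p \<bullet> (1, 0))) * ?ind (norm p < t) \<partial>(lborel :: (real \<times> real \<times> real) measure))"
    by (subst L, subst nn_integral_distr) (simp_all add: U cong: if_cong)
  also have "\<dots> = (\<integral>\<^sup>+x. (\<integral>\<^sup>+v. h ((t / sqrt (x\<^sup>2 + (norm v)\<^sup>2)) * x) * ?ind (x\<^sup>2 + (norm v)\<^sup>2 < t\<^sup>2) \<partial>(lborel :: (real \<times> real) measure)) \<partial>lborel)"
  proof -
    have *: "norm (x, v) < t \<longleftrightarrow> x\<^sup>2 + (norm v)\<^sup>2 < t\<^sup>2" for x :: real and v :: "real \<times> real"
      using t real_sqrt_less_iff[of "x\<^sup>2 + (norm v)\<^sup>2" "t\<^sup>2"] by (simp add: norm_Pair)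
    show ?thesis
    proof -
      have "(\<lambda>p. h ((t / norm p) * (p \<bullet> (1, 0))) * ?ind (norm p < t)) \<in> borel_measurable (borel :: (real \<times> real \<times> real) measure)"
        by measurable
      then have m: "(\<lambda>p. h ((t / norm p) * (p \<bullet> (1, 0))) * ?ind (norm p < t)) \<in> borel_measurable (lborel \<Otimes>\<^sub>M (lborel :: (real \<times> real) measure))"
        by (simp add: lborel_prod)
      show ?thesis
        by (subst lborel_prod[symmetric], subst lborel.nn_integral_fst[OF m, symmetric])
           (intro nn_integral_cong, simp add: *, simp add: norm_Pair)
    qed
  qed
  also have "\<dots> = (\<integral>\<^sup>+x. ennreal pi * (\<integral>\<^sup>+w. h ((t / sqrt (x\<^sup>2 + w)) * x) * ?ind (x\<^sup>2 + w < t\<^sup>2) * indicator {0..} w \<partial>lborel) \<partial>lborel)"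
    by (intro nn_integral_cong nn_integral_radial_plane) measurable
  \<comment> \<open>Shifting w by x^2 makes w the squared radius of the point, whose radial
    projection has first coordinate (t / sqrt w) x; the condition w \<ge> 0 becomes x^2 \<le>
    w.\<close>
  also have "\<dots> = (\<integral>\<^sup>+x. ennreal pi * (\<integral>\<^sup>+w. h ((t / sqrt w) * x) * ?ind (w < t\<^sup>2) * ?ind (x\<^sup>2 \<le> w) \<partial>lborel) \<partial>lborel)"
  proof (rule nn_integral_cong)
    fix x :: real
    have "(\<integral>\<^sup>+w. h ((t / sqrt w) * x) * ?ind (w < t\<^sup>2) * ?ind (x\<^sup>2 \<le> w) \<partial>lborel)
        = (\<integral>\<^sup>+w. h ((t / sqrt (w + x\<^sup>2)) * x) * ?ind (w + x\<^sup>2 < t\<^sup>2) * ?ind (x\<^sup>2 \<le> w + x\<^sup>2) \<partial>lborel)"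
      by (rule nn_integral_lborel_translate[symmetric]) measurable
    also have "\<dots> = (\<integral>\<^sup>+w. h ((t / sqrt (x\<^sup>2 + w)) * x) * ?ind (x\<^sup>2 + w < t\<^sup>2) * indicator {0..} w \<partial>lborel)"
      by (rule nn_integral_cong) (simp add: add.commute indicator_def)
    finally show "ennreal pi * (\<integral>\<^sup>+w. h ((t / sqrt (x\<^sup>2 + w)) * x) * ?ind (x\<^sup>2 + w < t\<^sup>2) * indicator {0..} w \<partial>lborel)
        = ennreal pi * (\<integral>\<^sup>+w. h ((t / sqrt w) * x) * ?ind (w < t\<^sup>2) * ?ind (x\<^sup>2 \<le> w) \<partial>lborel)"
      by (simp only:)
  qed
  also have "\<dots> = ennreal pi * (\<integral>\<^sup>+x. (\<integral>\<^sup>+w. h ((t / sqrt w) * x) * ?ind (w < t\<^sup>2) * ?ind (x\<^sup>2 \<le> w) \<partial>lborel) \<partial>lborel)"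
    by (rule nn_integral_cmult) measurable
  also have "(\<integral>\<^sup>+x. (\<integral>\<^sup>+w. h ((t / sqrt w) * x) * ?ind (w < t\<^sup>2) * ?ind (x\<^sup>2 \<le> w) \<partial>lborel) \<partial>lborel)
      = (\<integral>\<^sup>+w. (\<integral>\<^sup>+x. h ((t / sqrt w) * x) * ?ind (w < t\<^sup>2) * ?ind (x\<^sup>2 \<le> w) \<partial>lborel) \<partial>lborel)"
    by (rule lborel_pair.Fubini'[symmetric]) measurable
  also have "\<dots> = (\<integral>\<^sup>+w. ennreal (1 / t) * K * (ennreal (sqrt w) * indicator {0..t\<^sup>2} w) \<partial>lborel)"
  proof (rule nn_integral_cong_AE)
    \<comment> \<open>The scaling below degenerates at w = 0, and at w = t^2 the strict inequality
      meets a closed interval; both values form a null set.\<close>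
    have "AE w in lborel. w \<noteq> 0 \<and> w \<noteq> t\<^sup>2" using AE_lborel_singleton[of 0] AE_lborel_singleton[of "t\<^sup>2"] by auto
    then show "AE w in lborel. (\<integral>\<^sup>+x. h ((t / sqrt w) * x) * ?ind (w < t\<^sup>2) * ?ind (x\<^sup>2 \<le> w) \<partial>lborel)
        = ennreal (1 / t) * K * (ennreal (sqrt w) * indicator {0..t\<^sup>2} w)"
    proof eventually_elim
      case (elim w)
      show ?case
      proof (cases "0 < w \<and> w < t\<^sup>2")
        case True
        \<comment> \<open>With x = k u the first coordinate on the sphere becomes u and the
          condition x^2 \<le> w becomes |u| \<le> t, so the integral over x depends on w only
          through the Jacobian k.\<close>
        define k where "k = sqrt w / t"
        have k: "k > 0" "t / sqrt w * k = 1" using True t by (auto simp: k_def)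
        have "(\<integral>\<^sup>+x. h ((t / sqrt w) * x) * ?ind (w < t\<^sup>2) * ?ind (x\<^sup>2 \<le> w) \<partial>lborel)
            = (\<integral>\<^sup>+x. h ((t / sqrt w) * x) * ?ind (x\<^sup>2 \<le> w) \<partial>lborel)" using True by simp
        also have "\<dots> = ennreal k * (\<integral>\<^sup>+u. h ((t / sqrt w) * (0 + k * u)) * ?ind ((0 + k * u)\<^sup>2 \<le> w) \<partial>lborel)"
          using k(1) nn_integral_real_affine[of "\<lambda>x. h ((t / sqrt w) * x) * ?ind (x\<^sup>2 \<le> w)" k 0] by simp
        also have "(\<integral>\<^sup>+u. h ((t / sqrt w) * (0 + k * u)) * ?ind ((0 + k * u)\<^sup>2 \<le> w) \<partial>lborel) = K"
          unfolding K_def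
        proof (intro nn_integral_cong)
          fix u :: real
          have "(0 + k * u)\<^sup>2 \<le> w \<longleftrightarrow> w * u\<^sup>2 \<le> w * t\<^sup>2"
            using True t by (simp add: k_def power_mult_distrib power_divide field_simps)
          also have "\<dots> \<longleftrightarrow> \<bar>u\<bar> \<le> t" using True t by (simp add: abs_le_square_iff[symmetric])
          also have "\<dots> \<longleftrightarrow> u \<in> {-t..t}" by auto
          finally have "(0 + k * u)\<^sup>2 \<le> w \<longleftrightarrow> u \<in> {-t..t}" .
          moreover have "(t / sqrt w) * (0 + k * u) = u" using k(2) by (metis add_0 mult.assoc mult_1)
          ultimately show "h ((t / sqrt w) * (0 + k * u)) * ?ind ((0 + k * u)\<^sup>2 \<le> w) = h u * indicator {-t..t} u"
            by (simp add: indicator_def)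
        qed
        also have "ennreal k = ennreal (1 / t) * ennreal (sqrt w)" using t True by (simp add: k_def ennreal_mult[symmetric])
        finally show ?thesis using True by (simp add: mult_ac)
      next
        case False
        with elim consider "w < 0" | "w > t\<^sup>2" by linarith
        then show ?thesis
        proof cases
          case 1
          then have "\<not> x\<^sup>2 \<le> w" for x :: real using zero_le_power2[of x] by linarith
          with 1 show ?thesis by simp
        next
          case 2
          then show ?thesis by simp
        qed
      qed
    qed
  qed
  also have "\<dots> = ennreal (1 / t) * K * ennreal (2 / 3 * t ^ 3)"
    by (subst nn_integral_cmult) (simp_all add: nn_integral_sqrt[OF t])
  also have "c * (ennreal pi * \<dots>) = (ennreal (1 / (4 * pi * t)) * ennreal (3 / t) * ennreal pi * ennreal (1 / t) * ennreal (2 / 3 * t ^ 3)) * K"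
    by (simp only: c_def mult_ac)
  also have "ennreal (1 / (4 * pi * t)) * ennreal (3 / t) * ennreal pi * ennreal (1 / t) * ennreal (2 / 3 * t ^ 3)
      = ennreal (1 / (4 * pi * t) * (3 / t) * pi * (1 / t) * (2 / 3 * t ^ 3))"
  proof -
    have "0 \<le> 1 / (4 * pi * t)" "0 \<le> 3 / t" "0 \<le> 1 / t" "0 \<le> 2 / 3 * t ^ 3" using t by auto
    then show ?thesis by (simp only: ennreal_mult mult_nonneg_nonneg pi_ge_zero)
  qed
  also have "1 / (4 * pi * t) * (3 / t) * pi * (1 / t) * (2 / 3 * t ^ 3) = 1 / 2"
    using t by (simp add: field_simps power3_eq_cube)
  finally show ?thesis by (simp only: K_def)
qed

section \<open>Mass and Fourier transform of the wave measures\<close>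

lemma sets_wave_measure [measurable_cong]: "sets (wave_measure t) = sets borel"
  by (simp add: wave_measure_def sphere_surface_measure_def)

lemma nn_integral_wave_measure:
  fixes e :: "real ^ 'd" and h :: "real \<Rightarrow> ennreal"
  assumes "CARD('d) \<in> {1, 2, 3}" "norm e = 1" "h \<in> borel_measurable borel" "t > 0"
  shows "(\<integral>\<^sup>+y. h (y \<bullet> e) \<partial>wave_measure t) = ennreal (1 / 2) * (\<integral>\<^sup>+u. h u * indicator {-t..t} u \<partial>lborel)"
  using assms nn_integral_wave_measure_1 nn_integral_wave_measure_2 nn_integral_wave_measure_3 by blast

lemma emeasure_wave_measure:
  assumes "CARD('d::finite) \<in> {1, 2, 3}" and t: "t > 0"
  shows "emeasure (wave_measure t) (UNIV :: (real ^ 'd) set) = ennreal t"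
proof -
  have sp: "space (wave_measure t) = (UNIV :: (real ^ 'd) set)"
    using sets_eq_imp_space_eq[OF sets_wave_measure] by simp
  have "emeasure (wave_measure t) (UNIV :: (real ^ 'd) set) = (\<integral>\<^sup>+y. 1 \<partial>(wave_measure t :: (real ^ 'd) measure))"
    by (simp add: sp)
  also have "\<dots> = ennreal (1 / 2) * (\<integral>\<^sup>+u. 1 * indicator {-t..t} u \<partial>lborel)"
    using nn_integral_wave_measure[OF assms(1) _ _ t, of "axis (SOME k. True) 1" "\<lambda>_. 1"] by simp
  also have "\<dots> = ennreal (1 / 2) * ennreal (2 * t)" using t by simp
  also have "\<dots> = ennreal t" using t by (subst ennreal_mult[symmetric]) simp_all
  finally show ?thesis .
qed

lemma finite_wave_measure:
  assumes "CARD('d::finite) \<in> {1, 2, 3}" "t > 0"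
  shows "finite_measure (wave_measure t :: (real ^ 'd) measure)"
proof (rule finite_measureI)
  have "space (wave_measure t) = (UNIV :: (real ^ 'd) set)"
    using sets_eq_imp_space_eq[OF sets_wave_measure] by simp
  then show "emeasure (wave_measure t :: (real ^ 'd) measure) (space (wave_measure t)) \<noteq> \<infinity>"
    using emeasure_wave_measure[OF assms] by simp
qed

text \<open>The phase depends on y only through its component along \<xi>, so the transform is an
  integral over the line against the marginal, and an explicit antiderivative evaluates it.\<close>

lemma fourier_wave_measure:
  fixes \<xi> :: "real ^ 'd"
  assumes d: "CARD('d) \<in> {1, 2, 3}" and t: "t > 0"
  shows "(\<integral>y. cis (- 2 * pi * (y \<bullet> \<xi>)) \<partial>wave_measure t) = of_real (wave_symbol t \<xi>)"
proof (cases "\<xi> = 0")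
  case True
  \<comment> \<open>At frequency 0 the transform is the total mass t, the value assigned to
    \<open>wave_symbol\<close> there.\<close>
  have "space (wave_measure t) = (UNIV :: (real ^ 'd) set)"
    using sets_eq_imp_space_eq[OF sets_wave_measure] by simp
  then show ?thesis using True emeasure_wave_measure[OF d t] t
    by (simp add: wave_symbol_def measure_def scaleR_conv_of_real)
next
  case False
  define \<rho> where "\<rho> = norm \<xi>"
  define e where "e = \<xi> /\<^sub>R \<rho>"
  have \<rho>: "\<rho> > 0" and e: "norm e = 1" and \<xi>: "\<xi> = \<rho> *\<^sub>R e" using False by (auto simp: \<rho>_def e_def)
  have eq: "distr (wave_measure t) borel (\<lambda>y. y \<bullet> e) = density lborel (\<lambda>u. ennreal (indicator {-t..t} u / 2))" (is "?M = ?N")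
  proof (rule measure_eqI)
    fix A assume "A \<in> sets ?M"
    then have [measurable]: "A \<in> sets borel" by simp
    have "emeasure ?M A = (\<integral>\<^sup>+y. indicator A (y \<bullet> e) \<partial>wave_measure t)"
      by (subst nn_integral_indicator[symmetric], simp, subst nn_integral_distr) simp_all
    also have "\<dots> = (\<integral>\<^sup>+u. ennreal (1 / 2) * (indicator A u * indicator {-t..t} u) \<partial>lborel)"
      by (simp add: nn_integral_wave_measure[OF d e _ t] nn_integral_cmult)
    also have "\<dots> = emeasure ?N A"
      by (subst emeasure_density) (auto intro!: nn_integral_cong split: split_indicator)
    finally show "emeasure ?M A = emeasure ?N A" .
  qed simp
  let ?F = "\<lambda>u. cis (- 2 * pi * \<rho> * u) / (- 2 * pi * \<rho> * \<i>)"
  have "(\<integral>y. cis (- 2 * pi * (y \<bullet> \<xi>)) \<partial>wave_measure t) = (\<integral>u. cis (- 2 * pi * \<rho> * u) \<partial>?M)"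
    by (subst integral_distr) (simp_all add: \<xi> mult_ac)
  also have "\<dots> = (\<integral>u. (indicator {-t..t} u / 2) *\<^sub>R cis (- 2 * pi * \<rho> * u) \<partial>lborel)"
    unfolding eq by (subst integral_density) simp_all
  also have "\<dots> = (1 / 2) *\<^sub>R (\<integral>u. indicator {-t..t} u *\<^sub>R cis (- 2 * pi * \<rho> * u) \<partial>lborel)"
    by (subst integral_scaleR_right[symmetric]) simp
  also have "(\<integral>u. indicator {-t..t} u *\<^sub>R cis (- 2 * pi * \<rho> * u) \<partial>lborel) = ?F t - ?F (- t)"
  proof (rule integral_FTC_Icc)
    show "- t \<le> t" using t by simp
    show "(?F has_vector_derivative cis (- 2 * pi * \<rho> * u)) (at u within {- t..t})" for u
    proof -
      have "((\<lambda>u. exp (\<i> * of_real (- 2 * pi * \<rho>) * of_real u) / (- 2 * pi * \<rho> * \<i>)) has_vector_derivative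
          exp (\<i> * of_real (- 2 * pi * \<rho>) * of_real u)) (at u within {- t..t})"
        using \<rho> by (intro has_vector_derivative_real_field[of "\<lambda>z. exp (\<i> * of_real (- 2 * pi * \<rho>) * z) / (- 2 * pi * \<rho> * \<i>)"])
          (auto intro!: derivative_eq_intros)
      then show ?thesis by (simp add: cis_conv_exp mult_ac)
    qed
    show "continuous_on {- t..t} (\<lambda>u. cis (- 2 * pi * \<rho> * u))"
      by (intro continuous_intros)
  qed
  also have "(1 / 2) *\<^sub>R (?F t - ?F (- t)) = of_real (wave_symbol t \<xi>)"
  proof -
    have "?F t - ?F (- t) = (- 2 * \<i> * sin (2 * pi * \<rho> * t)) / (- 2 * pi * \<rho> * \<i>)"
    proof -
      define a where "a = 2 * pi * \<rho> * t"
      have "?F t - ?F (- t) = (cis (- a) - cis a) / (- 2 * pi * \<rho> * \<i>)"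
        by (simp add: a_def diff_divide_distrib)
      also have "cis (- a) - cis a = - 2 * \<i> * sin a" by (simp add: complex_eq_iff)
      finally show ?thesis by (simp add: a_def)
    qed
    also have "\<dots> = of_real (2 * (sin (2 * pi * \<rho> * t) / (2 * pi * \<rho>)))" using \<rho> by (simp add: field_simps)
    finally show ?thesis using False by (simp add: wave_symbol_def \<rho>_def scaleR_conv_of_real mult_ac)
  qed
  finally show ?thesis .
qed


section \<open>Wigner distributions of measures\<close>

lemma borel_measurable_fst [measurable]: "fst \<in> borel_measurable (borel :: ('a::euclidean_space \<times> 'b::euclidean_space) measure)"
  by (intro borel_measurable_continuous_onI continuous_intros)

lemma borel_measurable_snd [measurable]: "snd \<in> borel_measurable (borel :: ('a::euclidean_space \<times> 'b::euclidean_space) measure)"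
  by (intro borel_measurable_continuous_onI continuous_intros)

text \<open>Inverse of (a, b) \<mapsto> ((a + b) / 2, a - b): it leads from mean and difference back
  to the two arguments in the Wigner integrand.\<close>

definition midpoint_map :: "'a::euclidean_space \<times> 'a \<Rightarrow> 'a \<times> 'a" where
  "midpoint_map p = (fst p + (1/2) *\<^sub>R snd p, fst p - (1/2) *\<^sub>R snd p)"

lemma midpoint_map_measurable [measurable]: "midpoint_map \<in> borel_measurable borel"
  unfolding midpoint_map_def[abs_def] by (intro borel_measurable_continuous_onI continuous_intros)

text \<open>\<open>midpoint_map\<close> preserves Lebesgue measure since it is a composition of shears.\<close>

lemma nn_integral_midpoint_map:
  fixes H :: "'a::euclidean_space \<times> 'a \<Rightarrow> ennreal"
  assumes H [measurable]: "H \<in> borel_measurable borel"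
  shows "(\<integral>\<^sup>+p. H (midpoint_map p) \<partial>lborel) = (\<integral>\<^sup>+p. H p \<partial>lborel)"
proof -
  have m1: "(\<lambda>p. H (midpoint_map p)) \<in> borel_measurable (lborel \<Otimes>\<^sub>M lborel)"
    by (simp add: lborel_prod)
  have m2: "H \<in> borel_measurable (lborel \<Otimes>\<^sub>M lborel)" by (simp add: lborel_prod)
  have m3: "(\<lambda>(x, y). H (x + y, x)) \<in> borel_measurable (lborel \<Otimes>\<^sub>M lborel)"
    unfolding lborel_prod case_prod_beta by measurable
  have m4: "(\<lambda>(x, y). H (y, x)) \<in> borel_measurable (lborel \<Otimes>\<^sub>M lborel)"
    unfolding lborel_prod case_prod_beta by measurable
  have "(\<integral>\<^sup>+p. H (midpoint_map p) \<partial>lborel) = (\<integral>\<^sup>+s. (\<integral>\<^sup>+r. H (midpoint_map (s, r)) \<partial>lborel) \<partial>lborel)"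
    unfolding lborel_prod[symmetric] by (rule lborel.nn_integral_fst[OF m1, symmetric])
  also have "\<dots> = (\<integral>\<^sup>+r. (\<integral>\<^sup>+s. H (midpoint_map (s, r)) \<partial>lborel) \<partial>lborel)"
    by (rule lborel_pair.Fubini[OF m1, symmetric])
  \<comment> \<open>For fixed r, shifting s by r / 2 turns the pair into (s + r, s); a shift of r
    for fixed s then completes the change of variables.\<close>
  also have "\<dots> = (\<integral>\<^sup>+r. (\<integral>\<^sup>+s. H (s + r, s) \<partial>lborel) \<partial>lborel)"
  proof (rule nn_integral_cong)
    fix r :: 'a
    have "(\<integral>\<^sup>+s. H (midpoint_map (s, r)) \<partial>lborel) = (\<integral>\<^sup>+s. H (midpoint_map (s + (1/2) *\<^sub>R r, r)) \<partial>lborel)"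
      by (rule nn_integral_lborel_translate[symmetric]) measurable
    moreover have "midpoint_map (s + (1/2) *\<^sub>R r, r) = (s + r, s)" for s
      by (simp add: midpoint_map_def scaleR_add_left[symmetric] add.assoc)
    ultimately show "(\<integral>\<^sup>+s. H (midpoint_map (s, r)) \<partial>lborel) = (\<integral>\<^sup>+s. H (s + r, s) \<partial>lborel)"
      by (simp only:)
  qed
  also have "\<dots> = (\<integral>\<^sup>+s. (\<integral>\<^sup>+r. H (s + r, s) \<partial>lborel) \<partial>lborel)"
    using lborel_pair.Fubini[OF m3] by simp
  also have "\<dots> = (\<integral>\<^sup>+s. (\<integral>\<^sup>+r. H (r, s) \<partial>lborel) \<partial>lborel)"
  proof (rule nn_integral_cong)
    fix s :: 'a
    have "(\<integral>\<^sup>+r. H (r + s, s) \<partial>lborel) = (\<integral>\<^sup>+r. H (r, s) \<partial>lborel)"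
      by (rule nn_integral_lborel_translate) measurable
    then show "(\<integral>\<^sup>+r. H (s + r, s) \<partial>lborel) = (\<integral>\<^sup>+r. H (r, s) \<partial>lborel)"
      by (simp only: add.commute)
  qed
  also have "\<dots> = (\<integral>\<^sup>+r. (\<integral>\<^sup>+s. H (r, s) \<partial>lborel) \<partial>lborel)"
    by (rule lborel_pair.Fubini[OF m2])
  also have "\<dots> = (\<integral>\<^sup>+p. H p \<partial>lborel)"
    unfolding lborel_prod[symmetric] by (rule lborel.nn_integral_fst[OF m2])
  finally show ?thesis .
qed

lemma distr_midpoint_map: "distr lborel borel midpoint_map = (lborel :: ('a::euclidean_space \<times> 'a) measure)"
proof (rule measure_eqI)
  fix A assume "A \<in> sets (distr lborel borel midpoint_map :: ('a \<times> 'a) measure)"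
  then have [measurable]: "A \<in> sets borel" by simp
  have "emeasure (distr lborel borel midpoint_map) A = (\<integral>\<^sup>+p. indicator A (midpoint_map p) \<partial>lborel)"
    by (subst nn_integral_indicator[symmetric], simp, subst nn_integral_distr) simp_all
  also have "\<dots> = emeasure lborel A"
    by (subst nn_integral_midpoint_map) simp_all
  finally show "emeasure (distr lborel borel midpoint_map) A = emeasure lborel A" .
qed simp

lemma
  fixes h :: "'a::euclidean_space \<times> 'a \<Rightarrow> complex"
  assumes [measurable]: "h \<in> borel_measurable borel"
  shows integral_midpoint_map: "(\<integral>p. h (midpoint_map p) \<partial>lborel) = (\<integral>p. h p \<partial>lborel)"
    and integrable_midpoint_map: "integrable lborel (\<lambda>p. h (midpoint_map p)) \<longleftrightarrow> integrable lborel h"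
proof -
  have "integral\<^sup>L (distr lborel borel midpoint_map) h = (\<integral>p. h (midpoint_map p) \<partial>lborel)"
    by (rule integral_distr) simp_all
  then show "(\<integral>p. h (midpoint_map p) \<partial>lborel) = (\<integral>p. h p \<partial>lborel)" by (simp add: distr_midpoint_map)
  have "integrable (distr lborel borel midpoint_map) h = integrable lborel (\<lambda>p. h (midpoint_map p))"
    by (rule integrable_distr_eq) simp_all
  then show "integrable lborel (\<lambda>p. h (midpoint_map p)) \<longleftrightarrow> integrable lborel h" by (simp add: distr_midpoint_map)
qed

text \<open>The test functions on which the pairing is controlled. Decay is demanded in \<xi> only,
  where the integral is over Lebesgue measure; in the position variables a finite measure needs no
  more than boundedness.\<close>

definition slice_bounded :: "('a::euclidean_space \<times> 'a \<Rightarrow> complex) \<Rightarrow> bool" where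
  "slice_bounded F \<longleftrightarrow> F \<in> borel_measurable borel \<and> (\<exists>C. \<forall>s \<xi>. norm (F (s, \<xi>)) \<le> C * wt \<xi>)"

text \<open>The integral kernel of the Weyl operator with symbol F, with its two arguments
  exchanged: the Weyl kernel at (x, y) carries the phase + 2 pi (x - y) \<bullet> \<xi>.\<close>

definition weyl_symbol_kernel :: "('a::euclidean_space \<times> 'a \<Rightarrow> complex) \<Rightarrow> 'a \<times> 'a \<Rightarrow> complex" where
  "weyl_symbol_kernel F p = (\<integral>\<xi>. F ((1/2) *\<^sub>R (fst p + snd p), \<xi>) * cis (- 2 * pi * ((fst p - snd p) \<bullet> \<xi>)) \<partial>lborel)"

lemma weyl_symbol_kernel_measurable [measurable]:
  assumes [measurable]: "F \<in> borel_measurable borel"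
  shows "weyl_symbol_kernel F \<in> borel_measurable borel"
  unfolding weyl_symbol_kernel_def[abs_def] by measurable

lemma slice_bounded_integrable:
  assumes "slice_bounded F"
  shows "integrable lborel (\<lambda>\<xi>. F (s, \<xi>) * cis (- 2 * pi * (r \<bullet> \<xi>)))"
proof (rule integrable_mult_cis)
  have [measurable]: "F \<in> borel_measurable borel" using assms by (simp add: slice_bounded_def)
  obtain C where C: "\<And>s \<xi>. norm (F (s, \<xi>)) \<le> C * wt \<xi>" using assms unfolding slice_bounded_def by blast
  show "integrable lborel (\<lambda>\<xi>. F (s, \<xi>))"
    by (rule Bochner_Integration.integrable_bound[OF integrable_mult_right[OF integrable_wt, of C]])
       (auto intro!: AE_I2 order_trans[OF C])
qed simp

lemma weyl_symbol_kernel_bound: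
  fixes F :: "'a::euclidean_space \<times> 'a \<Rightarrow> complex"
  assumes F: "F \<in> borel_measurable borel" and C: "\<And>s \<xi>. norm (F (s, \<xi>)) \<le> C * wt \<xi>"
  shows "norm (weyl_symbol_kernel F p) \<le> C * (\<integral>\<xi>. wt (\<xi>::'a) \<partial>lborel)"
proof -
  have sb: "slice_bounded F" using assms unfolding slice_bounded_def by blast
  have "norm (weyl_symbol_kernel F p) \<le> (\<integral>\<xi>. norm (F ((1/2) *\<^sub>R (fst p + snd p), \<xi>) * cis (- 2 * pi * ((fst p - snd p) \<bullet> \<xi>))) \<partial>lborel)"
    unfolding weyl_symbol_kernel_def by (rule integral_norm_bound)
  also have "\<dots> \<le> (\<integral>\<xi>. C * wt (\<xi>::'a) \<partial>lborel)"
    by (rule integral_mono[OF integrable_norm[OF slice_bounded_integrable[OF sb]] integrable_mult_right[OF integrable_wt]])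
       (simp add: norm_mult C)
  finally show ?thesis by simp
qed

text \<open>The value of the Wigner distribution of \<mu> on F after the integral over \<xi> has
  been carried out. Every expression in the theorem is compared with this one.\<close>

definition wigner_pairing :: "'a::euclidean_space measure \<Rightarrow> ('a \<times> 'a \<Rightarrow> complex) \<Rightarrow> complex" where
  "wigner_pairing \<mu> F = (\<integral>p. weyl_symbol_kernel F p \<partial>(\<mu> \<Otimes>\<^sub>M \<mu>))"

context
  fixes \<mu> :: "'a::euclidean_space measure"
  assumes fin: "finite_measure \<mu>" and sets [measurable_cong]: "sets \<mu> = sets borel"
begin

interpretation finite_measure \<mu> by (rule fin)
interpretation P: pair_sigma_finite \<mu> \<mu> ..

lemma finite_measure_pair: "finite_measure (\<mu> \<Otimes>\<^sub>M \<mu>)"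
  by (rule finite_measure_pair_measure) unfold_locales

lemma sets_pair: "sets (\<mu> \<Otimes>\<^sub>M \<mu>) = sets borel"
  by (subst borel_prod[symmetric]) (rule sets_pair_measure_cong[OF sets sets])

lemma integrable_pair_bounded:
  fixes h :: "'a \<times> 'a \<Rightarrow> complex"
  assumes "h \<in> borel_measurable borel" "\<And>p. norm (h p) \<le> B"
  shows "integrable (\<mu> \<Otimes>\<^sub>M \<mu>) h"
proof -
  interpret PP: finite_measure "\<mu> \<Otimes>\<^sub>M \<mu>" by (rule finite_measure_pair)
  have "h \<in> borel_measurable (\<mu> \<Otimes>\<^sub>M \<mu>)" using assms(1) measurable_cong_sets[OF sets_pair refl] by blast
  then show ?thesis using assms(2) by (intro PP.integrable_const_bound[of _ B]) auto
qed

lemma integrable_weyl_symbol_kernel: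
  assumes "slice_bounded F"
  shows "integrable (\<mu> \<Otimes>\<^sub>M \<mu>) (weyl_symbol_kernel F)"
proof -
  have F: "F \<in> borel_measurable borel" using assms by (simp add: slice_bounded_def)
  obtain C where C: "\<And>s \<xi>. norm (F (s, \<xi>)) \<le> C * wt \<xi>" using assms unfolding slice_bounded_def by blast
  show ?thesis
    by (rule integrable_pair_bounded[OF weyl_symbol_kernel_measurable[OF F] weyl_symbol_kernel_bound[OF F C]])
qed

text \<open>A measure is a real functional, so the conjugations in \<open>cnj_distr\<close> cancel;
  Fubini's theorem merges the two integrals.\<close>

lemma wigner_distr_measure:
  assumes "slice_bounded F"
  shows "wigner_distr (measure_distr \<mu>) (measure_distr \<mu>) F = wigner_pairing \<mu> F"
proof -
  have "wigner_distr (measure_distr \<mu>) (measure_distr \<mu>) F = (\<integral>a. (\<integral>b. weyl_symbol_kernel F (a, b) \<partial>\<mu>) \<partial>\<mu>)"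
    by (simp add: wigner_distr_def tensor_distr_def cnj_distr_def measure_distr_def weyl_symbol_kernel_def)
  also have "\<dots> = wigner_pairing \<mu> F"
    unfolding wigner_pairing_def by (rule P.integral_fst'[OF integrable_weyl_symbol_kernel[OF assms]])
  finally show ?thesis .
qed

lemma wigner_pairing_add:
  assumes "slice_bounded F" "slice_bounded G"
  shows "wigner_pairing \<mu> (\<lambda>p. F p + G p) = wigner_pairing \<mu> F + wigner_pairing \<mu> G"
proof -
  have "weyl_symbol_kernel (\<lambda>p. F p + G p) = (\<lambda>p. weyl_symbol_kernel F p + weyl_symbol_kernel G p)"
    unfolding weyl_symbol_kernel_def[abs_def] distrib_right
    by (intro ext Bochner_Integration.integral_add slice_bounded_integrable assms)
  then show ?thesis unfolding wigner_pairing_def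
    by (simp add: integrable_weyl_symbol_kernel assms)
qed

lemma wigner_pairing_cmult: "wigner_pairing \<mu> (\<lambda>p. c * F p) = c * wigner_pairing \<mu> F"
proof -
  have "weyl_symbol_kernel (\<lambda>p. c * F p) = (\<lambda>p. c * weyl_symbol_kernel F p)"
    by (simp add: weyl_symbol_kernel_def[abs_def] mult.assoc)
  then show ?thesis by (simp add: wigner_pairing_def)
qed

lemma wigner_pairing_bound:
  assumes F: "F \<in> borel_measurable borel" and C: "\<And>s \<xi>. norm (F (s, \<xi>)) \<le> C * wt \<xi>"
  shows "norm (wigner_pairing \<mu> F) \<le> C * ((\<integral>\<xi>. wt (\<xi>::'a) \<partial>lborel) * measure (\<mu> \<Otimes>\<^sub>M \<mu>) UNIV)"
proof -
  have sb: "slice_bounded F" using assms unfolding slice_bounded_def by blast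
  interpret PP: finite_measure "\<mu> \<Otimes>\<^sub>M \<mu>" by (rule finite_measure_pair)
  have sp: "space (\<mu> \<Otimes>\<^sub>M \<mu>) = UNIV" using sets_eq_imp_space_eq[OF sets_pair] by simp
  have "norm (wigner_pairing \<mu> F) \<le> (\<integral>p. norm (weyl_symbol_kernel F p) \<partial>(\<mu> \<Otimes>\<^sub>M \<mu>))"
    unfolding wigner_pairing_def by (rule integral_norm_bound)
  also have "\<dots> \<le> (\<integral>p. C * (\<integral>\<xi>. wt (\<xi>::'a) \<partial>lborel) \<partial>(\<mu> \<Otimes>\<^sub>M \<mu>))"
    by (intro integral_mono integrable_norm integrable_weyl_symbol_kernel[OF sb] PP.integrable_const weyl_symbol_kernel_bound[OF F C])
  finally show ?thesis by (simp add: sp mult_ac)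
qed

text \<open>Settles the definition for dimension 3: passing to the image measure only renames the
  variables of the pairing.\<close>

lemma wigner_pairing_eq_distr:
  assumes F: "slice_bounded F"
  shows "(\<integral>(s, r). (\<integral>\<xi>. F (s, \<xi>) * cis (- 2 * pi * (r \<bullet> \<xi>)) \<partial>lborel)
           \<partial>(distr (\<mu> \<Otimes>\<^sub>M \<mu>) borel (\<lambda>(a, b). ((1/2) *\<^sub>R (a + b), a - b)))) = wigner_pairing \<mu> F"
proof -
  have [measurable]: "F \<in> borel_measurable borel" using F by (simp add: slice_bounded_def)
  have "(\<lambda>p. ((1/2) *\<^sub>R (fst p + snd p), fst p - snd p)) \<in> borel_measurable (borel :: ('a \<times> 'a) measure)" by measurable
  then have m: "(\<lambda>(a, b). ((1/2) *\<^sub>R (a + b), a - b)) \<in> (\<mu> \<Otimes>\<^sub>M \<mu>) \<rightarrow>\<^sub>M borel"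
    unfolding case_prod_beta using measurable_cong_sets[OF sets_pair refl] by blast
  have m2: "(\<lambda>(s, r). (\<integral>\<xi>. F (s, \<xi>) * cis (- 2 * pi * (r \<bullet> \<xi>)) \<partial>lborel)) \<in> borel_measurable (borel :: ('a \<times> 'a) measure)"
    unfolding case_prod_beta by measurable
  show ?thesis
    by (subst integral_distr[OF m m2]) (simp add: wigner_pairing_def weyl_symbol_kernel_def[abs_def] case_prod_beta)
qed

end

text \<open>Settles the case of a density. \<open>midpoint_map\<close> carries the product density
  to the variables (s, r) and turns the kernel into a Fourier integral of F (s, \<xi>) over \<xi>;
  Fubini's theorem in (r, \<xi>) then hands the exponential from F to the density.\<close>

lemma wigner_pairing_density:
  fixes m :: "'a::euclidean_space \<Rightarrow> real"
  assumes [measurable]: "m \<in> borel_measurable borel" and nn: "\<And>x. 0 \<le> m x"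
    and fin: "finite_measure (density lborel (\<lambda>y. ennreal (m y)))"
    and F: "slice_bounded F"
  shows "function_distr (\<lambda>(s, \<xi>). \<integral>r. cis (- 2 * pi * (r \<bullet> \<xi>)) *
             complex_of_real (m (s + (1/2) *\<^sub>R r) * m (s - (1/2) *\<^sub>R r)) \<partial>lborel) F
     = wigner_pairing (density lborel (\<lambda>y. ennreal (m y))) F"
proof -
  let ?\<mu> = "density lborel (\<lambda>y. ennreal (m y))"
  have [measurable]: "F \<in> borel_measurable borel" using F by (simp add: slice_bounded_def)
  obtain C where C: "\<And>s \<xi>. norm (F (s, \<xi>)) \<le> C * wt \<xi>" using F unfolding slice_bounded_def by blast
  let ?K = "weyl_symbol_kernel F"
  let ?P = "\<lambda>s r. complex_of_real (m (s + (1/2) *\<^sub>R r) * m (s - (1/2) *\<^sub>R r))"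
  define G where "G s \<xi> = (\<integral>r. cis (- 2 * pi * (r \<bullet> \<xi>)) * ?P s r \<partial>lborel)" for s \<xi>
  interpret M: finite_measure ?\<mu> by (rule fin)
  interpret P: pair_sigma_finite ?\<mu> ?\<mu> ..
  have mi: "integrable lborel m"
  proof (rule integrableI_nonneg)
    have "(\<integral>\<^sup>+x. ennreal (m x) \<partial>lborel) = emeasure ?\<mu> UNIV" by (simp add: emeasure_density)
    then show "(\<integral>\<^sup>+x. ennreal (m x) \<partial>lborel) < \<infinity>" using M.emeasure_finite[of UNIV] by (simp add: less_top[symmetric])
  qed (use nn in auto)
  have Kb: "norm (?K p) \<le> C * (\<integral>\<xi>. wt (\<xi>::'a) \<partial>lborel)" for p by (rule weyl_symbol_kernel_bound[OF _ C]) simp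
  have mm: "integrable lborel (\<lambda>p. complex_of_real (m (fst p) * m (snd p)))"
    unfolding lborel_prod[symmetric]
    by (rule integrable_pair_dominated[OF lborel.sigma_finite_measure_axioms lborel.sigma_finite_measure_axioms _ mi mi])
       (simp_all add: lborel_prod norm_mult nn)
  have mmK: "integrable lborel (\<lambda>p. complex_of_real (m (fst p) * m (snd p)) * ?K p)"
  proof (rule Bochner_Integration.integrable_bound[OF integrable_mult_left[OF mm, of "of_real (C * (\<integral>\<xi>. wt (\<xi>::'a) \<partial>lborel))"]])
    have "norm (?K p) \<le> norm (complex_of_real (C * (\<integral>\<xi>. wt (\<xi>::'a) \<partial>lborel)))" for p
      unfolding norm_of_real by (rule order_trans[OF Kb abs_ge_self])
    then show "AE p in lborel. norm (complex_of_real (m (fst p) * m (snd p)) * ?K p)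
        \<le> norm (complex_of_real (m (fst p) * m (snd p)) * of_real (C * (\<integral>\<xi>. wt (\<xi>::'a) \<partial>lborel)))"
      unfolding norm_mult[of "complex_of_real (m _ * m _)"] by (intro AE_I2 mult_left_mono) simp_all
  qed simp
  have PP: "integrable lborel (\<lambda>p. ?P (fst p) (snd p))"
    using mm by (subst (asm) integrable_midpoint_map[symmetric]) (simp_all add: midpoint_map_def)
  have PK: "integrable lborel (\<lambda>p. ?P (fst p) (snd p) * ?K (midpoint_map p))"
    using mmK by (subst (asm) integrable_midpoint_map[symmetric]) (simp_all add: midpoint_map_def)
  have Kmid: "?K (midpoint_map (s, r)) = (\<integral>\<xi>. F (s, \<xi>) * cis (- 2 * pi * (r \<bullet> \<xi>)) \<partial>lborel)" for s r
    by (simp add: weyl_symbol_kernel_def midpoint_map_def scaleR_2[symmetric] scaleR_add_left[symmetric])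
  have "wigner_pairing ?\<mu> F = (\<integral>a. (\<integral>b. ?K (a, b) \<partial>?\<mu>) \<partial>?\<mu>)"
    unfolding wigner_pairing_def by (rule P.integral_fst'[symmetric], rule integrable_weyl_symbol_kernel[OF fin _ F]) simp
  also have "\<dots> = (\<integral>a. m a *\<^sub>R (\<integral>b. m b *\<^sub>R ?K (a, b) \<partial>lborel) \<partial>lborel)"
    by (simp add: integral_density nn)
  also have "\<dots> = (\<integral>a. (\<integral>b. complex_of_real (m a * m b) * ?K (a, b) \<partial>lborel) \<partial>lborel)"
    by (simp add: scaleR_conv_of_real mult.assoc)
  also have "\<dots> = (\<integral>p. complex_of_real (m (fst p) * m (snd p)) * ?K p \<partial>lborel)"
    using lborel_pair.integral_fst'[OF mmK[folded lborel_prod]] by (simp add: lborel_prod)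
  also have "\<dots> = (\<integral>p. ?P (fst p) (snd p) * ?K (midpoint_map p) \<partial>lborel)"
    by (subst integral_midpoint_map[symmetric]) (simp_all add: midpoint_map_def)
  also have "\<dots> = (\<integral>s. (\<integral>r. ?P s r * ?K (midpoint_map (s, r)) \<partial>lborel) \<partial>lborel)"
    using lborel_pair.integral_fst'[OF PK[folded lborel_prod]] by (simp add: lborel_prod)
  also have "\<dots> = (\<integral>s. (\<integral>\<xi>. G s \<xi> * F (s, \<xi>) \<partial>lborel) \<partial>lborel)"
  proof (rule integral_cong_AE)
    show "(\<lambda>s. \<integral>r. ?P s r * ?K (midpoint_map (s, r)) \<partial>lborel) \<in> borel_measurable lborel" by measurable
    show "(\<lambda>s. \<integral>\<xi>. G s \<xi> * F (s, \<xi>) \<partial>lborel) \<in> borel_measurable lborel" unfolding G_def by measurable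
    \<comment> \<open>The density may be unbounded, and its product at s + r/2 and s - r/2 is known
      to be integrable in r for almost every s; for these s Fubini's theorem applies.\<close>
    have "AE s in lborel. integrable lborel (\<lambda>r. ?P s r)"
      using lborel_pair.AE_integrable_fst'[OF PP[folded lborel_prod]] by simp
    then show "AE s in lborel. (\<integral>r. ?P s r * ?K (midpoint_map (s, r)) \<partial>lborel) = (\<integral>\<xi>. G s \<xi> * F (s, \<xi>) \<partial>lborel)"
    proof eventually_elim
      case (elim s)
      let ?X = "\<lambda>r \<xi>. ?P s r * (F (s, \<xi>) * cis (- 2 * pi * (r \<bullet> \<xi>)))"
      have "integrable (lborel \<Otimes>\<^sub>M lborel) (case_prod ?X)"
      proof (rule integrable_pair_dominated[OF lborel.sigma_finite_measure_axioms lborel.sigma_finite_measure_axioms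
              _ integrable_norm[OF elim] integrable_mult_right[OF integrable_wt, of C]])
        show "norm (case_prod ?X (r, \<xi>)) \<le> norm (?P s r) * (C * wt \<xi>)" for r \<xi>
          by (simp add: norm_mult C mult_left_mono del: of_real_mult)
      qed simp
      from lborel_pair.Fubini_integral[OF this]
      have "(\<integral>r. (\<integral>\<xi>. ?X r \<xi> \<partial>lborel) \<partial>lborel) = (\<integral>\<xi>. (\<integral>r. ?X r \<xi> \<partial>lborel) \<partial>lborel)" by (rule sym)
      moreover have "(\<integral>\<xi>. ?X r \<xi> \<partial>lborel) = ?P s r * ?K (midpoint_map (s, r))" for r
        unfolding Kmid by (rule integral_mult_right_zero)
      moreover have "(\<integral>r. ?X r \<xi> \<partial>lborel) = G s \<xi> * F (s, \<xi>)" for \<xi>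
        unfolding G_def integral_mult_left_zero[symmetric] by (rule arg_cong[where f="integral\<^sup>L lborel"]) (simp add: mult_ac)
      ultimately show ?case by (simp only:)
    qed
  qed
  also have "\<dots> = (\<integral>p. G (fst p) (snd p) * F p \<partial>lborel)"
  proof -
    have [measurable]: "(\<lambda>p. G (fst p) (snd p)) \<in> borel_measurable (borel :: ('a \<times> 'a) measure)"
      unfolding G_def by measurable
    \<comment> \<open>An integrable majorant of G that is uniform in \<xi>; the decay of F in \<xi>
      supplies the other factor for Fubini's theorem in (s, \<xi>).\<close>
    define a where "a s = (\<integral>r. norm (?P s r) \<partial>lborel)" for s
    have a: "integrable lborel a"
      using lborel_pair.integrable_fst'[OF integrable_norm[OF PP, folded lborel_prod]] by (simp add: a_def[abs_def])
    have Gb: "norm (G s \<xi>) \<le> a s" for s \<xi>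
      unfolding G_def a_def by (rule order_trans[OF integral_norm_bound]) (simp add: norm_mult)
    have a0: "0 \<le> a s" for s unfolding a_def by simp
    have "integrable (lborel \<Otimes>\<^sub>M lborel) (\<lambda>p. G (fst p) (snd p) * F p)"
      by (rule integrable_pair_dominated[OF lborel.sigma_finite_measure_axioms lborel.sigma_finite_measure_axioms _ a integrable_mult_right[OF integrable_wt, of C]])
         (auto simp: lborel_prod norm_mult intro!: mult_mono Gb C a0)
    from lborel_pair.integral_fst'[OF this] show ?thesis by (simp add: lborel_prod)
  qed
  also have "\<dots> = function_distr (\<lambda>(s, \<xi>). G s \<xi>) F"
    by (simp add: function_distr_def case_prod_beta)
  finally show ?thesis by (simp add: G_def[abs_def])
qed

lemma wave_density_measurable [measurable]: "wave_density t \<in> borel_measurable borel"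
  unfolding wave_density_def[abs_def] by measurable

text \<open>Absorbs the case distinction on the dimension; the kernel lemmas that follow concern an
  arbitrary finite Borel measure.\<close>

lemma wave_wigner_integral_eq_pairing:
  fixes F :: "(real ^ 'd) \<times> (real ^ 'd) \<Rightarrow> complex"
  assumes d: "CARD('d) \<in> {1, 2, 3}" and t: "t > 0" and F: "slice_bounded F"
  shows "wave_wigner_integral t F = wigner_pairing (wave_measure t) F"
proof (cases "CARD('d) = 3")
  case True
  then show ?thesis
    using wigner_pairing_eq_distr[OF finite_wave_measure[OF d t] sets_wave_measure F] by (simp add: wave_wigner_integral_def)
next
  case False
  then have w: "wave_measure t = density lborel (\<lambda>y::real ^ 'd. ennreal (wave_density t y))" by (simp add: wave_measure_def)
  have "0 \<le> wave_density t y" for y :: "real ^ 'd"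
    using t by (auto simp: wave_density_def intro!: mult_nonneg_nonneg power_mono)
  from wigner_pairing_density[OF wave_density_measurable this finite_wave_measure[OF d t, unfolded w] F] False
  show ?thesis by (simp add: wave_wigner_integral_def w)
qed


section \<open>Seminorm bounds\<close>

lemma seminorm_le_sum:
  fixes f :: "'a::euclidean_space \<Rightarrow> complex"
  assumes f: "f \<in> schwartz" and k: "k \<le> N" "set vs \<subseteq> Basis" "length vs \<le> N"
  shows "schwartz_seminorm k vs f \<le> (\<Sum>k\<le>N. \<Sum>vs | set vs \<subseteq> Basis \<and> length vs \<le> N. schwartz_seminorm k vs f)"
proof -
  have nn: "0 \<le> schwartz_seminorm j ws f" if "ws \<in> {vs. set vs \<subseteq> Basis \<and> length vs \<le> N}" for j ws
    using that by (intro schwartz_seminorm_nonneg f) auto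
  have "schwartz_seminorm k vs f \<le> (\<Sum>vs | set vs \<subseteq> Basis \<and> length vs \<le> N. schwartz_seminorm k vs f)"
    using k by (intro member_le_sum finite_multi_indices nn) auto
  also have "\<dots> \<le> (\<Sum>k\<le>N. \<Sum>vs | set vs \<subseteq> Basis \<and> length vs \<le> N. schwartz_seminorm k vs f)"
    by (rule member_le_sum[of k "{..N}" "\<lambda>k. \<Sum>vs | set vs \<subseteq> Basis \<and> length vs \<le> N. schwartz_seminorm k vs f"])
       (use k in \<open>auto intro!: sum_nonneg nn\<close>)
  finally show ?thesis .
qed

abbreviation seminorm_sum :: "nat \<Rightarrow> ('a::euclidean_space \<Rightarrow> complex) \<Rightarrow> real" where
  "seminorm_sum N f \<equiv> \<Sum>k\<le>N. \<Sum>vs | set vs \<subseteq> Basis \<and> length vs \<le> N. schwartz_seminorm k vs f"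

lemma norm_le_seminorm_sum:
  assumes "f \<in> schwartz"
  shows "(1 + norm x) ^ N * norm (f x) \<le> 2 ^ (N + 1) * seminorm_sum N f"
proof -
  have "(1 + norm x) ^ N * norm (f x) \<le> (2 ^ N * (1 + norm x ^ N)) * norm (f x)"
    by (intro mult_right_mono one_plus_power_le) auto
  also have "\<dots> = 2 ^ N * (norm x ^ 0 * norm (iter_deriv [] f x) + norm x ^ N * norm (iter_deriv [] f x))"
    by (simp add: algebra_simps)
  also have "\<dots> \<le> 2 ^ N * (seminorm_sum N f + seminorm_sum N f)"
    by (intro mult_left_mono add_mono order_trans[OF le_schwartz_seminorm seminorm_le_sum] assms) auto
  finally show ?thesis by simp
qed

lemma seminorm_sum_nonneg: "f \<in> schwartz \<Longrightarrow> 0 \<le> seminorm_sum N f"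
  by (intro sum_nonneg schwartz_seminorm_nonneg) auto

lemma seminorm_sum_mono:
  fixes f :: "'a::euclidean_space \<Rightarrow> complex"
  assumes "f \<in> schwartz" "M \<le> N"
  shows "seminorm_sum M f \<le> seminorm_sum N f"
proof -
  have nn: "0 \<le> schwartz_seminorm j ws f" if "ws \<in> {vs. set vs \<subseteq> Basis \<and> length vs \<le> N}" for j ws
    using that by (intro schwartz_seminorm_nonneg assms) auto
  have "seminorm_sum M f \<le> (\<Sum>k\<le>M. \<Sum>vs | set vs \<subseteq> Basis \<and> length vs \<le> N. schwartz_seminorm k vs f)"
    using assms(2) by (intro sum_mono sum_mono2 finite_multi_indices) (auto intro: nn)
  also have "\<dots> \<le> seminorm_sum N f"
    using assms(2) by (intro sum_mono2) (auto intro!: sum_nonneg nn)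
  finally show ?thesis .
qed

lemma tempered_distribution_diff:
  assumes u: "tempered_distribution u" and v: "tempered_distribution v"
  shows "tempered_distribution (\<lambda>\<phi>. u \<phi> - v \<phi>)"
proof -
  obtain C N where C: "\<And>\<phi>. \<phi> \<in> schwartz \<Longrightarrow> norm (u \<phi>) \<le> C * seminorm_sum N \<phi>"
    using u unfolding tempered_distribution_def by blast
  obtain D M where D: "\<And>\<phi>. \<phi> \<in> schwartz \<Longrightarrow> norm (v \<phi>) \<le> D * seminorm_sum M \<phi>"
    using v unfolding tempered_distribution_def by blast
  have "norm (u \<phi> - v \<phi>) \<le> (\<bar>C\<bar> + \<bar>D\<bar>) * seminorm_sum (max M N) \<phi>" if \<phi>: "\<phi> \<in> schwartz" for \<phi>
  proof -
    have le: "A * seminorm_sum n \<phi> \<le> \<bar>A\<bar> * seminorm_sum (max M N) \<phi>" if "n \<le> max M N" for A n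
    proof -
      have "A * seminorm_sum n \<phi> \<le> \<bar>A\<bar> * seminorm_sum n \<phi>"
        by (intro mult_right_mono seminorm_sum_nonneg \<phi>) simp
      also have "\<dots> \<le> \<bar>A\<bar> * seminorm_sum (max M N) \<phi>"
        using that by (intro mult_left_mono seminorm_sum_mono \<phi>) simp_all
      finally show ?thesis .
    qed
    have "norm (u \<phi> - v \<phi>) \<le> norm (u \<phi>) + norm (v \<phi>)" by (rule norm_triangle_ineq4)
    also have "\<dots> \<le> \<bar>C\<bar> * seminorm_sum (max M N) \<phi> + \<bar>D\<bar> * seminorm_sum (max M N) \<phi>"
      by (intro add_mono order_trans[OF C le] order_trans[OF D le] \<phi>) simp_all
    finally show ?thesis by (simp only: distrib_right)
  qed
  moreover have "u (\<lambda>x. \<phi> x + \<psi> x) - v (\<lambda>x. \<phi> x + \<psi> x) = (u \<phi> - v \<phi>) + (u \<psi> - v \<psi>)"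
    if "\<phi> \<in> schwartz" "\<psi> \<in> schwartz" for \<phi> \<psi>
  proof -
    have "u (\<lambda>x. \<phi> x + \<psi> x) = u \<phi> + u \<psi>" "v (\<lambda>x. \<phi> x + \<psi> x) = v \<phi> + v \<psi>"
      using u v that unfolding tempered_distribution_def by blast+
    then show ?thesis by simp
  qed
  moreover have "u (\<lambda>x. c * \<phi> x) - v (\<lambda>x. c * \<phi> x) = c * (u \<phi> - v \<phi>)" if "\<phi> \<in> schwartz" for c \<phi>
  proof -
    have "u (\<lambda>x. c * \<phi> x) = c * u \<phi>" "v (\<lambda>x. c * \<phi> x) = c * v \<phi>"
      using u v that unfolding tempered_distribution_def by blast+
    then show ?thesis by (simp add: right_diff_distrib)
  qed
  ultimately show ?thesis unfolding tempered_distribution_def by blast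
qed

section \<open>Convolution with a finite measure as an operator into tempered distributions\<close>

context
  fixes \<mu> :: "'a::euclidean_space measure"
  assumes fin: "finite_measure \<mu>" and sets [measurable_cong]: "sets \<mu> = sets borel"
begin

interpretation finite_measure \<mu> by (rule fin)

lemma convolution_measurable:
  fixes f :: "'a \<Rightarrow> complex"
  assumes [measurable]: "f \<in> borel_measurable borel"
  shows "convolution_measure f \<mu> \<in> borel_measurable borel"
  unfolding convolution_measure_def[abs_def] by measurable

lemma convolution_integrable:
  fixes f :: "'a \<Rightarrow> complex"
  assumes [measurable]: "f \<in> borel_measurable borel" and B: "\<And>x. norm (f x) \<le> B"
  shows "integrable \<mu> (\<lambda>y. f (x - y))"
  by (rule integrable_const_bound[of _ B]) (use B in auto)

lemma convolution_bound:
  fixes f :: "'a \<Rightarrow> complex"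
  assumes f: "f \<in> borel_measurable borel" and B: "\<And>x. norm (f x) \<le> B"
  shows "norm (convolution_measure f \<mu> x) \<le> measure \<mu> UNIV * B"
proof -
  have sp: "space \<mu> = UNIV" using sets_eq_imp_space_eq[OF sets] by simp
  have "norm (convolution_measure f \<mu> x) \<le> (\<integral>y. norm (f (x - y)) \<partial>\<mu>)"
    unfolding convolution_measure_def by (rule integral_norm_bound)
  also have "\<dots> \<le> (\<integral>y. B \<partial>\<mu>)"
    by (rule integral_mono[OF integrable_norm[OF convolution_integrable[OF f B]]]) (simp_all add: B)
  finally show ?thesis by (simp add: sp)
qed

lemma schwartz_norm_le_seminorm_sum:
  fixes f :: "'a \<Rightarrow> complex"
  shows "f \<in> schwartz \<Longrightarrow> norm (f x) \<le> 2 * seminorm_sum 0 f"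
  using norm_le_seminorm_sum[of f x 0] by simp

text \<open>A single estimate, total mass times supremum of f times L1 norm of \<phi>, gives
  continuity in each argument: the L1 norm is bounded by seminorms when f is fixed, the supremum
  when \<phi> is fixed.\<close>

lemma continuous_linear_convolution:
  "continuous_linear_to_tempered (\<lambda>f. function_distr (convolution_measure f \<mu>))"
proof -
  have int: "integrable lborel (\<lambda>x. convolution_measure f \<mu> x * \<phi> x)"
    and bound: "norm (function_distr (convolution_measure f \<mu>) \<phi>) \<le> (measure \<mu> UNIV * (2 * seminorm_sum 0 f)) * (\<integral>x. norm (\<phi> x) \<partial>lborel)"
    if f: "f \<in> schwartz" and \<phi>: "\<phi> \<in> schwartz" for f \<phi>
  proof -
    note [measurable] = schwartz_measurable[OF f] schwartz_measurable[OF \<phi>] convolution_measurable[OF schwartz_measurable[OF f]]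
    let ?B = "measure \<mu> UNIV * (2 * seminorm_sum 0 f)"
    note i = integrable_norm[OF schwartz_integrable[OF \<phi>]]
    have le: "norm (convolution_measure f \<mu> x * \<phi> x) \<le> ?B * norm (\<phi> x)" for x
      unfolding norm_mult
      by (intro mult_right_mono convolution_bound schwartz_norm_le_seminorm_sum[OF f]) (simp_all add: schwartz_measurable[OF f])
    have le': "norm (convolution_measure f \<mu> x * \<phi> x) \<le> norm (?B * norm (\<phi> x))" for x
      unfolding real_norm_def by (rule order_trans[OF le abs_ge_self])
    show int: "integrable lborel (\<lambda>x. convolution_measure f \<mu> x * \<phi> x)"
      by (rule Bochner_Integration.integrable_bound[OF integrable_mult_right[OF i, of ?B]]) (use le' in auto)
    have "norm (function_distr (convolution_measure f \<mu>) \<phi>) \<le> (\<integral>x. norm (convolution_measure f \<mu> x * \<phi> x) \<partial>lborel)"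
      unfolding function_distr_def by (rule integral_norm_bound)
    also have "\<dots> \<le> (\<integral>x. ?B * norm (\<phi> x) \<partial>lborel)"
      by (rule integral_mono[OF integrable_norm[OF int] integrable_mult_right[OF i] le])
    finally show "norm (function_distr (convolution_measure f \<mu>) \<phi>) \<le> ?B * (\<integral>x. norm (\<phi> x) \<partial>lborel)" by simp
  qed
  have l1: "(\<integral>x. norm (\<phi> x) \<partial>lborel) \<le> 2 ^ (2 * DIM('a) + 1) * seminorm_sum (2 * DIM('a)) \<phi> * (\<integral>x. wt (x::'a) \<partial>lborel)"
    if \<phi>: "\<phi> \<in> schwartz" for \<phi> :: "'a \<Rightarrow> complex"
  proof -
    let ?S = "2 ^ (2 * DIM('a) + 1) * seminorm_sum (2 * DIM('a)) \<phi>"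
    have "norm (\<phi> x) \<le> ?S * wt x" for x
    proof -
      have "norm (\<phi> x) * 1 \<le> norm (\<phi> x) * (wt x * (1 + norm x) ^ (2 * DIM('a)))"
        by (intro mult_left_mono le_wt) simp
      also have "\<dots> = ((1 + norm x) ^ (2 * DIM('a)) * norm (\<phi> x)) * wt x" by simp
      also have "\<dots> \<le> ?S * wt x" by (intro mult_right_mono norm_le_seminorm_sum \<phi> wt_nonneg)
      finally show ?thesis by simp
    qed
    then have "(\<integral>x. norm (\<phi> x) \<partial>lborel) \<le> (\<integral>x. ?S * wt (x::'a) \<partial>lborel)"
      by (rule integral_mono[OF integrable_norm[OF schwartz_integrable[OF \<phi>]] integrable_mult_right[OF integrable_wt]])
    then show ?thesis by simp
  qed
  show ?thesis unfolding continuous_linear_to_tempered_def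
  proof (intro conjI ballI)
    fix f :: "'a \<Rightarrow> complex" assume f: "f \<in> schwartz"
    let ?B = "measure \<mu> UNIV * (2 * seminorm_sum 0 f)"
    have B: "0 \<le> ?B" by (intro mult_nonneg_nonneg seminorm_sum_nonneg f) simp_all
    have "norm (function_distr (convolution_measure f \<mu>) \<phi>) \<le>
        (?B * (2 ^ (2 * DIM('a) + 1) * (\<integral>x. wt (x::'a) \<partial>lborel))) * seminorm_sum (2 * DIM('a)) \<phi>" if \<phi>: "\<phi> \<in> schwartz" for \<phi>
      using order_trans[OF bound[OF f \<phi>] mult_left_mono[OF l1[OF \<phi>] B]] by (simp only: mult_ac)
    moreover have "function_distr (convolution_measure f \<mu>) (\<lambda>x. \<phi> x + \<psi> x)
        = function_distr (convolution_measure f \<mu>) \<phi> + function_distr (convolution_measure f \<mu>) \<psi>"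
      if "\<phi> \<in> schwartz" "\<psi> \<in> schwartz" for \<phi> \<psi>
      unfolding function_distr_def distrib_left by (intro Bochner_Integration.integral_add int f that)
    moreover have "function_distr (convolution_measure f \<mu>) (\<lambda>x. c * \<phi> x) = c * function_distr (convolution_measure f \<mu>) \<phi>" for c \<phi>
      by (simp add: function_distr_def mult.left_commute)
    ultimately show "tempered_distribution (function_distr (convolution_measure f \<mu>))"
      unfolding tempered_distribution_def by blast
  next
    fix \<phi> :: "'a \<Rightarrow> complex" assume \<phi>: "\<phi> \<in> schwartz"
    have conv_int: "integrable \<mu> (\<lambda>y. f (x - y))" if "f \<in> schwartz" for f x
      by (rule convolution_integrable[OF schwartz_measurable[OF that] schwartz_norm_le_seminorm_sum[OF that]])
    have "norm (function_distr (convolution_measure f \<mu>) \<phi>) \<le>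
        (measure \<mu> UNIV * 2 * (\<integral>x. norm (\<phi> x) \<partial>lborel)) * seminorm_sum 0 f" if f: "f \<in> schwartz" for f
      using bound[OF f \<phi>] by (simp only: mult_ac)
    moreover have "function_distr (convolution_measure (\<lambda>x. f x + g x) \<mu>) \<phi>
        = function_distr (convolution_measure f \<mu>) \<phi> + function_distr (convolution_measure g \<mu>) \<phi>"
      if f: "f \<in> schwartz" and g: "g \<in> schwartz" for f g
    proof -
      have "convolution_measure (\<lambda>x. f x + g x) \<mu> = (\<lambda>x. convolution_measure f \<mu> x + convolution_measure g \<mu> x)"
        unfolding convolution_measure_def[abs_def] by (rule ext) (rule Bochner_Integration.integral_add[OF conv_int[OF f] conv_int[OF g]])
      then show ?thesis unfolding function_distr_def by (simp add: distrib_right int f g \<phi>)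
    qed
    moreover have "function_distr (convolution_measure (\<lambda>x. c * f x) \<mu>) \<phi> = c * function_distr (convolution_measure f \<mu>) \<phi>" for c f
      by (simp add: function_distr_def convolution_measure_def mult.assoc)
    ultimately show "tempered_distribution (\<lambda>f. function_distr (convolution_measure f \<mu>) \<phi>)"
      unfolding tempered_distribution_def by blast
  qed
qed

end

text \<open>The test function that \<open>delta_kernel F\<close> hands to \<open>F\<close>, named so
  that bounds can be stated for it.\<close>

definition diagonal_slice :: "(('a::euclidean_space \<times> 'a) \<times> ('a \<times> 'a) \<Rightarrow> complex) \<Rightarrow> 'a \<times> 'a \<Rightarrow> complex" where
  "diagonal_slice \<Phi> = (\<lambda>(s, \<xi>). \<integral>y. \<Phi> ((y + s, \<xi>), (y, \<xi>)) \<partial>lborel)"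

lemma diagonal_slice_measurable:
  fixes \<Phi> :: "('a::euclidean_space \<times> 'a) \<times> ('a \<times> 'a) \<Rightarrow> complex"
  assumes [measurable]: "\<Phi> \<in> borel_measurable borel"
  shows "diagonal_slice \<Phi> \<in> borel_measurable borel"
  unfolding diagonal_slice_def case_prod_beta by measurable

text \<open>Decay of order \<open>4 * DIM('a)\<close> is split evenly: one half pays for a weight in
  y, which makes the integral converge, the other for the weight in \<xi> that remains. Since the
  constant is a seminorm sum, the bound also yields continuity of the kernel.\<close>

lemma
  fixes \<Phi> :: "('a::euclidean_space \<times> 'a) \<times> ('a \<times> 'a) \<Rightarrow> complex"
  assumes \<Phi>: "\<Phi> \<in> schwartz"
  defines "S \<equiv> 2 ^ (4 * DIM('a) + 1) * seminorm_sum (4 * DIM('a)) \<Phi>"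
  shows diagonal_slice_integrable: "integrable lborel (\<lambda>y. \<Phi> ((y + s, \<xi>), (y, \<xi>)))"
    and diagonal_slice_bound: "norm (diagonal_slice \<Phi> (s, \<xi>)) \<le> (S * (\<integral>y. wt (y::'a) \<partial>lborel)) * wt \<xi>"
proof -
  note [measurable] = schwartz_measurable[OF \<Phi>]
  have le: "norm (\<Phi> ((y + s, \<xi>), (y, \<xi>))) \<le> (S * wt \<xi>) * wt y" for y
  proof -
    let ?p = "((y + s, \<xi>), (y, \<xi>))" and ?n = "DIM('a)"
    have ny: "norm y \<le> norm ?p" and nx: "norm \<xi> \<le> norm ?p"
      using norm_Pair_ge(2)[of "(y, \<xi>)" "(y + s, \<xi>)"] norm_Pair_ge(1)[of y \<xi>] norm_Pair_ge(2)[of \<xi> y] by linarith+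
    have 1: "1 \<le> wt y * (1 + norm ?p) ^ (2 * ?n)"
      by (rule order_trans[OF le_wt[of y]]) (intro mult_left_mono power_mono, use ny in \<open>auto simp: wt_nonneg\<close>)
    have 2: "1 \<le> wt \<xi> * (1 + norm ?p) ^ (2 * ?n)"
      by (rule order_trans[OF le_wt[of \<xi>]]) (intro mult_left_mono power_mono, use nx in \<open>auto simp: wt_nonneg\<close>)
    have "1 * 1 \<le> (wt y * (1 + norm ?p) ^ (2 * ?n)) * (wt \<xi> * (1 + norm ?p) ^ (2 * ?n))"
      by (rule mult_mono[OF 1 2]) (simp_all add: wt_nonneg)
    then have "norm (\<Phi> ?p) * 1 \<le> norm (\<Phi> ?p) * ((wt y * (1 + norm ?p) ^ (2 * ?n)) * (wt \<xi> * (1 + norm ?p) ^ (2 * ?n)))"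
      by (intro mult_left_mono) simp_all
    also have "\<dots> = ((1 + norm ?p) ^ (4 * ?n) * norm (\<Phi> ?p)) * (wt \<xi> * wt y)"
      by (simp add: mult_ac flip: power_add)
    also have "\<dots> \<le> S * (wt \<xi> * wt y)"
      unfolding S_def by (intro mult_right_mono norm_le_seminorm_sum \<Phi> mult_nonneg_nonneg wt_nonneg)
    finally show ?thesis by (simp add: mult_ac)
  qed
  have le': "norm (\<Phi> ((y + s, \<xi>), (y, \<xi>))) \<le> norm ((S * wt \<xi>) * wt y)" for y
    unfolding real_norm_def by (rule order_trans[OF le abs_ge_self])
  show int: "integrable lborel (\<lambda>y. \<Phi> ((y + s, \<xi>), (y, \<xi>)))"
    by (rule Bochner_Integration.integrable_bound[OF integrable_mult_right[OF integrable_wt, of "S * wt \<xi>"]])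
       (use le' in auto)
  have "norm (diagonal_slice \<Phi> (s, \<xi>)) \<le> (\<integral>y. norm (\<Phi> ((y + s, \<xi>), (y, \<xi>))) \<partial>lborel)"
    unfolding diagonal_slice_def prod.case by (rule integral_norm_bound)
  also have "\<dots> \<le> (\<integral>y. (S * wt \<xi>) * wt (y::'a) \<partial>lborel)"
    by (rule integral_mono[OF integrable_norm[OF int] integrable_mult_right[OF integrable_wt] le])
  finally show "norm (diagonal_slice \<Phi> (s, \<xi>)) \<le> (S * (\<integral>y. wt (y::'a) \<partial>lborel)) * wt \<xi>"
    by (simp add: mult_ac)
qed

lemma slice_bounded_diagonal_slice:
  assumes "\<Phi> \<in> schwartz"
  shows "slice_bounded (diagonal_slice \<Phi>)"
  unfolding slice_bounded_def
proof (intro conjI exI allI)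
  show "diagonal_slice \<Phi> \<in> borel_measurable borel"
    by (rule diagonal_slice_measurable[OF schwartz_measurable[OF assms]])
qed (rule diagonal_slice_bound[OF assms])

lemma tempered_wigner_pairing:
  fixes \<mu> :: "'a::euclidean_space measure"
  assumes \<mu>: "finite_measure \<mu>" "sets \<mu> = sets borel"
  shows "tempered_distribution (\<lambda>\<Phi>. wigner_pairing \<mu> (diagonal_slice \<Phi>))"
proof -
  let ?I = "\<integral>y. wt (y::'a) \<partial>lborel"
  have "norm (wigner_pairing \<mu> (diagonal_slice \<Phi>)) \<le>
      (2 ^ (4 * DIM('a) + 1) * ?I * (?I * measure (\<mu> \<Otimes>\<^sub>M \<mu>) UNIV)) * seminorm_sum (4 * DIM('a)) \<Phi>"
    if \<Phi>: "\<Phi> \<in> schwartz" for \<Phi>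
    using wigner_pairing_bound[OF \<mu> diagonal_slice_measurable[OF schwartz_measurable[OF \<Phi>]] diagonal_slice_bound[OF \<Phi>]]
    by (simp only: mult_ac)
  moreover have "wigner_pairing \<mu> (diagonal_slice (\<lambda>p. \<Phi> p + \<Psi> p))
      = wigner_pairing \<mu> (diagonal_slice \<Phi>) + wigner_pairing \<mu> (diagonal_slice \<Psi>)"
    if \<Phi>: "\<Phi> \<in> schwartz" and \<Psi>: "\<Psi> \<in> schwartz" for \<Phi> \<Psi>
  proof -
    have "diagonal_slice (\<lambda>p. \<Phi> p + \<Psi> p) = (\<lambda>p. diagonal_slice \<Phi> p + diagonal_slice \<Psi> p)"
      unfolding diagonal_slice_def case_prod_beta
      by (intro ext Bochner_Integration.integral_add diagonal_slice_integrable \<Phi> \<Psi>)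
    then show ?thesis
      using wigner_pairing_add[OF \<mu> slice_bounded_diagonal_slice[OF \<Phi>] slice_bounded_diagonal_slice[OF \<Psi>]] by simp
  qed
  moreover have "wigner_pairing \<mu> (diagonal_slice (\<lambda>p. c * \<Phi> p)) = c * wigner_pairing \<mu> (diagonal_slice \<Phi>)" for c \<Phi>
  proof -
    have "diagonal_slice (\<lambda>p. c * \<Phi> p) = (\<lambda>p. c * diagonal_slice \<Phi> p)"
      by (rule ext) (simp add: diagonal_slice_def case_prod_beta)
    then show ?thesis by (simp only: wigner_pairing_cmult[OF \<mu>])
  qed
  ultimately show ?thesis unfolding tempered_distribution_def by blast
qed


section \<open>The Wigner kernel\<close>

lemma cnj_measurable [measurable (raw)]:
  "f \<in> borel_measurable M \<Longrightarrow> (\<lambda>x. cnj (f x)) \<in> borel_measurable M"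
  by (rule measurable_compose[OF _ borel_measurable_continuous_onI]) (auto intro!: continuous_intros)

lemma slice_bounded_schwartz:
  assumes "\<Phi> \<in> schwartz"
  shows "slice_bounded \<Phi>"
proof -
  obtain C where "\<And>x y. (1 + norm x) ^ 0 * norm (\<Phi> (x, y)) \<le> C * wt y"
    by (rule rapid_Pair_le_wt[OF schwartz_rapid[OF assms], where k=0]) blast
  then show ?thesis unfolding slice_bounded_def using schwartz_measurable[OF assms] by auto
qed

text \<open>The first claim rests on a majorant of W(f, g)(y, \<xi>) that is integrable in y and
  uniform in \<xi>. For the second, W(f, g) is expanded as an integral over r. The phases of r and a
  - b combine, and (y, r) becomes the point p = (a + y + r/2, b + y - r/2) with mean y + (a + b)/2
  and difference r + a - b; integrating over \<xi> first leaves the kernel of \<Phi> at p.\<close>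

lemma
  fixes f g :: "'a::euclidean_space \<Rightarrow> complex"
  assumes f: "f \<in> schwartz" and g: "g \<in> schwartz" and \<Phi>: "\<Phi> \<in> schwartz"
  defines "F \<equiv> diagonal_slice (\<lambda>(z, w). \<Phi> z * cross_wigner f g w)"
  shows slice_bounded_wigner: "slice_bounded F"
    and weyl_symbol_kernel_wigner: "weyl_symbol_kernel F (a, b)
      = (\<integral>p. f (fst p - a) * cnj (g (snd p - b)) * weyl_symbol_kernel \<Phi> p \<partial>lborel)"
proof -
  let ?h0 = "\<lambda>p. f (fst p) * cnj (g (snd p))"
  have h0: "?h0 \<in> schwartz" by (rule schwartz_tensor[OF f schwartz_cnj[OF g]])
  note [measurable] = schwartz_measurable[OF f] schwartz_measurable[OF g] schwartz_measurable[OF \<Phi>]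
  obtain C where C: "C > 0" "\<And>x \<xi>. norm (\<Phi> (x, \<xi>)) \<le> C * wt \<xi>"
    using rapid_Pair_le_wt[OF schwartz_rapid[OF \<Phi>], where k=0] by auto
  let ?W = "cross_wigner f g"
  have W: "?W (y, \<xi>) = (\<integral>r. ?h0 (midpoint_map (y, r)) * cis (- 2 * pi * (r \<bullet> \<xi>)) \<partial>lborel)" for y \<xi>
    by (simp add: cross_wigner_def midpoint_map_def)
  have Wm [measurable]: "?W \<in> borel_measurable borel"
    unfolding cross_wigner_def case_prod_beta by measurable
  have hm: "integrable lborel (\<lambda>p. ?h0 (midpoint_map p))"
    by (subst integrable_midpoint_map) (use schwartz_integrable[OF h0] in simp_all)
  define A where "A y = (\<integral>r. norm (?h0 (midpoint_map (y, r))) \<partial>lborel)" for y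
  have A: "integrable lborel A"
    using lborel_pair.integrable_fst'[OF integrable_norm[OF hm, folded lborel_prod]] by (simp add: A_def[abs_def])
  have WA: "norm (?W (y, \<xi>)) \<le> A y" for y \<xi>
    unfolding W A_def by (rule order_trans[OF integral_norm_bound]) (simp add: norm_mult)
  have Fdef: "F (s, \<xi>) = (\<integral>y. \<Phi> (y + s, \<xi>) * ?W (y, \<xi>) \<partial>lborel)" for s \<xi>
    by (simp add: F_def diagonal_slice_def)
  have le: "norm (\<Phi> (y + s, \<xi>) * ?W (y, \<xi>)) \<le> (C * wt \<xi>) * A y" for y s \<xi>
    unfolding norm_mult using C(1) by (intro mult_mono C WA mult_nonneg_nonneg wt_nonneg) simp_all
  show "slice_bounded F" unfolding slice_bounded_def
  proof (intro conjI exI allI)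
    show "F \<in> borel_measurable borel"
      unfolding F_def by (rule diagonal_slice_measurable) (unfold case_prod_beta, measurable)
    fix s \<xi>
    have i: "integrable lborel (\<lambda>y. \<Phi> (y + s, \<xi>) * ?W (y, \<xi>))"
    proof (rule Bochner_Integration.integrable_bound[OF integrable_mult_right[OF A, of "C * wt \<xi>"]])
      show "AE y in lborel. norm (\<Phi> (y + s, \<xi>) * ?W (y, \<xi>)) \<le> norm ((C * wt \<xi>) * A y)"
        unfolding real_norm_def by (intro AE_I2 order_trans[OF le abs_ge_self])
    qed simp
    have "norm (F (s, \<xi>)) \<le> (\<integral>y. norm (\<Phi> (y + s, \<xi>) * ?W (y, \<xi>)) \<partial>lborel)"
      unfolding Fdef by (rule integral_norm_bound)
    also have "\<dots> \<le> (\<integral>y. (C * wt \<xi>) * A y \<partial>lborel)"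
      by (rule integral_mono[OF integrable_norm[OF i] integrable_mult_right[OF A] le])
    finally show "norm (F (s, \<xi>)) \<le> (C * (\<integral>y. A y \<partial>lborel)) * wt \<xi>" by (simp add: mult_ac)
  qed
  let ?H = "\<lambda>\<xi> p. \<Phi> ((1/2) *\<^sub>R (fst p + snd p), \<xi>) * (f (fst p - a) * cnj (g (snd p - b))) * cis (- 2 * pi * ((fst p - snd p) \<bullet> \<xi>))"
  have sh: "(\<lambda>p. f (fst p - a) * cnj (g (snd p - b))) \<in> schwartz"
    using schwartz_affine[OF h0, of "\<lambda>p. p" "- (a, b)"] by (simp add: linear_iff)
  have inner: "F ((1/2) *\<^sub>R (a + b), \<xi>) * cis (- 2 * pi * ((a - b) \<bullet> \<xi>)) = (\<integral>p. ?H \<xi> p \<partial>lborel)" for \<xi>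
  proof -
    \<comment> \<open>The integrand before translation: at \<open>midpoint_map (y, r)\<close> it
      contains the integrand of W(f, g), and at p - (a, b) it equals
      \<open>?H \<xi> p\<close>.\<close>
    define h where "h p = \<Phi> ((1/2) *\<^sub>R (fst p + snd p) + (1/2) *\<^sub>R (a + b), \<xi>) * ?h0 p * cis (- 2 * pi * ((fst p - snd p + (a - b)) \<bullet> \<xi>))" for p
    have hmeas [measurable]: "h \<in> borel_measurable borel" unfolding h_def by measurable
    have hint: "integrable lborel h"
    proof (rule Bochner_Integration.integrable_bound[OF integrable_mult_right[OF schwartz_integrable[OF h0], of "of_real (C * wt \<xi>)"]])
      show "AE p in lborel. norm (h p) \<le> norm (complex_of_real (C * wt \<xi>) * ?h0 p)"
        unfolding h_def norm_mult[of _ "cis _"] norm_mult[of "\<Phi> _"] norm_mult[of "complex_of_real _"] norm_cis mult_1_right norm_of_real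
        by (intro AE_I2 mult_right_mono order_trans[OF C(2) abs_ge_self]) simp
    qed simp
    have "F ((1/2) *\<^sub>R (a + b), \<xi>) * cis (- 2 * pi * ((a - b) \<bullet> \<xi>))
        = (\<integral>y. \<Phi> (y + (1/2) *\<^sub>R (a + b), \<xi>) * ?W (y, \<xi>) * cis (- 2 * pi * ((a - b) \<bullet> \<xi>)) \<partial>lborel)"
      unfolding Fdef by simp
    also have "\<dots> = (\<integral>y. (\<integral>r. h (midpoint_map (y, r)) \<partial>lborel) \<partial>lborel)"
    proof (rule Bochner_Integration.integral_cong[OF refl])
      fix y
      have "h (midpoint_map (y, r)) = (\<Phi> (y + (1/2) *\<^sub>R (a + b), \<xi>) * cis (- 2 * pi * ((a - b) \<bullet> \<xi>))) *
          (?h0 (midpoint_map (y, r)) * cis (- 2 * pi * (r \<bullet> \<xi>)))" for r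
      proof -
        have m: "(1/2) *\<^sub>R (fst (midpoint_map (y, r)) + snd (midpoint_map (y, r))) = y"
          "fst (midpoint_map (y, r)) - snd (midpoint_map (y, r)) = r"
          by (simp_all add: midpoint_map_def scaleR_2[symmetric] scaleR_add_left[symmetric])
        have "cis (- 2 * pi * ((r + (a - b)) \<bullet> \<xi>)) = cis (- 2 * pi * ((a - b) \<bullet> \<xi>)) * cis (- 2 * pi * (r \<bullet> \<xi>))"
          unfolding cis_mult by (rule arg_cong[where f=cis]) (simp add: inner_add_left algebra_simps)
        then show ?thesis unfolding h_def m by (simp only: mult_ac)
      qed
      then have "(\<integral>r. h (midpoint_map (y, r)) \<partial>lborel)
          = (\<Phi> (y + (1/2) *\<^sub>R (a + b), \<xi>) * cis (- 2 * pi * ((a - b) \<bullet> \<xi>))) * ?W (y, \<xi>)"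
        by (simp only: W integral_mult_right_zero)
      then show "\<Phi> (y + (1/2) *\<^sub>R (a + b), \<xi>) * ?W (y, \<xi>) * cis (- 2 * pi * ((a - b) \<bullet> \<xi>)) = (\<integral>r. h (midpoint_map (y, r)) \<partial>lborel)"
        by (simp only: mult_ac)
    qed
    also have "\<dots> = (\<integral>p. h (midpoint_map p) \<partial>lborel)"
      using lborel_pair.integral_fst'[of "\<lambda>p. h (midpoint_map p)"] integrable_midpoint_map[OF hmeas] hint by (simp add: lborel_prod)
    also have "\<dots> = (\<integral>p. h p \<partial>lborel)" by (rule integral_midpoint_map[OF hmeas])
    also have "\<dots> = (\<integral>p. h (- (a, b) + p) \<partial>lborel)"
      using integral_lborel_affine[OF hmeas, of 1 "- (a, b)"] by simp
    also have "\<dots> = (\<integral>p. ?H \<xi> p \<partial>lborel)"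
    proof (rule Bochner_Integration.integral_cong[OF refl])
      fix p :: "'a \<times> 'a"
      have "(1/2) *\<^sub>R (fst (- (a, b) + p) + snd (- (a, b) + p)) + (1/2) *\<^sub>R (a + b) = (1/2) *\<^sub>R (fst p + snd p)"
        by (simp add: algebra_simps)
      moreover have "fst (- (a, b) + p) - snd (- (a, b) + p) + (a - b) = fst p - snd p" by simp
      ultimately show "h (- (a, b) + p) = ?H \<xi> p" unfolding h_def by (simp only:) simp
    qed
    finally show ?thesis .
  qed
  have "integrable (lborel \<Otimes>\<^sub>M lborel) (case_prod ?H)"
  proof (rule integrable_pair_dominated[OF lborel.sigma_finite_measure_axioms lborel.sigma_finite_measure_axioms
        _ integrable_mult_right[OF integrable_wt, of C] integrable_norm[OF schwartz_integrable[OF sh]]])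
    show "norm (case_prod ?H (\<xi>, p)) \<le> C * wt \<xi> * norm (f (fst p - a) * cnj (g (snd p - b)))" for \<xi> p
      unfolding prod.case norm_mult[of _ "cis _"] norm_mult[of "\<Phi> _"] norm_cis mult_1_right
      by (intro mult_right_mono C) simp
    show "case_prod ?H \<in> borel_measurable (lborel \<Otimes>\<^sub>M lborel)"
      unfolding lborel_prod case_prod_beta by measurable
  qed
  from lborel_pair.Fubini_integral[OF this]
  have swap: "(\<integral>\<xi>. (\<integral>p. ?H \<xi> p \<partial>lborel) \<partial>lborel) = (\<integral>p. (\<integral>\<xi>. ?H \<xi> p \<partial>lborel) \<partial>lborel)" by (rule sym)
  have "weyl_symbol_kernel F (a, b) = (\<integral>\<xi>. (\<integral>p. ?H \<xi> p \<partial>lborel) \<partial>lborel)"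
    unfolding weyl_symbol_kernel_def fst_conv snd_conv inner ..
  also have "\<dots> = (\<integral>p. f (fst p - a) * cnj (g (snd p - b)) * weyl_symbol_kernel \<Phi> p \<partial>lborel)"
    unfolding swap weyl_symbol_kernel_def integral_mult_right_zero[symmetric]
    by (simp only: mult_ac)
  finally show "weyl_symbol_kernel F (a, b)
      = (\<integral>p. f (fst p - a) * cnj (g (snd p - b)) * weyl_symbol_kernel \<Phi> p \<partial>lborel)" .
qed

text \<open>\<open>weyl_symbol_kernel_wigner\<close> expresses the kernel at n = (a, b) through f
  and g translated by a and b; integrating n against the product measure turns the translates into
  convolutions. The work lies in justifying Fubini's theorem for n and p.\<close>

lemma wigner_pairing_convolution:
  fixes f g :: "'a::euclidean_space \<Rightarrow> complex"
  assumes \<mu>: "finite_measure \<mu>" "sets \<mu> = sets borel"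
    and f: "f \<in> schwartz" and g: "g \<in> schwartz" and \<Phi>: "\<Phi> \<in> schwartz"
  shows "wigner_distr (function_distr (convolution_measure f \<mu>)) (function_distr (convolution_measure g \<mu>)) \<Phi>
    = wigner_pairing \<mu> (diagonal_slice (\<lambda>(z, w). \<Phi> z * cross_wigner f g w))"
proof -
  let ?h0 = "\<lambda>p. f (fst p) * cnj (g (snd p))"
  have h0: "?h0 \<in> schwartz" by (rule schwartz_tensor[OF f schwartz_cnj[OF g]])
  note [measurable] = schwartz_measurable[OF f] schwartz_measurable[OF g] schwartz_measurable[OF \<Phi>]
  note [measurable_cong] = \<mu>(2)
  let ?K = "weyl_symbol_kernel \<Phi>"
  let ?N = "\<mu> \<Otimes>\<^sub>M \<mu>"
  have Km [measurable]: "?K \<in> borel_measurable borel" by measurable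
  obtain C where C: "\<And>s \<xi>. norm (\<Phi> (s, \<xi>)) \<le> C * wt \<xi>"
    using slice_bounded_schwartz[OF \<Phi>] unfolding slice_bounded_def by blast
  define B where "B = C * (\<integral>\<xi>. wt (\<xi>::'a) \<partial>lborel)"
  have B: "norm (?K p) \<le> B" for p
    unfolding B_def by (rule weyl_symbol_kernel_bound[OF schwartz_measurable[OF \<Phi>] C])
  interpret M: finite_measure \<mu> by (rule \<mu>(1))
  interpret MM: pair_sigma_finite \<mu> \<mu> ..
  interpret N: finite_measure ?N by (rule finite_measure_pair[OF \<mu>])
  interpret NL: pair_sigma_finite ?N "lborel :: ('a \<times> 'a) measure" ..
  note setsN = sets_pair[OF \<mu>]
  let ?X = "\<lambda>n p. f (fst p - fst n) * cnj (g (snd p - snd n)) * ?K p"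
  have sh: "(\<lambda>p. f (fst p - fst n) * cnj (g (snd p - snd n))) \<in> schwartz" for n
    using schwartz_affine[OF h0, of "\<lambda>p. p" "- n"] by (simp add: linear_iff)
  have Xm: "case_prod ?X \<in> borel_measurable (?N \<Otimes>\<^sub>M lborel)"
  proof -
    have "case_prod ?X \<in> borel_measurable (borel :: (('a \<times> 'a) \<times> ('a \<times> 'a)) measure)"
      unfolding case_prod_beta by measurable
    moreover have "sets (?N \<Otimes>\<^sub>M (lborel :: ('a \<times> 'a) measure)) = sets borel"
      by (subst borel_prod[symmetric]) (rule sets_pair_measure_cong[OF setsN sets_lborel])
    ultimately show ?thesis using measurable_cong_sets[OF _ refl] by blast
  qed
  have Xle: "norm (?X n p) \<le> \<bar>B\<bar> * norm (f (fst p - fst n) * cnj (g (snd p - snd n)))" for n p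
    unfolding norm_mult[of _ "?K p"] mult.commute[of "\<bar>B\<bar>"]
    by (intro mult_left_mono order_trans[OF B abs_ge_self]) simp
  have Xi: "integrable lborel (?X n)" for n
  proof (rule Bochner_Integration.integrable_bound[OF integrable_mult_right[OF integrable_norm[OF schwartz_integrable[OF sh]], of "\<bar>B\<bar>"]])
    show "AE p in lborel. norm (?X n p) \<le> norm (\<bar>B\<bar> * norm (f (fst p - fst n) * cnj (g (snd p - snd n))))"
      by (intro AE_I2 order_trans[OF Xle]) simp
  qed simp
  \<comment> \<open>By translation invariance the L1 norm in p has a bound independent of n, and a
    constant is integrable for the finite product measure.\<close>
  have X1: "(\<integral>p. norm (?X n p) \<partial>lborel) \<le> \<bar>B\<bar> * (\<integral>p. norm (?h0 p) \<partial>lborel)" for n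
  proof -
    have "(\<integral>p. norm (?X n p) \<partial>lborel) \<le> (\<integral>p. \<bar>B\<bar> * norm (f (fst p - fst n) * cnj (g (snd p - snd n))) \<partial>lborel)"
      by (rule integral_mono[OF integrable_norm[OF Xi] integrable_mult_right[OF integrable_norm[OF schwartz_integrable[OF sh]]] Xle])
    also have "\<dots> = \<bar>B\<bar> * (\<integral>p. norm (f (fst p - fst n) * cnj (g (snd p - snd n))) \<partial>lborel)" by simp
    also have "(\<integral>p. norm (f (fst p - fst n) * cnj (g (snd p - snd n))) \<partial>lborel) = (\<integral>p. norm (?h0 p) \<partial>lborel)"
    proof -
      have "integral\<^sup>L (distr lborel borel ((+) (- n))) (\<lambda>p. norm (?h0 p)) = (\<integral>p. norm (?h0 (- n + p)) \<partial>lborel)"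
        by (rule integral_distr) simp_all
      then show ?thesis by (simp add: lborel_distr_plus)
    qed
    finally show ?thesis .
  qed
  have X: "integrable (?N \<Otimes>\<^sub>M lborel) (case_prod ?X)"
  proof (rule NL.Fubini_integrable[OF Xm])
    show "integrable ?N (\<lambda>n. \<integral>p. norm (case_prod ?X (n, p)) \<partial>lborel)"
    proof (rule N.integrable_const_bound)
      show "AE n in ?N. norm (\<integral>p. norm (case_prod ?X (n, p)) \<partial>lborel) \<le> \<bar>B\<bar> * (\<integral>p. norm (?h0 p) \<partial>lborel)"
        using X1 by simp
      show "(\<lambda>n. \<integral>p. norm (case_prod ?X (n, p)) \<partial>lborel) \<in> borel_measurable ?N"
        using Xm by (intro lborel.borel_measurable_lebesgue_integral) (simp add: case_prod_beta)
    qed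
    show "AE n in ?N. integrable lborel (\<lambda>p. case_prod ?X (n, p))" using Xi by simp
  qed
  have inner: "(\<integral>n. ?X n p \<partial>?N) = convolution_measure f \<mu> (fst p) * (cnj (convolution_measure g \<mu> (snd p)) * ?K p)" for p
  proof -
    obtain Bf where Bf: "\<And>x. norm (f x) \<le> Bf" using rapidE[OF schwartz_rapid[OF f], where k=0] by auto
    obtain Bg where Bg: "\<And>x. norm (g x) \<le> Bg" using rapidE[OF schwartz_rapid[OF g], where k=0] by auto
    have "integrable ?N (\<lambda>n. f (fst p - fst n) * cnj (g (snd p - snd n)))"
    proof (rule integrable_pair_bounded[OF \<mu>, of _ "Bf * Bg"])
      show "norm (f (fst p - fst n) * cnj (g (snd p - snd n))) \<le> Bf * Bg" for n
        unfolding norm_mult complex_mod_cnj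
        using order_trans[OF norm_ge_zero Bf] by (intro mult_mono Bf Bg) auto
    qed measurable
    from MM.integral_fst'[OF this]
    have "(\<integral>n. f (fst p - fst n) * cnj (g (snd p - snd n)) \<partial>?N)
        = convolution_measure f \<mu> (fst p) * cnj (convolution_measure g \<mu> (snd p))"
      by (simp add: convolution_measure_def)
    then show ?thesis unfolding integral_mult_left_zero by (simp only: mult.assoc)
  qed
  have int: "integrable lborel (\<lambda>p. convolution_measure f \<mu> (fst p) * (cnj (convolution_measure g \<mu> (snd p)) * ?K p))"
    using NL.integrable_snd[OF X] by (simp only: inner)
  have "wigner_pairing \<mu> (diagonal_slice (\<lambda>(z, w). \<Phi> z * cross_wigner f g w)) = (\<integral>n. (\<integral>p. ?X n p \<partial>lborel) \<partial>?N)"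
    unfolding wigner_pairing_def
  proof (rule Bochner_Integration.integral_cong[OF refl])
    fix n :: "'a \<times> 'a"
    show "weyl_symbol_kernel (diagonal_slice (\<lambda>(z, w). \<Phi> z * cross_wigner f g w)) n = (\<integral>p. ?X n p \<partial>lborel)"
      using weyl_symbol_kernel_wigner[OF f g \<Phi>, of "fst n" "snd n"] by (simp only: prod.collapse)
  qed
  also have "\<dots> = (\<integral>p. (\<integral>n. ?X n p \<partial>?N) \<partial>lborel)"
    by (rule NL.Fubini_integral[OF X, symmetric])
  also have "\<dots> = (\<integral>a. (\<integral>b. convolution_measure f \<mu> a * (cnj (convolution_measure g \<mu> b) * ?K (a, b)) \<partial>lborel) \<partial>lborel)"
    unfolding inner using lborel_pair.integral_fst'[OF int[folded lborel_prod]] by (simp add: lborel_prod)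
  also have "\<dots> = wigner_distr (function_distr (convolution_measure f \<mu>)) (function_distr (convolution_measure g \<mu>)) \<Phi>"
  proof -
    have "wigner_distr (function_distr (convolution_measure f \<mu>)) (function_distr (convolution_measure g \<mu>)) \<Phi>
        = (\<integral>a. convolution_measure f \<mu> a * cnj (\<integral>b. convolution_measure g \<mu> b * cnj (?K (a, b)) \<partial>lborel) \<partial>lborel)"
      by (simp add: wigner_distr_def tensor_distr_def cnj_distr_def function_distr_def weyl_symbol_kernel_def)
    moreover have "cnj (\<integral>b. convolution_measure g \<mu> b * cnj (?K (a, b)) \<partial>lborel)
        = (\<integral>b. cnj (convolution_measure g \<mu> b) * ?K (a, b) \<partial>lborel)" for a
      by (subst Bochner_Integration.integral_cnj[symmetric]) simp
    ultimately show ?thesis by (simp only: integral_mult_right_zero)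
  qed
  finally show ?thesis by (rule sym)
qed

section \<open>Uniqueness of the kernel\<close>

lemma schwartz_gaussian_modulated:
  "a > 0 \<Longrightarrow> (\<lambda>p::'a::euclidean_space. of_real (exp (- pi * a * (norm (p - c))\<^sup>2)) * cis (2 * pi * (p \<bullet> l))) \<in> schwartz"
  using schwartz_cis_mult[OF schwartz_gaussian_affine[of a c], of "2 * pi" l] by (simp add: mult.commute)

text \<open>For two time-frequency shifts of one Gaussian, the mean of the shift parameters becomes
  the centre of the Wigner distribution and their difference becomes its modulation, so centre and
  modulation can be prescribed independently.\<close>

lemma cross_wigner_gaussian_shifts:
  fixes x0 \<xi>0 \<beta> \<gamma> :: "'a::euclidean_space"
  obtains f g \<kappa> where "f \<in> schwartz" "g \<in> schwartz" "\<kappa> \<noteq> 0"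
    "\<And>w. cross_wigner f g w = \<kappa> * (of_real (exp (- 2 * pi * (norm (w - (x0, \<xi>0)))\<^sup>2)) * cis (2 * pi * (w \<bullet> (\<beta>, \<gamma>))))"
proof -
  define G where "G c l p = complex_of_real (exp (- pi * 1 * (norm (p - c))\<^sup>2)) * cis (2 * pi * (p \<bullet> l))" for c l p :: 'a
  have G: "G c l \<in> schwartz" for c l unfolding G_def[abs_def] by (rule schwartz_gaussian_modulated) simp
  \<comment> \<open>Positions have mean x0 and frequencies have mean \<xi>0. The difference \<beta>
    of the frequencies produces the modulation in x, the difference - \<gamma> of the positions the
    one in \<xi>.\<close>
  let ?f = "G (x0 - (1/2) *\<^sub>R \<gamma>) (\<xi>0 + (1/2) *\<^sub>R \<beta>)" and ?g = "G (x0 + (1/2) *\<^sub>R \<gamma>) (\<xi>0 - (1/2) *\<^sub>R \<beta>)"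
  define \<kappa> where "\<kappa> = cis (- 2 * pi * (\<gamma> \<bullet> \<xi>0)) * of_real (1 / sqrt (1/2) ^ DIM('a))"
  have "cross_wigner ?f ?g (x, \<xi>) = \<kappa> * (of_real (exp (- 2 * pi * (norm ((x, \<xi>) - (x0, \<xi>0)))\<^sup>2)) * cis (2 * pi * ((x, \<xi>) \<bullet> (\<beta>, \<gamma>))))" for x \<xi>
  proof -
    define E where "E = complex_of_real (exp (- 2 * pi * (norm (x - x0))\<^sup>2)) * cis (2 * pi * (x \<bullet> \<beta>))"
    define J where "J y = complex_of_real (exp (- pi * (1/2) * (norm (y + \<gamma>))\<^sup>2)) * cis (2 * pi * (y \<bullet> (\<xi>0 - \<xi>)))" for y
    have "?f (x + (1/2) *\<^sub>R y) * cnj (?g (x - (1/2) *\<^sub>R y)) * cis (- 2 * pi * (y \<bullet> \<xi>)) = E * J y" for y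
    proof -
      define u v where "u = x - x0" and "v = (1/2) *\<^sub>R (y + \<gamma>)"
      have 1: "x + (1/2) *\<^sub>R y - (x0 - (1/2) *\<^sub>R \<gamma>) = u + v" "x - (1/2) *\<^sub>R y - (x0 + (1/2) *\<^sub>R \<gamma>) = u - v"
        by (simp_all add: u_def v_def algebra_simps)
      \<comment> \<open>The parallelogram law separates the Gaussian in x from the Gaussian in
        y.\<close>
      have "(norm (u + v))\<^sup>2 + (norm (u - v))\<^sup>2 = 2 * (norm u)\<^sup>2 + 2 * (norm v)\<^sup>2"
        unfolding power2_norm_eq_inner by (simp add: inner_add_left inner_add_right inner_diff_left inner_diff_right)
      also have "2 * (norm v)\<^sup>2 = (1/2) * (norm (y + \<gamma>))\<^sup>2"
        unfolding v_def norm_scaleR power_mult_distrib by (simp add: power2_eq_square)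
      finally have s: "(norm (u + v))\<^sup>2 + (norm (u - v))\<^sup>2 = 2 * (norm u)\<^sup>2 + (1/2) * (norm (y + \<gamma>))\<^sup>2" .
      have "- pi * 1 * (norm (u + v))\<^sup>2 + - pi * 1 * (norm (u - v))\<^sup>2 = - pi * ((norm (u + v))\<^sup>2 + (norm (u - v))\<^sup>2)"
        by (simp add: distrib_left)
      also have "\<dots> = - 2 * pi * (norm u)\<^sup>2 + - pi * (1/2) * (norm (y + \<gamma>))\<^sup>2"
        unfolding s by (simp add: distrib_left)
      finally have n: "- pi * 1 * (norm (u + v))\<^sup>2 + - pi * 1 * (norm (u - v))\<^sup>2
          = - 2 * pi * (norm u)\<^sup>2 + - pi * (1/2) * (norm (y + \<gamma>))\<^sup>2" .
      have e: "exp (- pi * 1 * (norm (u + v))\<^sup>2) * exp (- pi * 1 * (norm (u - v))\<^sup>2)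
          = exp (- 2 * pi * (norm u)\<^sup>2) * exp (- pi * (1/2) * (norm (y + \<gamma>))\<^sup>2)"
        unfolding exp_add[symmetric] n ..
      have c: "cis (2 * pi * ((x + (1/2) *\<^sub>R y) \<bullet> (\<xi>0 + (1/2) *\<^sub>R \<beta>))) *
          (cis (- (2 * pi * ((x - (1/2) *\<^sub>R y) \<bullet> (\<xi>0 - (1/2) *\<^sub>R \<beta>)))) * cis (- 2 * pi * (y \<bullet> \<xi>)))
          = cis (2 * pi * (x \<bullet> \<beta>)) * cis (2 * pi * (y \<bullet> (\<xi>0 - \<xi>)))"
        unfolding cis_mult by (rule arg_cong[where f=cis]) (simp add: inner_simps algebra_simps)
      have "?f (x + (1/2) *\<^sub>R y) * cnj (?g (x - (1/2) *\<^sub>R y)) * cis (- 2 * pi * (y \<bullet> \<xi>))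
        = of_real (exp (- pi * 1 * (norm (u + v))\<^sup>2) * exp (- pi * 1 * (norm (u - v))\<^sup>2)) *
          (cis (2 * pi * ((x + (1/2) *\<^sub>R y) \<bullet> (\<xi>0 + (1/2) *\<^sub>R \<beta>))) *
          (cis (- (2 * pi * ((x - (1/2) *\<^sub>R y) \<bullet> (\<xi>0 - (1/2) *\<^sub>R \<beta>)))) * cis (- 2 * pi * (y \<bullet> \<xi>))))"
        unfolding G_def 1 complex_cnj_mult complex_cnj_complex_of_real cis_cnj of_real_mult by (simp only: mult_ac)
      also have "\<dots> = E * J y"
        unfolding e c unfolding E_def J_def u_def of_real_mult by (simp only: mult_ac)
      finally show ?thesis .
    qed
    then have "cross_wigner ?f ?g (x, \<xi>) = (\<integral>y. E * J y \<partial>lborel)" unfolding cross_wigner_def prod.case by (simp only:)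
    also have "\<dots> = E * (\<integral>y. J y \<partial>lborel)" by simp
    \<comment> \<open>Centring the Gaussian in y releases a phase that holds both the modulation
      \<gamma> \<bullet> \<xi> and the constant phase of \<kappa>.\<close>
    also have "(\<integral>y. J y \<partial>lborel) = (\<integral>y. J (- \<gamma> + y) \<partial>lborel)"
      using integral_lborel_affine[of J 1 "- \<gamma>"] by (simp add: J_def[abs_def])
    also have "\<dots> = (\<integral>y. cis (- 2 * pi * (\<gamma> \<bullet> (\<xi>0 - \<xi>))) * (of_real (exp (- pi * (1/2) * (norm y)\<^sup>2)) * cis (2 * pi * (y \<bullet> (\<xi>0 - \<xi>)))) \<partial>lborel)"
    proof (rule Bochner_Integration.integral_cong[OF refl])
      fix y
      have c: "cis (2 * pi * ((- \<gamma> + y) \<bullet> (\<xi>0 - \<xi>))) = cis (- 2 * pi * (\<gamma> \<bullet> (\<xi>0 - \<xi>))) * cis (2 * pi * (y \<bullet> (\<xi>0 - \<xi>)))"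
        unfolding cis_mult by (rule arg_cong[where f=cis]) (simp add: inner_simps algebra_simps)
      show "J (- \<gamma> + y) = cis (- 2 * pi * (\<gamma> \<bullet> (\<xi>0 - \<xi>))) * (of_real (exp (- pi * (1/2) * (norm y)\<^sup>2)) * cis (2 * pi * (y \<bullet> (\<xi>0 - \<xi>))))"
        unfolding J_def c by simp
    qed
    \<comment> \<open>The parameter a = 1 / 2 doubles the exponent under the transform, so the
      Gaussian in \<xi> has the same constant 2 pi as the one in x and their product is isotropic on
      phase space.\<close>
    also have "\<dots> = cis (- 2 * pi * (\<gamma> \<bullet> (\<xi>0 - \<xi>))) * of_real (exp (- pi * (norm (\<xi>0 - \<xi>))\<^sup>2 / (1/2)) / sqrt (1/2) ^ DIM('a))"
      unfolding integral_mult_right_zero by (subst integral_gaussian_cis) simp_all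
    also have "E * \<dots> = \<kappa> * (of_real (exp (- 2 * pi * (norm ((x, \<xi>) - (x0, \<xi>0)))\<^sup>2)) * cis (2 * pi * ((x, \<xi>) \<bullet> (\<beta>, \<gamma>))))"
    proof -
      have c: "cis (2 * pi * (x \<bullet> \<beta>)) * cis (- 2 * pi * (\<gamma> \<bullet> (\<xi>0 - \<xi>))) = cis (- 2 * pi * (\<gamma> \<bullet> \<xi>0)) * cis (2 * pi * ((x, \<xi>) \<bullet> (\<beta>, \<gamma>)))"
        unfolding cis_mult by (rule arg_cong[where f=cis]) (simp add: inner_simps inner_commute algebra_simps)
      have n: "- 2 * pi * (norm (x - x0))\<^sup>2 + - pi * (norm (\<xi>0 - \<xi>))\<^sup>2 / (1/2) = - 2 * pi * (norm ((x, \<xi>) - (x0, \<xi>0)))\<^sup>2"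
        by (simp add: norm_Pair norm_minus_commute algebra_simps)
      have e: "exp (- 2 * pi * (norm (x - x0))\<^sup>2) * (exp (- pi * (norm (\<xi>0 - \<xi>))\<^sup>2 / (1/2)) / sqrt (1/2) ^ DIM('a))
          = (1 / sqrt (1/2) ^ DIM('a)) * exp (- 2 * pi * (norm ((x, \<xi>) - (x0, \<xi>0)))\<^sup>2)"
        unfolding n[symmetric] exp_add by simp
      have "E * (cis (- 2 * pi * (\<gamma> \<bullet> (\<xi>0 - \<xi>))) * of_real (exp (- pi * (norm (\<xi>0 - \<xi>))\<^sup>2 / (1/2)) / sqrt (1/2) ^ DIM('a)))
        = of_real (exp (- 2 * pi * (norm (x - x0))\<^sup>2) * (exp (- pi * (norm (\<xi>0 - \<xi>))\<^sup>2 / (1/2)) / sqrt (1/2) ^ DIM('a))) *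
          (cis (2 * pi * (x \<bullet> \<beta>)) * cis (- 2 * pi * (\<gamma> \<bullet> (\<xi>0 - \<xi>))))"
        unfolding E_def of_real_mult by (simp only: mult_ac)
      also have "\<dots> = \<kappa> * (of_real (exp (- 2 * pi * (norm ((x, \<xi>) - (x0, \<xi>0)))\<^sup>2)) * cis (2 * pi * ((x, \<xi>) \<bullet> (\<beta>, \<gamma>))))"
        unfolding e c unfolding \<kappa>_def of_real_mult by (simp only: mult_ac)
      finally show ?thesis .
    qed
    finally show ?thesis .
  qed
  then have "cross_wigner ?f ?g w = \<kappa> * (of_real (exp (- 2 * pi * (norm (w - (x0, \<xi>0)))\<^sup>2)) * cis (2 * pi * (w \<bullet> (\<beta>, \<gamma>))))" for w
    by (cases w) simp
  moreover have "\<kappa> \<noteq> 0" by (simp add: \<kappa>_def)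
  ultimately show ?thesis by (intro that[OF G G])
qed

text \<open>A Gaussian shift on the doubled phase space factors into one in z and one in w. The
  first serves as \<Phi>, the second is a multiple of some W(f, g), so two kernels with the same
  identity agree on the product; density extends this to all Schwartz functions.\<close>

lemma wigner_kernel_unique:
  fixes T :: "('a::euclidean_space \<Rightarrow> complex) \<Rightarrow> ('a \<Rightarrow> complex) \<Rightarrow> complex"
  assumes k: "tempered_distribution k" "wigner_kernel_identity T k"
    and k': "tempered_distribution k'" "wigner_kernel_identity T k'"
    and \<Psi>: "\<Psi> \<in> schwartz"
  shows "k' \<Psi> = k \<Psi>"
proof -
  have "k' \<Psi> - k \<Psi> = 0"
  proof (rule tempered_zero_if_gaussian_shifts[OF tempered_distribution_diff[OF k'(1) k(1)] _ \<Psi>])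
    fix c l :: "('a \<times> 'a) \<times> ('a \<times> 'a)"
    obtain c1 x0 \<xi>0 where c: "c = (c1, (x0, \<xi>0))" by (cases c) auto
    obtain l1 \<beta> \<gamma> where l: "l = (l1, (\<beta>, \<gamma>))" by (cases l) auto
    define \<Phi> where "\<Phi> z = complex_of_real (exp (- 2 * pi * (norm (z - c1))\<^sup>2)) * cis (2 * pi * (z \<bullet> l1))" for z :: "'a \<times> 'a"
    have \<Phi>: "\<Phi> \<in> schwartz" unfolding \<Phi>_def[abs_def] by (rule schwartz_gaussian_shift)
    obtain f g \<kappa> where fg: "f \<in> schwartz" "g \<in> schwartz" "\<kappa> \<noteq> 0" and
      W: "\<And>w. cross_wigner f g w = \<kappa> * (of_real (exp (- 2 * pi * (norm (w - (x0, \<xi>0)))\<^sup>2)) * cis (2 * pi * (w \<bullet> (\<beta>, \<gamma>))))"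
      by (rule cross_wigner_gaussian_shifts[of x0 \<xi>0 \<beta> \<gamma>]) (rule that, assumption+)
    let ?S = "\<lambda>p. complex_of_real (exp (- 2 * pi * (norm (p - c))\<^sup>2)) * cis (2 * pi * (p \<bullet> l))"
    have eq: "(\<lambda>(z, w). \<Phi> z * cross_wigner f g w) = (\<lambda>p. \<kappa> * ?S p)"
    proof (rule ext)
      fix p :: "('a \<times> 'a) \<times> ('a \<times> 'a)"
      let ?z = "fst p" and ?w = "snd p"
      have "(norm (p - c))\<^sup>2 = (norm (?z - c1))\<^sup>2 + (norm (?w - (x0, \<xi>0)))\<^sup>2"
        unfolding c using norm_Pair[of "?z - c1" "?w - (x0, \<xi>0)"] by (simp add: minus_prod_def)
      then have e: "exp (- 2 * pi * (norm (p - c))\<^sup>2) = exp (- 2 * pi * (norm (?z - c1))\<^sup>2) * exp (- 2 * pi * (norm (?w - (x0, \<xi>0)))\<^sup>2)"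
        by (simp only: distrib_left exp_add)
      have "p \<bullet> l = ?z \<bullet> l1 + ?w \<bullet> (\<beta>, \<gamma>)" unfolding l inner_prod_def by simp
      then have i: "cis (2 * pi * (p \<bullet> l)) = cis (2 * pi * (?z \<bullet> l1)) * cis (2 * pi * (?w \<bullet> (\<beta>, \<gamma>)))"
        by (simp only: distrib_left cis_mult)
      show "(case p of (z, w) \<Rightarrow> \<Phi> z * cross_wigner f g w) = \<kappa> * ?S p"
        unfolding case_prod_beta \<Phi>_def W e i of_real_mult by (simp only: mult_ac)
    qed
    have S: "?S \<in> schwartz" by (rule schwartz_gaussian_shift)
    have "k' (\<lambda>p. \<kappa> * ?S p) = k (\<lambda>p. \<kappa> * ?S p)"
      using k(2)[unfolded wigner_kernel_identity_def, rule_format, OF fg(1,2) \<Phi>]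
        k'(2)[unfolded wigner_kernel_identity_def, rule_format, OF fg(1,2) \<Phi>]
      unfolding eq by (simp only:)
    moreover have "u (\<lambda>p. \<kappa> * ?S p) = \<kappa> * u ?S" if "tempered_distribution u" for u
      by (rule that[unfolded tempered_distribution_def, THEN conjunct2, THEN conjunct1, rule_format, OF S])
    note this[OF k(1)] this[OF k'(1)]
    ultimately show "k' ?S - k ?S = 0" using fg(3) by simp
  qed
  then show ?thesis by simp
qed

text \<open>Distributions here are functionals on all functions, while the identities between them
  hold on \<open>schwartz\<close> only; closure of \<open>schwartz\<close> under sums and multiples
  makes this enough.\<close>

lemma tempered_distribution_cong:
  assumes u: "tempered_distribution u" and eq: "\<And>\<phi>. \<phi> \<in> schwartz \<Longrightarrow> v \<phi> = u \<phi>"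
  shows "tempered_distribution v"
proof -
  obtain C N where C: "\<And>\<phi>. \<phi> \<in> schwartz \<Longrightarrow> norm (u \<phi>) \<le> C * seminorm_sum N \<phi>"
    using u unfolding tempered_distribution_def by blast
  have "\<forall>\<phi>\<in>schwartz. norm (v \<phi>) \<le> C * seminorm_sum N \<phi>" using C eq by simp
  moreover have "v (\<lambda>x. \<phi> x + \<psi> x) = v \<phi> + v \<psi>" if "\<phi> \<in> schwartz" "\<psi> \<in> schwartz" for \<phi> \<psi>
    unfolding eq[OF schwartz_add[OF that]] eq[OF that(1)] eq[OF that(2)]
    by (rule u[unfolded tempered_distribution_def, THEN conjunct1, rule_format, OF that])
  moreover have "v (\<lambda>x. c * \<phi> x) = c * v \<phi>" if "\<phi> \<in> schwartz" for c \<phi>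
    unfolding eq[OF schwartz_cmult[OF that]] eq[OF that]
    by (rule u[unfolded tempered_distribution_def, THEN conjunct2, THEN conjunct1, rule_format, OF that])
  ultimately show ?thesis unfolding tempered_distribution_def by blast
qed

theorem theorem6p2:
  fixes t :: real
  assumes "CARD('d::finite) \<in> {1, 2, 3}" and "t > 0"
  shows "(\<forall>f\<in>schwartz. wave_multiplier t f =
            convolution_measure f (wave_measure t :: (real ^ 'd) measure)) \<and>
         is_wigner_kernel
           (\<lambda>f :: real ^ 'd \<Rightarrow> complex. function_distr (wave_multiplier t f))
           (delta_kernel (wave_wigner_integral t)) \<and>
         (\<forall>\<Phi> \<in> (schwartz :: (((real ^ 'd) \<times> (real ^ 'd)) \<times> ((real ^ 'd) \<times> (real ^ 'd)) \<Rightarrow> complex) set).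
            delta_kernel (wave_wigner_integral t) \<Phi> =
            delta_kernel (wigner_distr (measure_distr (wave_measure t)) (measure_distr (wave_measure t))) \<Phi>)"
proof -
  let ?\<mu> = "wave_measure t :: (real ^ 'd) measure"
  let ?k = "delta_kernel (wave_wigner_integral t) :: (((real ^ 'd) \<times> (real ^ 'd)) \<times> ((real ^ 'd) \<times> (real ^ 'd)) \<Rightarrow> complex) \<Rightarrow> complex"
  let ?T = "\<lambda>f :: real ^ 'd \<Rightarrow> complex. function_distr (wave_multiplier t f)"
  note \<mu> = finite_wave_measure[OF assms] sets_wave_measure
  have conv: "wave_multiplier t f = convolution_measure f ?\<mu>" if "f \<in> schwartz" for f
    unfolding wave_multiplier_def
    by (rule fourier_multiplier_eq_convolution[OF that \<mu>]) (rule fourier_wave_measure[OF assms, symmetric])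
  have delta: "delta_kernel F \<Phi> = F (diagonal_slice \<Phi>)"
    for F and \<Phi> :: "((real ^ 'd) \<times> (real ^ 'd)) \<times> ((real ^ 'd) \<times> (real ^ 'd)) \<Rightarrow> complex"
    by (simp add: delta_kernel_def diagonal_slice_def)
  \<comment> \<open>Stated under \<open>slice_bounded\<close> so that it covers Schwartz \<Phi>,
    where continuity is needed, as well as \<Phi> \<otimes> W(f, g) in the kernel identity.\<close>
  have k: "?k \<Phi> = wigner_pairing ?\<mu> (diagonal_slice \<Phi>)" if "slice_bounded (diagonal_slice \<Phi>)" for \<Phi>
    unfolding delta by (rule wave_wigner_integral_eq_pairing[OF assms that])
  have T: "continuous_linear_to_tempered ?T"
  proof -
    have c: "continuous_linear_to_tempered (\<lambda>f. function_distr (convolution_measure f ?\<mu>))"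
      by (rule continuous_linear_convolution[OF \<mu>])
    show ?thesis unfolding continuous_linear_to_tempered_def
    proof (intro conjI ballI)
      show "tempered_distribution (?T f)" if "f \<in> schwartz" for f
        unfolding conv[OF that]
        by (rule c[unfolded continuous_linear_to_tempered_def, THEN conjunct1, rule_format, OF that])
      \<comment> \<open>With f as the variable, \<open>conv\<close> can be used at Schwartz
        functions only, so the two functionals are compared there instead of being rewritten into
        each other.\<close>
      show "tempered_distribution (\<lambda>f. ?T f \<phi>)" if "\<phi> \<in> schwartz" for \<phi>
      proof (rule tempered_distribution_cong)
        show "tempered_distribution (\<lambda>f. function_distr (convolution_measure f ?\<mu>) \<phi>)"
          by (rule c[unfolded continuous_linear_to_tempered_def, THEN conjunct2, rule_format, OF that])
      qed (simp only: conv)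
    qed
  qed
  have tk: "tempered_distribution ?k"
    by (rule tempered_distribution_cong[OF tempered_wigner_pairing[OF \<mu>] k[OF slice_bounded_diagonal_slice]])
  have id: "wigner_kernel_identity ?T ?k"
    unfolding wigner_kernel_identity_def
  proof (intro ballI)
    fix f g :: "real ^ 'd \<Rightarrow> complex" and \<Phi> :: "(real ^ 'd) \<times> (real ^ 'd) \<Rightarrow> complex"
    assume f: "f \<in> schwartz" and g: "g \<in> schwartz" and \<Phi>: "\<Phi> \<in> schwartz"
    show "wigner_distr (?T f) (?T g) \<Phi> = ?k (\<lambda>(z, w). \<Phi> z * cross_wigner f g w)"
      unfolding k[OF slice_bounded_wigner[OF f g \<Phi>]] conv[OF f] conv[OF g]
      by (rule wigner_pairing_convolution[OF \<mu> f g \<Phi>])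
  qed
  have "?k \<Phi> = delta_kernel (wigner_distr (measure_distr ?\<mu>) (measure_distr ?\<mu>)) \<Phi>" if "\<Phi> \<in> schwartz" for \<Phi>
    unfolding k[OF slice_bounded_diagonal_slice[OF that]]
    unfolding delta by (rule wigner_distr_measure[OF \<mu> slice_bounded_diagonal_slice[OF that], symmetric])
  then show ?thesis
    unfolding is_wigner_kernel_def
  proof (intro conjI ballI allI impI)
    show "continuous_linear_to_tempered ?T" "tempered_distribution ?k" "wigner_kernel_identity ?T ?k"
      by (rule T, rule tk, rule id)
    show "wave_multiplier t f = convolution_measure f ?\<mu>" if "f \<in> schwartz" for f by (rule conv[OF that])
    fix k' and \<Psi> :: "((real ^ 'd) \<times> (real ^ 'd)) \<times> ((real ^ 'd) \<times> (real ^ 'd)) \<Rightarrow> complex"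
    assume "tempered_distribution k' \<and> wigner_kernel_identity ?T k'" "\<Psi> \<in> schwartz"
    then show "k' \<Psi> = ?k \<Psi>" by (elim conjE) (rule wigner_kernel_unique[OF tk id])
  qed (simp_all only:)
qed

end
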